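(* Let $K$ be a field and let $N\hookrightarrow M$ be a (proper) Frobenius D2 extension of $K$-algebras with separable centralizer $R=C_M(N)$ such that the module $M_N$ is balanced. Let $A=\mathrm{End}({}_NM_N)$ (under composition) and $B=(M\otimes_NM)^N$ (with product $bb'={b'}^1b^1\otimes b^2{b'}^2$ and unit $1\otimes 1$). Then $M|N$ is a split extension if and only if $A$ is a separable $K$-algebra; and $M|N$ is a separable extension if and only if $B$ is a separable $K$-algebra.
   Context: A ring extension $N\to M$ is D2 if $M\otimes_NM$ is isomorphic to a direct summand of $\oplus^n\,{}_NM_M$ as an $N$-$M$-bimodule and of $\oplus^m\,{}_MM_N$ as an $M$-$N$-bimodule, for some $n,m\ge1$. It is Frobenius if there are an $N$-$N$-bimodule map $E:M\to N$ and finitely many $x_i,y_i\in M$ with $\sum_ix_iE(y_im)=m=\sum_iE(mx_i)y_i$ for all $m\in M$. It is split if $N$ is a direct summand of $M$ as an $N$-bimodule, and separable if the multiplication $M\otimes_NM\to M$ is a split $M$-$M$-bimodule epimorphism. $C_M(N)$ is the centralizer of $N$ in $M$, assumed to be a separable $K$-algebra. $(M\otimes_NM)^N=\{b:nb=bn\ \forall n\in N\}$, elements written $b=b^1\otimes b^2$. $M_N$ is balanced if, with $\mathcal E=\mathrm{End}(M_N)$, the natural map sending $n\in N$ to right multiplication by $n$ is a bijection $N\to\mathrm{End}({}_{\mathcal E}M)$. *)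

theory Defs
  imports
    "HOL-Algebra.Module"
    "HOL-Algebra.AbelCoset"
    "HOL-Algebra.Generated_Groups"
    "HOL-Algebra.Free_Abelian_Groups"
begin

locale assoc_algebra = module + ring M +
  assumes smult_mult_left:
      "\<lbrakk>a \<in> carrier R; x \<in> carrier M; y \<in> carrier M\<rbrakk> \<Longrightarrow>
       (a \<odot>\<^bsub>M\<^esub> x) \<otimes>\<^bsub>M\<^esub> y = a \<odot>\<^bsub>M\<^esub> (x \<otimes>\<^bsub>M\<^esub> y)"
    and smult_mult_right:
      "\<lbrakk>a \<in> carrier R; x \<in> carrier M; y \<in> carrier M\<rbrakk> \<Longrightarrow>
       x \<otimes>\<^bsub>M\<^esub> (a \<odot>\<^bsub>M\<^esub> y) = a \<odot>\<^bsub>M\<^esub> (x \<otimes>\<^bsub>M\<^esub> y)"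

definition algebra_hom ::
    "('k, 'x) ring_scheme \<Rightarrow> ('k, 'n) module \<Rightarrow> ('k, 'm) module \<Rightarrow> ('n \<Rightarrow> 'm) set" where
  "algebra_hom K N M =
     {h \<in> ring_hom N M. \<forall>k\<in>carrier K. \<forall>x\<in>carrier N. h (k \<odot>\<^bsub>N\<^esub> x) = k \<odot>\<^bsub>M\<^esub> h x}"


section \<open>Bimodules\<close>

text \<open>As for modules in \<open>HOL-Algebra.Module\<close>, the record extends that of rings and its
  multiplicative fields carry no meaning.  The acting rings are not part of the record; the sets
  of scalars \<open>S\<close> (left) and \<open>T\<close> (right) are passed separately.\<close>

record ('s, 't, 'a) bimodule = "'a ring" +
  lact :: "'s \<Rightarrow> 'a \<Rightarrow> 'a"
  ract :: "'a \<Rightarrow> 't \<Rightarrow> 'a"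

text \<open>A ring \<open>M\<close> as a bimodule by restriction of scalars along \<open>f\<close> (left) and \<open>g\<close> (right).\<close>

definition ring_bimodule ::
    "('m, 'c) ring_scheme \<Rightarrow> ('s \<Rightarrow> 'm) \<Rightarrow> ('t \<Rightarrow> 'm) \<Rightarrow> ('s, 't, 'm) bimodule" where
  "ring_bimodule M f g =
     \<lparr>carrier = carrier M, monoid.mult = monoid.mult M, one = \<one>\<^bsub>M\<^esub>, ring.zero = \<zero>\<^bsub>M\<^esub>, ring.add = ring.add M,
      lact = (\<lambda>s x. f s \<otimes>\<^bsub>M\<^esub> x), ract = (\<lambda>x t. x \<otimes>\<^bsub>M\<^esub> g t)\<rparr>"

definition bimodule_hom ::
    "'s set \<Rightarrow> 't set \<Rightarrow> ('s, 't, 'a) bimodule \<Rightarrow> ('s, 't, 'b) bimodule \<Rightarrow> ('a \<Rightarrow> 'b) set" where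
  "bimodule_hom S T P Q =
     {h \<in> hom (add_monoid P) (add_monoid Q).
        (\<forall>s\<in>S. \<forall>x\<in>carrier P. h (lact P s x) = lact Q s (h x)) \<and>
        (\<forall>t\<in>T. \<forall>x\<in>carrier P. h (ract P x t) = ract Q (h x) t)}"

definition subbimodule :: "'s set \<Rightarrow> 't set \<Rightarrow> 'a set \<Rightarrow> ('s, 't, 'a) bimodule \<Rightarrow> bool" where
  "subbimodule S T U Q \<longleftrightarrow>
     additive_subgroup U Q \<and>
     (\<forall>s\<in>S. \<forall>x\<in>U. lact Q s x \<in> U) \<and> (\<forall>t\<in>T. \<forall>x\<in>U. ract Q x t \<in> U)"

definition direct_summand :: "'s set \<Rightarrow> 't set \<Rightarrow> 'a set \<Rightarrow> ('s, 't, 'a) bimodule \<Rightarrow> bool" where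
  "direct_summand S T U Q \<longleftrightarrow>
     subbimodule S T U Q \<and>
     (\<exists>V. subbimodule S T V Q \<and> U <+>\<^bsub>Q\<^esub> V = carrier Q \<and> U \<inter> V = {\<zero>\<^bsub>Q\<^esub>})"

definition iso_to_direct_summand ::
    "'s set \<Rightarrow> 't set \<Rightarrow> ('s, 't, 'a) bimodule \<Rightarrow> ('s, 't, 'b) bimodule \<Rightarrow> bool" where
  "iso_to_direct_summand S T P Q \<longleftrightarrow>
     (\<exists>U h. direct_summand S T U Q \<and> h \<in> bimodule_hom S T P Q \<and> bij_betw h (carrier P) U)"

definition bimodule_power ::
    "nat \<Rightarrow> ('s, 't, 'a) bimodule \<Rightarrow> ('s, 't, nat \<Rightarrow> 'a) bimodule" where
  "bimodule_power n Q =
     \<lparr>carrier = {..<n} \<rightarrow>\<^sub>E carrier Q, monoid.mult = undefined, one = undefined,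
      ring.zero = (\<lambda>i\<in>{..<n}. \<zero>\<^bsub>Q\<^esub>), ring.add = (\<lambda>u v. \<lambda>i\<in>{..<n}. u i \<oplus>\<^bsub>Q\<^esub> v i),
      lact = (\<lambda>s u. \<lambda>i\<in>{..<n}. lact Q s (u i)), ract = (\<lambda>u t. \<lambda>i\<in>{..<n}. ract Q (u i) t)\<rparr>"


section \<open>Tensor products over a noncommutative ring\<close>

text \<open>The tensor product of a right module \<open>P\<close> and a left module \<open>Q\<close> over the scalars \<open>S\<close> is the
  free abelian group on \<open>carrier P \<times> carrier Q\<close> modulo the usual relators; its elements are cosets
  of formal \<open>\<int>\<close>-linear combinations of pairs.\<close>

definition pair_group ::
    "('l, 's, 'p) bimodule \<Rightarrow> ('s, 'r, 'q) bimodule \<Rightarrow> (('p \<times> 'q) \<Rightarrow>\<^sub>0 int) monoid" where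
  "pair_group P Q = free_Abelian_group (carrier P \<times> carrier Q)"

definition tensor_relators ::
    "'s set \<Rightarrow> ('l, 's, 'p) bimodule \<Rightarrow> ('s, 'r, 'q) bimodule \<Rightarrow> (('p \<times> 'q) \<Rightarrow>\<^sub>0 int) set" where
  "tensor_relators S P Q =
     {frag_of (p \<oplus>\<^bsub>P\<^esub> p', q) - frag_of (p, q) - frag_of (p', q) | p p' q.
        p \<in> carrier P \<and> p' \<in> carrier P \<and> q \<in> carrier Q} \<union>
     {frag_of (p, q \<oplus>\<^bsub>Q\<^esub> q') - frag_of (p, q) - frag_of (p, q') | p q q'.
        p \<in> carrier P \<and> q \<in> carrier Q \<and> q' \<in> carrier Q} \<union>
     {frag_of (ract P p s, q) - frag_of (p, lact Q s q) | p s q.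
        p \<in> carrier P \<and> s \<in> S \<and> q \<in> carrier Q}"

definition tensor_null ::
    "'s set \<Rightarrow> ('l, 's, 'p) bimodule \<Rightarrow> ('s, 'r, 'q) bimodule \<Rightarrow> (('p \<times> 'q) \<Rightarrow>\<^sub>0 int) set" where
  "tensor_null S P Q = generate (pair_group P Q) (tensor_relators S P Q)"

definition pure_tensor ::
    "'s set \<Rightarrow> ('l, 's, 'p) bimodule \<Rightarrow> ('s, 'r, 'q) bimodule \<Rightarrow> 'p \<Rightarrow> 'q \<Rightarrow>
     (('p \<times> 'q) \<Rightarrow>\<^sub>0 int) set" where
  "pure_tensor S P Q p q = tensor_null S P Q #>\<^bsub>pair_group P Q\<^esub> frag_of (p, q)"

definition tensor_group ::
    "'s set \<Rightarrow> ('l, 's, 'p) bimodule \<Rightarrow> ('s, 'r, 'q) bimodule \<Rightarrow>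
     ((('p \<times> 'q) \<Rightarrow>\<^sub>0 int) set) ring" where
  "tensor_group S P Q =
     \<lparr>carrier = carrier (pair_group P Q Mod tensor_null S P Q), monoid.mult = undefined, one = undefined,
      ring.zero = \<one>\<^bsub>pair_group P Q Mod tensor_null S P Q\<^esub>,
      ring.add = monoid.mult (pair_group P Q Mod tensor_null S P Q)\<rparr>"

text \<open>The additive map \<open>p \<otimes> q \<mapsto> f p q\<close> into \<open>G\<close>, evaluated on a representative of the coset
  \<open>t\<close>; for balanced biadditive \<open>f\<close> the result does not depend on the representative
  (lemma \<open>tensor_lift_coset\<close>).\<close>

definition tensor_lift ::
    "('g, 'c) ring_scheme \<Rightarrow> ('p \<Rightarrow> 'q \<Rightarrow> 'g) \<Rightarrow> (('p \<times> 'q) \<Rightarrow>\<^sub>0 int) set \<Rightarrow> 'g" where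
  "tensor_lift G f t =
     (let c = (SOME c. c \<in> t) in
      \<Oplus>\<^bsub>G\<^esub>z\<in>Poly_Mapping.keys c. [Poly_Mapping.lookup c z] \<cdot>\<^bsub>G\<^esub> f (fst z) (snd z))"

lemma tensor_lift_coset:
  assumes G: "abelian_group G" and P: "abelian_group P" and Q: "abelian_group Q"
    and actP: "\<And>p s. p \<in> carrier P \<Longrightarrow> s \<in> S \<Longrightarrow> ract P p s \<in> carrier P"
    and actQ: "\<And>q s. q \<in> carrier Q \<Longrightarrow> s \<in> S \<Longrightarrow> lact Q s q \<in> carrier Q"
    and f: "\<And>p q. p \<in> carrier P \<Longrightarrow> q \<in> carrier Q \<Longrightarrow> f p q \<in> carrier G"
    and addl: "\<And>p p' q. p \<in> carrier P \<Longrightarrow> p' \<in> carrier P \<Longrightarrow> q \<in> carrier Q \<Longrightarrow>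
                 f (p \<oplus>\<^bsub>P\<^esub> p') q = f p q \<oplus>\<^bsub>G\<^esub> f p' q"
    and addr: "\<And>p q q'. p \<in> carrier P \<Longrightarrow> q \<in> carrier Q \<Longrightarrow> q' \<in> carrier Q \<Longrightarrow>
                 f p (q \<oplus>\<^bsub>Q\<^esub> q') = f p q \<oplus>\<^bsub>G\<^esub> f p q'"
    and bal: "\<And>p s q. p \<in> carrier P \<Longrightarrow> s \<in> S \<Longrightarrow> q \<in> carrier Q \<Longrightarrow>
                 f (ract P p s) q = f p (lact Q s q)"
    and c: "c \<in> carrier (pair_group P Q)"
  shows "tensor_lift G f (tensor_null S P Q #>\<^bsub>pair_group P Q\<^esub> c) =
           (\<Oplus>\<^bsub>G\<^esub>z\<in>Poly_Mapping.keys c. [Poly_Mapping.lookup c z] \<cdot>\<^bsub>G\<^esub> f (fst z) (snd z))"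
proof -
  interpret G: abelian_group G by fact
  interpret P: abelian_group P by fact
  interpret Q: abelian_group Q by fact
  let ?A = "add_monoid G"
  let ?X = "carrier P \<times> carrier Q"
  let ?F = "free_Abelian_group ?X"
  have A: "comm_group ?A" by (rule G.a_comm_group)
  interpret F: comm_group ?F by (rule abelian_free_Abelian_group)
  have "(\<lambda>z. f (fst z) (snd z)) ` ?X \<subseteq> carrier ?A"
    using f by auto
  then obtain h where h: "h \<in> hom ?F ?A"
    and hf: "\<And>z. z \<in> ?X \<Longrightarrow> h (frag_of z) = f (fst z) (snd z)"
    by (rule comm_group.free_Abelian_group_universal[OF A]) (assumption | blast)+
  interpret h: group_hom ?F ?A h
    by (simp add: group_hom_def group_hom_axioms_def h F.is_group G.a_group)
  have pcl: "[k] \<cdot>\<^bsub>G\<^esub> x \<in> carrier G" if "x \<in> carrier G" for k :: int and x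
    using group.int_pow_closed[OF G.a_group, of x k] that by (simp add: add_pow_def)
  have hclosed: "h u \<in> carrier G" if "Poly_Mapping.keys u \<subseteq> ?X" for u
    using h.hom_closed[of u] that by simp
  have hadd: "h (u + v) = h u \<oplus>\<^bsub>G\<^esub> h v"
    if "Poly_Mapping.keys u \<subseteq> ?X" "Poly_Mapping.keys v \<subseteq> ?X" for u v
    using h.hom_mult[of u v] that by simp
  have hneg: "h (- u) = \<ominus>\<^bsub>G\<^esub> h u" if "Poly_Mapping.keys u \<subseteq> ?X" for u
    using h.hom_inv[of u] that by (simp add: a_inv_def)
  have hdiff: "h (u - v) = h u \<ominus>\<^bsub>G\<^esub> h v"
    if "Poly_Mapping.keys u \<subseteq> ?X" "Poly_Mapping.keys v \<subseteq> ?X" for u v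
    using hadd[of u "- v"] hneg[of v] that by (simp add: a_minus_def)
  have hsum: "h u = (\<Oplus>\<^bsub>G\<^esub>z\<in>Poly_Mapping.keys u. [Poly_Mapping.lookup u z] \<cdot>\<^bsub>G\<^esub> f (fst z) (snd z))"
    if u: "Poly_Mapping.keys u \<subseteq> ?X" for u
  proof -
    have *: "h (\<Sum>z\<in>I. frag_cmul (Poly_Mapping.lookup u z) (frag_of z)) =
               (\<Oplus>\<^bsub>G\<^esub>z\<in>I. [Poly_Mapping.lookup u z] \<cdot>\<^bsub>G\<^esub> f (fst z) (snd z))"
      if "finite I" "I \<subseteq> ?X" for I
      using that
    proof (induction I rule: finite_induct)
      case empty
      then show ?case using h.hom_one by simp
    next
      case (insert z I)
      have z: "z \<in> ?X" "f (fst z) (snd z) \<in> carrier G" using insert.prems f by auto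
      have keyt: "Poly_Mapping.keys (frag_cmul (Poly_Mapping.lookup u w) (frag_of w)) \<subseteq> ?X"
        if "w \<in> ?X" for w
        using that keys_cmul[of "Poly_Mapping.lookup u w" "frag_of w"] by auto
      note keyz = keyt[OF z(1)]
      have keyI: "(\<Sum>z\<in>I. frag_cmul (Poly_Mapping.lookup u z) (frag_of z)) \<in> carrier ?F"
      proof (rule sum_closed_free_Abelian_group)
        fix w assume "w \<in> I"
        then have "w \<in> ?X" using insert.prems by auto
        from keyt[OF this]
        show "frag_cmul (Poly_Mapping.lookup u w) (frag_of w) \<in> carrier ?F" by simp
      qed
      have "frag_cmul (Poly_Mapping.lookup u z) (frag_of z) =
              frag_of z [^]\<^bsub>?F\<^esub> Poly_Mapping.lookup u z"
        using z(1) by (subst int_pow_free_Abelian_group) auto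
      then have "h (frag_cmul (Poly_Mapping.lookup u z) (frag_of z)) =
                   [Poly_Mapping.lookup u z] \<cdot>\<^bsub>G\<^esub> f (fst z) (snd z)"
        using h.hom_int_pow[of "frag_of z" "Poly_Mapping.lookup u z"] hf[OF z(1)] z(1)
        by (simp add: add_pow_def)
      moreover have "(\<lambda>z. [Poly_Mapping.lookup u z] \<cdot>\<^bsub>G\<^esub> f (fst z) (snd z)) \<in> I \<rightarrow> carrier G"
      proof
        fix w assume "w \<in> I"
        then have "w \<in> ?X" using insert.prems by auto
        then have "f (fst w) (snd w) \<in> carrier G" using f by auto
        then show "[Poly_Mapping.lookup u w] \<cdot>\<^bsub>G\<^esub> f (fst w) (snd w) \<in> carrier G" by (rule pcl)
      qed
      ultimately show ?case
        using insert.hyps insert.IH insert.prems hadd[OF keyz] keyI pcl[OF z(2)]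
        by (simp add: G.finsum_insert)
    qed
    show ?thesis
      using *[of "Poly_Mapping.keys u"] u frag_expansion[of u]
      by (simp add: frag_extend_def)
  qed
  have R: "tensor_relators S P Q \<subseteq> kernel ?F ?A h"
  proof
    fix u assume "u \<in> tensor_relators S P Q"
    then consider (l) p p' q where
        "u = frag_of (p \<oplus>\<^bsub>P\<^esub> p', q) - frag_of (p, q) - frag_of (p', q)"
        "p \<in> carrier P" "p' \<in> carrier P" "q \<in> carrier Q"
      | (r) p q q' where
        "u = frag_of (p, q \<oplus>\<^bsub>Q\<^esub> q') - frag_of (p, q) - frag_of (p, q')"
        "p \<in> carrier P" "q \<in> carrier Q" "q' \<in> carrier Q"
      | (b) p s q where "u = frag_of (ract P p s, q) - frag_of (p, lact Q s q)"
        "p \<in> carrier P" "s \<in> S" "q \<in> carrier Q"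
      unfolding tensor_relators_def by blast
    then show "u \<in> kernel ?F ?A h"
    proof cases
      case l
      have k: "Poly_Mapping.keys (frag_of (p \<oplus>\<^bsub>P\<^esub> p', q) - frag_of (p, q)) \<subseteq> ?X"
        using l by (intro order_trans[OF keys_diff]) auto
      have "Poly_Mapping.keys u \<subseteq> ?X"
        unfolding l(1) by (intro order_trans[OF keys_diff] Un_least k) (use l in auto)
      moreover have "h u = \<zero>\<^bsub>G\<^esub>"
        unfolding l(1) using l f by (simp add: hdiff k hf addl G.minus_add G.a_ac a_minus_def
            G.r_neg G.r_neg1 G.r_neg2)
      ultimately show ?thesis by (simp add: kernel_def)
    next
      case r
      have k: "Poly_Mapping.keys (frag_of (p, q \<oplus>\<^bsub>Q\<^esub> q') - frag_of (p, q)) \<subseteq> ?X"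
        using r by (intro order_trans[OF keys_diff]) auto
      have "Poly_Mapping.keys u \<subseteq> ?X"
        unfolding r(1) by (intro order_trans[OF keys_diff] Un_least k) (use r in auto)
      moreover have "h u = \<zero>\<^bsub>G\<^esub>"
        unfolding r(1) using r f by (simp add: hdiff k hf addr G.minus_add G.a_ac a_minus_def
            G.r_neg G.r_neg1 G.r_neg2)
      ultimately show ?thesis by (simp add: kernel_def)
    next
      case b
      have "Poly_Mapping.keys u \<subseteq> ?X"
        unfolding b(1) by (intro order_trans[OF keys_diff] Un_least) (use b actP actQ in auto)
      moreover have "h u = \<zero>\<^bsub>G\<^esub>"
        unfolding b(1) using b f actP actQ by (simp add: hdiff hf bal a_minus_def G.r_neg)
      ultimately show ?thesis by (simp add: kernel_def)
    qed
  qed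
  have null: "tensor_null S P Q \<subseteq> kernel ?F ?A h"
    unfolding tensor_null_def pair_group_def
    by (rule F.generate_subgroup_incl[OF R h.subgroup_kernel])
  have "\<one>\<^bsub>?F\<^esub> \<in> tensor_null S P Q"
    unfolding tensor_null_def pair_group_def by (rule generate.one)
  then have "c \<in> tensor_null S P Q #>\<^bsub>pair_group P Q\<^esub> c"
    by (force simp: r_coset_def pair_group_def)
  then have "(SOME u. u \<in> tensor_null S P Q #>\<^bsub>pair_group P Q\<^esub> c) \<in> tensor_null S P Q #>\<^bsub>pair_group P Q\<^esub> c"
    (is "?u \<in> _") by (rule someI)
  then obtain v where v: "v \<in> tensor_null S P Q" "?u = v + c"
    by (auto simp: r_coset_def pair_group_def)
  have kv: "Poly_Mapping.keys v \<subseteq> ?X" "h v = \<zero>\<^bsub>G\<^esub>" using v(1) null by (auto simp: kernel_def)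
  have kc: "Poly_Mapping.keys c \<subseteq> ?X" using c by (simp add: pair_group_def)
  have "Poly_Mapping.keys ?u \<subseteq> ?X"
    unfolding v(2) using kv kc keys_add[of v c] by blast
  moreover have "h ?u = h c"
    unfolding v(2) using hadd[OF kv(1) kc] kv hclosed[OF kc] by simp
  ultimately show ?thesis
    unfolding tensor_lift_def Let_def using hsum[of ?u] hsum[OF kc] by simp
qed

definition tensor_product ::
    "'s set \<Rightarrow> ('l, 's, 'p) bimodule \<Rightarrow> ('s, 'r, 'q) bimodule \<Rightarrow>
     ('l, 'r, (('p \<times> 'q) \<Rightarrow>\<^sub>0 int) set) bimodule" where
  "tensor_product S P Q =
     \<lparr>carrier = carrier (tensor_group S P Q), monoid.mult = undefined, one = undefined,
      ring.zero = \<zero>\<^bsub>tensor_group S P Q\<^esub>, ring.add = ring.add (tensor_group S P Q),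
      lact = (\<lambda>l. tensor_lift (tensor_group S P Q) (\<lambda>p q. pure_tensor S P Q (lact P l p) q)),
      ract = (\<lambda>t r. tensor_lift (tensor_group S P Q) (\<lambda>p q. pure_tensor S P Q p (ract Q q r)) t)\<rparr>"


section \<open>Ring extensions\<close>

text \<open>A ring extension \<open>N \<rightarrow> M\<close> is given by a ring homomorphism \<open>\<iota>\<close>, not assumed injective in
  the definitions.  Below, \<open>f\<close> and \<open>g\<close> (each \<open>\<iota>\<close> or \<open>id\<close>) determine which ring acts on the
  left and on the right of \<open>M \<otimes>\<^sub>N M\<close>.\<close>

definition tensor_square ::
    "('n, 'd) ring_scheme \<Rightarrow> ('m, 'c) ring_scheme \<Rightarrow> ('n \<Rightarrow> 'm) \<Rightarrow> ('s \<Rightarrow> 'm) \<Rightarrow> ('t \<Rightarrow> 'm) \<Rightarrow>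
     ('s, 't, (('m \<times> 'm) \<Rightarrow>\<^sub>0 int) set) bimodule" where
  "tensor_square N M \<iota> f g =
     tensor_product (carrier N) (ring_bimodule M f \<iota>) (ring_bimodule M \<iota> g)"

definition D2_extension ::
    "('n, 'd) ring_scheme \<Rightarrow> ('m, 'c) ring_scheme \<Rightarrow> ('n \<Rightarrow> 'm) \<Rightarrow> bool" where
  "D2_extension N M \<iota> \<longleftrightarrow>
     (\<exists>n\<ge>1. iso_to_direct_summand (carrier N) (carrier M)
        (tensor_square N M \<iota> \<iota> id) (bimodule_power n (ring_bimodule M \<iota> id))) \<and>
     (\<exists>m\<ge>1. iso_to_direct_summand (carrier M) (carrier N)
        (tensor_square N M \<iota> id \<iota>) (bimodule_power m (ring_bimodule M id \<iota>)))"

definition frobenius_extension ::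
    "('n, 'd) ring_scheme \<Rightarrow> ('m, 'c) ring_scheme \<Rightarrow> ('n \<Rightarrow> 'm) \<Rightarrow> bool" where
  "frobenius_extension N M \<iota> \<longleftrightarrow>
     (\<exists>E \<in> bimodule_hom (carrier N) (carrier N) (ring_bimodule M \<iota> \<iota>) (ring_bimodule N id id).
      \<exists>(k::nat) x y. x \<in> {..<k} \<rightarrow> carrier M \<and> y \<in> {..<k} \<rightarrow> carrier M \<and>
        (\<forall>m\<in>carrier M.
           (\<Oplus>\<^bsub>M\<^esub>i\<in>{..<k}. x i \<otimes>\<^bsub>M\<^esub> \<iota> (E (y i \<otimes>\<^bsub>M\<^esub> m))) = m \<and>
           (\<Oplus>\<^bsub>M\<^esub>i\<in>{..<k}. \<iota> (E (m \<otimes>\<^bsub>M\<^esub> x i)) \<otimes>\<^bsub>M\<^esub> y i) = m))"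

definition split_extension ::
    "('n, 'd) ring_scheme \<Rightarrow> ('m, 'c) ring_scheme \<Rightarrow> ('n \<Rightarrow> 'm) \<Rightarrow> bool" where
  "split_extension N M \<iota> \<longleftrightarrow>
     direct_summand (carrier N) (carrier N) (\<iota> ` carrier N) (ring_bimodule M \<iota> \<iota>)"

definition separable_extension ::
    "('n, 'd) ring_scheme \<Rightarrow> ('m, 'c) ring_scheme \<Rightarrow> ('n \<Rightarrow> 'm) \<Rightarrow> bool" where
  "separable_extension N M \<iota> \<longleftrightarrow>
     (\<exists>\<sigma> \<in> bimodule_hom (carrier M) (carrier M)
             (ring_bimodule M id id) (tensor_square N M \<iota> id id).
        \<forall>x\<in>carrier M. tensor_lift M (\<lambda>a b. a \<otimes>\<^bsub>M\<^esub> b) (\<sigma> x) = x)"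

definition separable_algebra :: "('k, 'x) ring_scheme \<Rightarrow> ('k, 'a) module \<Rightarrow> bool" where
  "separable_algebra K A \<longleftrightarrow>
     assoc_algebra K A \<and> separable_extension K A (\<lambda>k. k \<odot>\<^bsub>A\<^esub> \<one>\<^bsub>A\<^esub>)"

text \<open>Endomorphisms are taken extensional, so that equality of functions is equality on
  \<open>carrier M\<close>.\<close>

definition right_End :: "('n, 'd) ring_scheme \<Rightarrow> ('m, 'c) ring_scheme \<Rightarrow> ('n \<Rightarrow> 'm) \<Rightarrow> ('m \<Rightarrow> 'm) set"
  where
  "right_End N M \<iota> =
     {h \<in> hom (add_monoid M) (add_monoid M) \<inter> extensional (carrier M).
        \<forall>x\<in>carrier M. \<forall>n\<in>carrier N. h (x \<otimes>\<^bsub>M\<^esub> \<iota> n) = h x \<otimes>\<^bsub>M\<^esub> \<iota> n}"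

definition balanced_extension ::
    "('n, 'd) ring_scheme \<Rightarrow> ('m, 'c) ring_scheme \<Rightarrow> ('n \<Rightarrow> 'm) \<Rightarrow> bool" where
  "balanced_extension N M \<iota> \<longleftrightarrow>
     bij_betw (\<lambda>n. \<lambda>x\<in>carrier M. x \<otimes>\<^bsub>M\<^esub> \<iota> n) (carrier N)
       {g \<in> hom (add_monoid M) (add_monoid M) \<inter> extensional (carrier M).
          \<forall>h\<in>right_End N M \<iota>. \<forall>x\<in>carrier M. g (h x) = h (g x)}"

definition centralizer_algebra ::
    "('k, 'n) module \<Rightarrow> ('k, 'm) module \<Rightarrow> ('n \<Rightarrow> 'm) \<Rightarrow> ('k, 'm) module" where
  "centralizer_algebra N M \<iota> =
     M\<lparr>carrier := {r \<in> carrier M. \<forall>n\<in>carrier N. \<iota> n \<otimes>\<^bsub>M\<^esub> r = r \<otimes>\<^bsub>M\<^esub> \<iota> n}\<rparr>"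

definition bimodule_End_algebra ::
    "('k, 'n) module \<Rightarrow> ('k, 'm) module \<Rightarrow> ('n \<Rightarrow> 'm) \<Rightarrow> ('k, 'm \<Rightarrow> 'm) module" where
  "bimodule_End_algebra N M \<iota> =
     \<lparr>carrier = bimodule_hom (carrier N) (carrier N) (ring_bimodule M \<iota> \<iota>) (ring_bimodule M \<iota> \<iota>)
                  \<inter> extensional (carrier M),
      monoid.mult = (\<lambda>g h. compose (carrier M) g h),
      one = (\<lambda>x\<in>carrier M. x),
      ring.zero = (\<lambda>x\<in>carrier M. \<zero>\<^bsub>M\<^esub>),
      ring.add = (\<lambda>g h. \<lambda>x\<in>carrier M. g x \<oplus>\<^bsub>M\<^esub> h x),
      smult = (\<lambda>k h. \<lambda>x\<in>carrier M. k \<odot>\<^bsub>M\<^esub> h x)\<rparr>"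

text \<open>On \<open>(M \<otimes>\<^sub>N M)\<^sup>N\<close> the product \<open>b b'\<close> is the image of \<open>b'\<close> under the map
  \<open>x \<otimes> y \<mapsto> x b y\<close>, which is balanced because \<open>b\<close> commutes with \<open>N\<close>; written out it is
  \<open>b'\<^sup>1 b\<^sup>1 \<otimes> b\<^sup>2 b'\<^sup>2\<close>.\<close>

definition tensor_invariant_algebra ::
    "('k, 'n) module \<Rightarrow> ('k, 'm) module \<Rightarrow> ('n \<Rightarrow> 'm) \<Rightarrow>
     ('k, (('m \<times> 'm) \<Rightarrow>\<^sub>0 int) set) module" where
  "tensor_invariant_algebra N M \<iota> =
     (let T = tensor_square N M \<iota> id id in
      \<lparr>carrier = {b \<in> carrier T. \<forall>n\<in>carrier N. lact T (\<iota> n) b = ract T b (\<iota> n)},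
       monoid.mult = (\<lambda>b b'. tensor_lift T (\<lambda>x y. ract T (lact T x b) y) b'),
       one = pure_tensor (carrier N) (ring_bimodule M id \<iota>) (ring_bimodule M \<iota> id) \<one>\<^bsub>M\<^esub> \<one>\<^bsub>M\<^esub>,
       ring.zero = \<zero>\<^bsub>T\<^esub>,
       ring.add = ring.add T,
       smult = (\<lambda>k b. lact T (k \<odot>\<^bsub>M\<^esub> \<one>\<^bsub>M\<^esub>) b)\<rparr>)"

end

(*
  Write M (x) M for the tensor square over N.  Depth two yields quasibases b_k, invariant under N,
  and bimodule endomorphisms beta_k with m (x) 1 = sum_k b_k beta_k(m).  All four implications are
  explicit constructions with them.

  If u_k, v_k are elements of A (or B) such that sum_k u_k v_k = 1 and sum_k u_k (x)_R v_k is
  central, then composing with a separability element of R gives one over K.  For A, given a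
  bimodule projection F of M onto N, take u_k(m) = b_k^1 F(b_k^2 m) and v_k = beta_k.  For B, given
  a separability element s of M|N, take u_k = b_k and v_k = s^1 (x) beta_k(s^2).

  Conversely, a separability element e of A gives F(m) = e^1(e^2(1) m), whose values satisfy
  gamma(F(m)) = gamma(1) F(m) for all gamma in A and hence lie in N because M_N is balanced.  A
  separability element g of B gives t = g^1 r(g^2), where r maps B to R and is defined by
  sum_i x_i b y_i = sum_i x_i (x) r(b) y_i.  Expanding in quasibases shows
  t = tau sum_i x_i (x) y_i with tau in R, and sum_i x_i tau (x) y_i is a separability element.
*)
theory Submission
  imports Defs
begin

section \<open>Additive maps and tensor products\<close>

text \<open>Write \<open>t = t^1 (x) t^2\<close>, with sums suppressed. Centrality of the dual bases
  comes from one matrix. Every \<open>t\<close> equals \<open>sum_k b_k \<beta>_k(t^1) t^2\<close>,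
  and for invariant \<open>t\<close> the coefficients lie in \<open>R\<close>. Expanding
  \<open>g b_l\<close>, for \<open>g\<close> in \<open>A\<close> or \<open>B\<close>, gives
  \<open>\<rho>\<close> over \<open>R\<close> with \<open>g u_l = sum_k u_k \<rho>_kl\<close>, and
  the same \<open>\<rho>\<close> satisfies \<open>v_k g = sum_l \<rho>_kl v_l\<close>. The two
  converses share a pattern. Each algebra has a counit-like map to \<open>R\<close>:
  \<open>\<gamma> \<mapsto> \<gamma>(1)\<close> on \<open>A\<close>, and \<open>r\<close> on
  \<open>B\<close>. Sending the second factor of a separability element through it yields an element
  on which the whole algebra acts only through that map. The map \<open>r\<close> exists because the
  \<open>M\<close>-central elements of \<open>M (x) M\<close> are exactly those of the form
  \<open>sum_i x_i (x) \<rho> y_i\<close> with \<open>\<rho>\<close> in \<open>R\<close>, and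
  \<open>B\<close> acts on them. The obstacle is formal: tensors are cosets, and elements such as
  \<open>b_k\<close> or \<open>s\<close> come without a decomposition into pure tensors. So every
  expression in \<open>t^1\<close> and \<open>t^2\<close> is an additive map on
  \<open>M (x) M\<close>, and identities are stated for arbitrary tensors even when one special
  element is meant.\<close>

abbreviation addhom :: "('a, 'c) ring_scheme \<Rightarrow> ('b, 'd) ring_scheme \<Rightarrow> ('a \<Rightarrow> 'b) set" where
  "addhom G H \<equiv> hom (add_monoid G) (add_monoid H)"

lemma addhomI:
  assumes "\<And>x. x \<in> carrier G \<Longrightarrow> h x \<in> carrier H"
    and "\<And>x y. x \<in> carrier G \<Longrightarrow> y \<in> carrier G \<Longrightarrow> h (x \<oplus>\<^bsub>G\<^esub> y) = h x \<oplus>\<^bsub>H\<^esub> h y"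
  shows "h \<in> addhom G H"
  using assms by (auto simp: hom_def)

lemma addhom_closed: "h \<in> addhom G H \<Longrightarrow> x \<in> carrier G \<Longrightarrow> h x \<in> carrier H"
  by (auto simp: hom_def)

lemma addhom_add:
  "h \<in> addhom G H \<Longrightarrow> x \<in> carrier G \<Longrightarrow> y \<in> carrier G \<Longrightarrow> h (x \<oplus>\<^bsub>G\<^esub> y) = h x \<oplus>\<^bsub>H\<^esub> h y"
  by (auto simp: hom_def)

lemma addhom_comp: "h \<in> addhom G H \<Longrightarrow> k \<in> addhom H L \<Longrightarrow> (\<lambda>x. k (h x)) \<in> addhom G L"
  by (auto simp: hom_def Pi_def)

lemma addhom_id: "(\<lambda>x. x) \<in> addhom G G"
  by (auto simp: hom_def)

lemma addhom_zero:
  assumes "abelian_group G" "abelian_group H" "h \<in> addhom G H"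
  shows "h \<zero>\<^bsub>G\<^esub> = \<zero>\<^bsub>H\<^esub>"
proof -
  interpret group_hom "add_monoid G" "add_monoid H" h
    using assms by (simp add: group_hom_def group_hom_axioms_def abelian_group.a_group)
  show ?thesis using hom_one by simp
qed

lemma addhom_uminus:
  assumes "abelian_group G" "abelian_group H" "h \<in> addhom G H" "x \<in> carrier G"
  shows "h (\<ominus>\<^bsub>G\<^esub> x) = \<ominus>\<^bsub>H\<^esub> h x"
proof -
  interpret group_hom "add_monoid G" "add_monoid H" h
    using assms by (simp add: group_hom_def group_hom_axioms_def abelian_group.a_group)
  show ?thesis using hom_inv[of x] assms(4) by (simp add: a_inv_def)
qed

lemma addhom_minus:
  assumes "abelian_group G" "abelian_group H" "h \<in> addhom G H" "x \<in> carrier G" "y \<in> carrier G"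
  shows "h (x \<ominus>\<^bsub>G\<^esub> y) = h x \<ominus>\<^bsub>H\<^esub> h y"
  using assms addhom_add[of h G H x "\<ominus>\<^bsub>G\<^esub> y"]
  by (simp add: a_minus_def addhom_uminus abelian_group.a_inv_closed)

lemma addhom_finsum:
  assumes "abelian_group G" "abelian_group H" "h \<in> addhom G H"
    and "finite I" "f \<in> I \<rightarrow> carrier G"
  shows "h (\<Oplus>\<^bsub>G\<^esub>i\<in>I. f i) = (\<Oplus>\<^bsub>H\<^esub>i\<in>I. h (f i))"
proof -
  interpret G: abelian_group G by fact
  interpret H: abelian_group H by fact
  show ?thesis using assms(4,5)
  proof (induction I rule: finite_induct)
    case empty
    then show ?case using addhom_zero[OF assms(1-3)] by simp
  next
    case (insert i I)
    have "(\<lambda>i. h (f i)) \<in> I \<rightarrow> carrier H" "h (f i) \<in> carrier H"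
      using insert.prems addhom_closed[OF assms(3)] by auto
    then show ?case
      using insert addhom_add[OF assms(3)] by (simp add: Pi_def)
  qed
qed

lemma addhom_sum:
  assumes "abelian_group G" "abelian_group H" "finite I" "\<And>i. i \<in> I \<Longrightarrow> h i \<in> addhom G H"
  shows "(\<lambda>x. \<Oplus>\<^bsub>H\<^esub>i\<in>I. h i x) \<in> addhom G H"
proof -
  interpret G: abelian_group G by fact
  interpret H: abelian_group H by fact
  have cl: "h i x \<in> carrier H" if "i \<in> I" "x \<in> carrier G" for i x
    using addhom_closed[OF assms(4)] that by blast
  show ?thesis
  proof (rule addhomI)
    fix x y assume xy: "x \<in> carrier G" "y \<in> carrier G"
    have "(\<Oplus>\<^bsub>H\<^esub>i\<in>I. h i (x \<oplus>\<^bsub>G\<^esub> y)) = (\<Oplus>\<^bsub>H\<^esub>i\<in>I. h i x \<oplus>\<^bsub>H\<^esub> h i y)"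
      using xy cl by (intro H.finsum_cong') (auto simp: addhom_add[OF assms(4)])
    then show "(\<Oplus>\<^bsub>H\<^esub>i\<in>I. h i (x \<oplus>\<^bsub>G\<^esub> y)) = (\<Oplus>\<^bsub>H\<^esub>i\<in>I. h i x) \<oplus>\<^bsub>H\<^esub> (\<Oplus>\<^bsub>H\<^esub>i\<in>I. h i y)"
      using xy cl by (simp add: H.finsum_addf)
  qed (use cl in auto)
qed

lemma bimodule_hom_add: "h \<in> bimodule_hom S T P Q \<Longrightarrow> h \<in> addhom P Q"
  by (simp add: bimodule_hom_def)

lemma bimodule_hom_lact:
  "h \<in> bimodule_hom S T P Q \<Longrightarrow> s \<in> S \<Longrightarrow> x \<in> carrier P \<Longrightarrow> h (lact P s x) = lact Q s (h x)"
  by (simp add: bimodule_hom_def)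

lemma bimodule_hom_ract:
  "h \<in> bimodule_hom S T P Q \<Longrightarrow> t \<in> T \<Longrightarrow> x \<in> carrier P \<Longrightarrow> h (ract P x t) = ract Q (h x) t"
  by (simp add: bimodule_hom_def)

lemma abelian_group_cong:
  assumes G: "abelian_group G"
    and eq: "carrier H = carrier G" "\<zero>\<^bsub>H\<^esub> = \<zero>\<^bsub>G\<^esub>" "add H = add G"
  shows "abelian_group H"
proof -
  interpret G: abelian_group G by fact
  show ?thesis
    by (rule abelian_groupI) (auto simp: eq G.a_ac intro: G.l_neg bexI[of _ "\<ominus>\<^bsub>G\<^esub> _"])
qed

lemma addhom_cong:
  assumes "carrier G' = carrier G" "add G' = add G" "carrier H' = carrier H" "add H' = add H"
  shows "addhom G' H' = addhom G H"
  using assms by (simp add: hom_def)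

lemma (in abelian_monoid) finsum_swap:
  assumes "finite I" "finite J" "\<And>i j. i \<in> I \<Longrightarrow> j \<in> J \<Longrightarrow> f i j \<in> carrier G"
  shows "(\<Oplus>i\<in>I. \<Oplus>j\<in>J. f i j) = (\<Oplus>j\<in>J. \<Oplus>i\<in>I. f i j)"
  using assms(1,3)
proof (induction I rule: finite_induct)
  case empty
  then show ?case by simp
next
  case (insert i I)
  have cl: "f i' j \<in> carrier G" if "i' \<in> insert i I" "j \<in> J" for i' j
    using insert.prems that by blast
  have "(\<Oplus>j\<in>J. \<Oplus>i\<in>insert i I. f i j) = (\<Oplus>j\<in>J. f i j \<oplus> (\<Oplus>i\<in>I. f i j))"
    using insert.hyps cl by (intro finsum_cong') (auto simp: finsum_insert Pi_def intro!: finsum_closed)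
  also have "\<dots> = (\<Oplus>j\<in>J. f i j) \<oplus> (\<Oplus>j\<in>J. \<Oplus>i\<in>I. f i j)"
    using cl by (intro finsum_addf) (auto intro!: finsum_closed)
  finally show ?case
    using insert cl by (simp add: finsum_insert Pi_def)
qed

section \<open>Tensor products over a set of scalars and their universal property\<close>

locale tensor_pair =
  P: abelian_group P + Q: abelian_group Q
  for S :: "'s set" and P :: "('l, 's, 'p) bimodule" and Q :: "('s, 'r, 'q) bimodule" +
  assumes ract_closed: "p \<in> carrier P \<Longrightarrow> s \<in> S \<Longrightarrow> ract P p s \<in> carrier P"
    and lact_closed: "q \<in> carrier Q \<Longrightarrow> s \<in> S \<Longrightarrow> lact Q s q \<in> carrier Q"
begin

abbreviation "F \<equiv> pair_group P Q"
abbreviation "Z \<equiv> tensor_null S P Q"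
abbreviation "TG \<equiv> tensor_group S P Q"

lemma comm_group_F: "comm_group F"
  unfolding pair_group_def by (rule abelian_free_Abelian_group)

lemma relators_subset: "tensor_relators S P Q \<subseteq> carrier F"
proof
  let ?X = "carrier P \<times> carrier Q"
  fix u assume "u \<in> tensor_relators S P Q"
  then consider (l) p p' q where
      "u = frag_of (p \<oplus>\<^bsub>P\<^esub> p', q) - frag_of (p, q) - frag_of (p', q)"
      "p \<in> carrier P" "p' \<in> carrier P" "q \<in> carrier Q"
    | (r) p q q' where
      "u = frag_of (p, q \<oplus>\<^bsub>Q\<^esub> q') - frag_of (p, q) - frag_of (p, q')"
      "p \<in> carrier P" "q \<in> carrier Q" "q' \<in> carrier Q"
    | (b) p s q where "u = frag_of (ract P p s, q) - frag_of (p, lact Q s q)"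
      "p \<in> carrier P" "s \<in> S" "q \<in> carrier Q"
    unfolding tensor_relators_def by blast
  then have "Poly_Mapping.keys u \<subseteq> ?X"
  proof cases
    case l
    then show ?thesis unfolding l(1)
      by (intro order_trans[OF keys_diff] Un_least) auto
  next
    case r
    then show ?thesis unfolding r(1)
      by (intro order_trans[OF keys_diff] Un_least) auto
  next
    case b
    then show ?thesis unfolding b(1)
      by (intro order_trans[OF keys_diff] Un_least) (auto simp: ract_closed lact_closed)
  qed
  then show "u \<in> carrier F" by (simp add: pair_group_def)
qed

lemma subgroup_Z: "subgroup Z F"
  unfolding tensor_null_def
  by (intro group.generate_is_subgroup relators_subset comm_group.axioms(2) comm_group_F)

lemma normal_Z: "Z \<lhd> F"
  by (rule comm_group.subgroup_imp_normal[OF comm_group_F subgroup_Z])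

lemma add_monoid_TG: "add_monoid TG = F Mod Z"
  by (simp add: tensor_group_def FactGroup_def)

lemma abelian_group_TG: "abelian_group TG"
  by (rule comm_group_abelian_groupI)
    (unfold add_monoid_TG, rule comm_group.abelian_FactGroup[OF comm_group_F subgroup_Z])

lemma carrier_TG: "carrier TG = (\<lambda>c. Z #>\<^bsub>F\<^esub> c) ` carrier F"
  by (auto simp: tensor_group_def FactGroup_def RCOSETS_def)

lemma coset_hom: "(\<lambda>c. Z #>\<^bsub>F\<^esub> c) \<in> hom F (add_monoid TG)"
  unfolding add_monoid_TG by (rule normal.r_coset_hom_Mod[OF normal_Z])

lemma coset_diff:
  assumes "a \<in> carrier F" "b \<in> carrier F"
  shows "Z #>\<^bsub>F\<^esub> (a - b) = (Z #>\<^bsub>F\<^esub> a) \<ominus>\<^bsub>TG\<^esub> (Z #>\<^bsub>F\<^esub> b)"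
proof -
  interpret F: comm_group F by (rule comm_group_F)
  interpret group_hom F "add_monoid TG" "\<lambda>c. Z #>\<^bsub>F\<^esub> c"
    using coset_hom abelian_group.a_group[OF abelian_group_TG] F.is_group
    by (simp add: group_hom_def group_hom_axioms_def)
  have "a - b = a \<otimes>\<^bsub>F\<^esub> inv\<^bsub>F\<^esub> b"
    using assms by (simp add: pair_group_def)
  then show ?thesis
    using assms by (simp add: a_minus_def a_inv_def)
qed

lemma coset_eqI:
  assumes "a - b \<in> tensor_relators S P Q" "a \<in> carrier F" "b \<in> carrier F"
  shows "Z #>\<^bsub>F\<^esub> a = Z #>\<^bsub>F\<^esub> b"
proof -
  interpret F: comm_group F by (rule comm_group_F)
  have "a - b \<in> Z"
    unfolding tensor_null_def by (rule generate.incl[OF assms(1)])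
  then have "a \<in> Z #>\<^bsub>F\<^esub> b"
    by (force simp: r_coset_def pair_group_def)
  then show ?thesis
    using F.repr_independence[OF _ assms(3) subgroup_Z] by simp
qed

lemma frag_pair: "p \<in> carrier P \<Longrightarrow> q \<in> carrier Q \<Longrightarrow> frag_of (p, q) \<in> carrier F"
  by (simp add: pair_group_def)

lemma F_add: "a \<in> carrier F \<Longrightarrow> b \<in> carrier F \<Longrightarrow> a + b \<in> carrier F"
  using group.is_monoid[OF comm_group.axioms(2)[OF comm_group_F]] monoid.m_closed[of F a b]
  by (simp add: pair_group_def)

lemma coset_add:
  "a \<in> carrier F \<Longrightarrow> b \<in> carrier F \<Longrightarrow>
   Z #>\<^bsub>F\<^esub> (a + b) = (Z #>\<^bsub>F\<^esub> a) \<oplus>\<^bsub>TG\<^esub> (Z #>\<^bsub>F\<^esub> b)"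
  using hom_mult[OF coset_hom, of a b] by (simp add: pair_group_def)

lemma pure_tensor_closed:
  "p \<in> carrier P \<Longrightarrow> q \<in> carrier Q \<Longrightarrow> pure_tensor S P Q p q \<in> carrier TG"
  unfolding pure_tensor_def carrier_TG using frag_pair by blast

lemma pure_tensor_add_left:
  assumes "p \<in> carrier P" "p' \<in> carrier P" "q \<in> carrier Q"
  shows "pure_tensor S P Q (p \<oplus>\<^bsub>P\<^esub> p') q = pure_tensor S P Q p q \<oplus>\<^bsub>TG\<^esub> pure_tensor S P Q p' q"
  unfolding pure_tensor_def using assms
  by (subst coset_add[symmetric], simp_all add: frag_pair, intro coset_eqI)
    (auto intro: frag_pair F_add simp: tensor_relators_def diff_diff_eq[symmetric])

lemma pure_tensor_add_right:
  assumes "p \<in> carrier P" "q \<in> carrier Q" "q' \<in> carrier Q"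
  shows "pure_tensor S P Q p (q \<oplus>\<^bsub>Q\<^esub> q') = pure_tensor S P Q p q \<oplus>\<^bsub>TG\<^esub> pure_tensor S P Q p q'"
  unfolding pure_tensor_def using assms
  by (subst coset_add[symmetric], simp_all add: frag_pair, intro coset_eqI)
    (auto intro: frag_pair F_add simp: tensor_relators_def diff_diff_eq[symmetric])

lemma pure_tensor_balanced:
  assumes "p \<in> carrier P" "s \<in> S" "q \<in> carrier Q"
  shows "pure_tensor S P Q (ract P p s) q = pure_tensor S P Q p (lact Q s q)"
  unfolding pure_tensor_def using assms
  by (intro coset_eqI) (auto intro!: frag_pair ract_closed lact_closed simp: tensor_relators_def)

text \<open>The pure tensors generate the quotient group, so induction over differences of formal
  sums suffices. Through \<open>T_eqI\<close> this is how nearly every later identity about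
  unspecified tensors is proved.\<close>

lemma tensor_hom_eqI:
  assumes H: "abelian_group H" and h: "h \<in> addhom TG H" and k: "k \<in> addhom TG H"
    and eq: "\<And>p q. p \<in> carrier P \<Longrightarrow> q \<in> carrier Q \<Longrightarrow>
               h (pure_tensor S P Q p q) = k (pure_tensor S P Q p q)"
    and t: "t \<in> carrier TG"
  shows "h t = k t"
proof -
  note G = abelian_group_TG
  obtain c where c: "c \<in> carrier F" "t = Z #>\<^bsub>F\<^esub> c" using t carrier_TG by blast
  have "c \<in> carrier F \<and> h (Z #>\<^bsub>F\<^esub> c) = k (Z #>\<^bsub>F\<^esub> c)"
  proof (rule frag_induction[of c "carrier P \<times> carrier Q"])
    show "Poly_Mapping.keys c \<subseteq> carrier P \<times> carrier Q" using c(1) by (simp add: pair_group_def)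
    have z: "Z #>\<^bsub>F\<^esub> 0 = \<zero>\<^bsub>TG\<^esub>"
      using group.coset_mult_one[OF comm_group.axioms(2)[OF comm_group_F],
          OF subgroup.subset[OF subgroup_Z]]
      by (simp add: tensor_group_def FactGroup_def pair_group_def)
    show "0 \<in> carrier F \<and> h (Z #>\<^bsub>F\<^esub> 0) = k (Z #>\<^bsub>F\<^esub> 0)"
      using addhom_zero[OF G H h] addhom_zero[OF G H k] z by (simp add: pair_group_def)
  next
    fix x assume "x \<in> carrier P \<times> carrier Q"
    then show "frag_of x \<in> carrier F \<and> h (Z #>\<^bsub>F\<^esub> frag_of x) = k (Z #>\<^bsub>F\<^esub> frag_of x)"
      using eq by (auto simp: pure_tensor_def frag_pair)
  next
    fix a b
    assume a: "a \<in> carrier F \<and> h (Z #>\<^bsub>F\<^esub> a) = k (Z #>\<^bsub>F\<^esub> a)"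
      and b: "b \<in> carrier F \<and> h (Z #>\<^bsub>F\<^esub> b) = k (Z #>\<^bsub>F\<^esub> b)"
    have "a - b \<in> carrier F"
      using a b keys_diff[of a b] by (auto simp: pair_group_def)
    moreover have "Z #>\<^bsub>F\<^esub> a \<in> carrier TG" "Z #>\<^bsub>F\<^esub> b \<in> carrier TG"
      using a b carrier_TG by auto
    ultimately show "a - b \<in> carrier F \<and> h (Z #>\<^bsub>F\<^esub> (a - b)) = k (Z #>\<^bsub>F\<^esub> (a - b))"
      using a b by (simp add: coset_diff addhom_minus[OF G H h] addhom_minus[OF G H k])
  qed
  then show ?thesis using c by simp
qed

definition balanced_map :: "('g, 'c) ring_scheme \<Rightarrow> ('p \<Rightarrow> 'q \<Rightarrow> 'g) \<Rightarrow> bool" where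
  "balanced_map G f \<longleftrightarrow> abelian_group G \<and>
     (\<forall>p\<in>carrier P. \<forall>q\<in>carrier Q. f p q \<in> carrier G) \<and>
     (\<forall>p\<in>carrier P. \<forall>p'\<in>carrier P. \<forall>q\<in>carrier Q. f (p \<oplus>\<^bsub>P\<^esub> p') q = f p q \<oplus>\<^bsub>G\<^esub> f p' q) \<and>
     (\<forall>p\<in>carrier P. \<forall>q\<in>carrier Q. \<forall>q'\<in>carrier Q. f p (q \<oplus>\<^bsub>Q\<^esub> q') = f p q \<oplus>\<^bsub>G\<^esub> f p q') \<and>
     (\<forall>p\<in>carrier P. \<forall>s\<in>S. \<forall>q\<in>carrier Q. f (ract P p s) q = f p (lact Q s q))"

lemma tensor_lift_eq:
  assumes "balanced_map G f" "c \<in> carrier F"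
  shows "tensor_lift G f (Z #>\<^bsub>F\<^esub> c) =
           (\<Oplus>\<^bsub>G\<^esub>z\<in>Poly_Mapping.keys c. [Poly_Mapping.lookup c z] \<cdot>\<^bsub>G\<^esub> f (fst z) (snd z))"
  using assms P.abelian_group_axioms Q.abelian_group_axioms ract_closed lact_closed
  by (intro tensor_lift_coset) (auto simp: balanced_map_def)

lemma tensor_lift_pure:
  assumes f: "balanced_map G f" and "p \<in> carrier P" "q \<in> carrier Q"
  shows "tensor_lift G f (pure_tensor S P Q p q) = f p q"
proof -
  interpret G: abelian_group G using f by (simp add: balanced_map_def)
  have "f p q \<in> carrier G" using assms by (simp add: balanced_map_def)
  then show ?thesis
    unfolding pure_tensor_def
    using tensor_lift_eq[OF f frag_pair, of p q] assms
    by (simp add: add_pow_def group.int_pow_1[OF G.a_group])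
qed

text \<open>\<open>tensor_lift\<close> evaluates a chosen representative, which hides its
  additivity. The universal property of the free abelian group supplies a homomorphism
  \<open>h\<close>, and the lift of the coset of \<open>c\<close> turns out to be
  \<open>h c\<close>.\<close>

lemma tensor_lift_hom:
  assumes f: "balanced_map G f"
  shows "tensor_lift G f \<in> addhom TG G"
proof -
  interpret G: abelian_group G using f by (simp add: balanced_map_def)
  have cl: "f (fst z) (snd z) \<in> carrier G" if "z \<in> carrier P \<times> carrier Q" for z
    using f that by (auto simp: balanced_map_def)
  let ?A = "add_monoid G"
  have "(\<lambda>z. f (fst z) (snd z)) ` (carrier P \<times> carrier Q) \<subseteq> carrier ?A"
    using cl by auto
  then obtain h where h: "h \<in> hom (free_Abelian_group (carrier P \<times> carrier Q)) ?A"
    and hf: "\<And>z. z \<in> carrier P \<times> carrier Q \<Longrightarrow> h (frag_of z) = f (fst z) (snd z)"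
    by (rule comm_group.free_Abelian_group_universal[OF G.a_comm_group]) blast+
  have hF: "h \<in> hom F ?A" using h by (simp add: pair_group_def)
  interpret h: group_hom F ?A h
    using hF G.a_group comm_group.axioms(2)[OF comm_group_F]
    by (simp add: group_hom_def group_hom_axioms_def)
  have sum: "tensor_lift G f (Z #>\<^bsub>F\<^esub> c) = h c" if c: "c \<in> carrier F" for c
  proof -
    have keys: "Poly_Mapping.keys c \<subseteq> carrier P \<times> carrier Q"
      using c by (simp add: pair_group_def)
    have *: "(\<Sum>z\<in>I. frag_cmul (Poly_Mapping.lookup c z) (frag_of z)) \<in> carrier F \<and>
             h (\<Sum>z\<in>I. frag_cmul (Poly_Mapping.lookup c z) (frag_of z)) =
               (\<Oplus>\<^bsub>G\<^esub>z\<in>I. [Poly_Mapping.lookup c z] \<cdot>\<^bsub>G\<^esub> f (fst z) (snd z))"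
      if "finite I" "I \<subseteq> carrier P \<times> carrier Q" for I
      using that
    proof (induction I rule: finite_induct)
      case empty
      then show ?case using h.hom_one by (simp add: pair_group_def)
    next
      case (insert z I)
      let ?k = "Poly_Mapping.lookup c"
      have z: "z \<in> carrier P \<times> carrier Q" "frag_of z \<in> carrier F"
        using insert.prems by (auto simp: pair_group_def)
      have pow: "frag_cmul (?k z) (frag_of z) = frag_of z [^]\<^bsub>F\<^esub> ?k z"
        using z(1) unfolding pair_group_def by (subst int_pow_free_Abelian_group) auto
      have fcl: "[?k w] \<cdot>\<^bsub>G\<^esub> f (fst w) (snd w) \<in> carrier G" if "w \<in> insert z I" for w
        using group.int_pow_closed[OF G.a_group, of "f (fst w) (snd w)"] cl[of w] that insert.prems
        by (auto simp: add_pow_def)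
      have kz: "frag_cmul (?k z) (frag_of z) \<in> carrier F"
        unfolding pow by (rule group.int_pow_closed[OF h.is_group z(2)])
      have "h (frag_cmul (?k z) (frag_of z)) = [?k z] \<cdot>\<^bsub>G\<^esub> f (fst z) (snd z)"
        unfolding pow using h.hom_int_pow[OF z(2)] hf[OF z(1)] by (simp add: add_pow_def)
      moreover have "h (frag_cmul (?k z) (frag_of z) +
            (\<Sum>z\<in>I. frag_cmul (?k z) (frag_of z))) =
          h (frag_cmul (?k z) (frag_of z)) \<oplus>\<^bsub>G\<^esub> h (\<Sum>z\<in>I. frag_cmul (?k z) (frag_of z))"
        using h.hom_mult[OF kz] insert by (simp add: pair_group_def)
      moreover have "(\<Oplus>\<^bsub>G\<^esub>w\<in>insert z I. [?k w] \<cdot>\<^bsub>G\<^esub> f (fst w) (snd w)) =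
          [?k z] \<cdot>\<^bsub>G\<^esub> f (fst z) (snd z) \<oplus>\<^bsub>G\<^esub>
          (\<Oplus>\<^bsub>G\<^esub>w\<in>I. [?k w] \<cdot>\<^bsub>G\<^esub> f (fst w) (snd w))"
        by (rule G.finsum_insert[OF insert.hyps]) (use fcl in auto)
      ultimately show ?case
        using insert kz by (simp add: F_add)
    qed
    have "c = (\<Sum>z\<in>Poly_Mapping.keys c. frag_cmul (Poly_Mapping.lookup c z) (frag_of z))"
      using frag_expansion[of c] by (simp add: frag_extend_def)
    then show ?thesis
      using *[OF _ keys] tensor_lift_eq[OF f c] by simp
  qed
  show ?thesis
  proof (rule addhomI)
    fix x assume "x \<in> carrier TG"
    then show "tensor_lift G f x \<in> carrier G"
      using sum h.hom_closed carrier_TG by auto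
  next
    fix x y assume "x \<in> carrier TG" "y \<in> carrier TG"
    then obtain a b where ab: "a \<in> carrier F" "b \<in> carrier F"
        "x = Z #>\<^bsub>F\<^esub> a" "y = Z #>\<^bsub>F\<^esub> b"
      using carrier_TG by auto
    have "h (a + b) = h a \<oplus>\<^bsub>G\<^esub> h b"
      using h.hom_mult[OF ab(1,2)] by (simp add: pair_group_def)
    then show "tensor_lift G f (x \<oplus>\<^bsub>TG\<^esub> y) = tensor_lift G f x \<oplus>\<^bsub>G\<^esub> tensor_lift G f y"
      using ab by (simp add: sum F_add coset_add[symmetric])
  qed
qed

end

section \<open>The tensor square of a ring extension\<close>

locale ring_ext = N: ring N + M?: ring M
  for N :: "('n, 'd) ring_scheme" and M :: "('m, 'c) ring_scheme" (structure) +
  fixes \<iota> :: "'n \<Rightarrow> 'm"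
  assumes \<iota>_hom: "\<iota> \<in> ring_hom N M"
begin

lemma \<iota>_closed [simp]: "n \<in> carrier N \<Longrightarrow> \<iota> n \<in> carrier M"
  using \<iota>_hom by (rule ring_hom_closed)

lemma abelian_group_ring_bimodule: "abelian_group (ring_bimodule M f g)"
  by (rule abelian_group_cong[OF M.abelian_group_axioms]) (simp_all add: ring_bimodule_def)

sublocale TP: tensor_pair "carrier N" "ring_bimodule M id \<iota>" "ring_bimodule M \<iota> id"
  unfolding tensor_pair_def tensor_pair_axioms_def
  by (simp add: abelian_group_ring_bimodule) (simp add: ring_bimodule_def)

abbreviation T :: "('m, 'm, (('m \<times> 'm) \<Rightarrow>\<^sub>0 int) set) bimodule" where
  "T \<equiv> tensor_square N M \<iota> id id"

definition pt :: "'m \<Rightarrow> 'm \<Rightarrow> (('m \<times> 'm) \<Rightarrow>\<^sub>0 int) set" (infixl \<open>\<bowtie>\<close> 68) where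
  "p \<bowtie> q = pure_tensor (carrier N) (ring_bimodule M id \<iota>) (ring_bimodule M \<iota> id) p q"

abbreviation lact_T (infixr \<open>\<triangleright>\<close> 67) where "m \<triangleright> t \<equiv> lact T m t"
abbreviation ract_T (infixl \<open>\<triangleleft>\<close> 66) where "t \<triangleleft> m \<equiv> ract T t m"

lemma carrier_T: "carrier T = carrier TP.TG"
  and zero_T: "\<zero>\<^bsub>T\<^esub> = \<zero>\<^bsub>TP.TG\<^esub>"
  and add_T: "add T = add TP.TG"
  by (simp_all add: tensor_square_def tensor_product_def)

text \<open>The outer actions do not enter the relators. Hence all choices of acting rings share one
  abelian group and differ only by restricting the actions of \<open>T\<close> along
  \<open>f\<close> and \<open>g\<close>, and all work can be done in the
  \<open>M\<close>-\<open>M\<close>-bimodule \<open>T\<close>.\<close>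

lemma tensor_square_carrier: "carrier (tensor_square N M \<iota> f g) = carrier T"
  and tensor_square_zero: "\<zero>\<^bsub>tensor_square N M \<iota> f g\<^esub> = \<zero>\<^bsub>T\<^esub>"
  and tensor_square_add: "add (tensor_square N M \<iota> f g) = add T"
  and tensor_square_lact: "lact (tensor_square N M \<iota> f g) s t = f s \<triangleright> t"
  and tensor_square_ract: "ract (tensor_square N M \<iota> f g) t r = t \<triangleleft> g r"
  by (simp_all add: tensor_square_def tensor_product_def tensor_group_def pure_tensor_def
      tensor_null_def pair_group_def tensor_relators_def ring_bimodule_def)

lemma addhom_T: "addhom T H = addhom TP.TG H" "addhom G T = addhom G TP.TG"
  by (rule addhom_cong; simp add: carrier_T add_T)+

sublocale T: abelian_group T
  by (rule abelian_group_cong[OF TP.abelian_group_TG]) (simp_all add: carrier_T zero_T add_T)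

lemma carrier_ring_bimodule [simp]: "carrier (ring_bimodule M f g) = carrier M"
  by (simp add: ring_bimodule_def)

lemma pt_closed [simp]: "p \<in> carrier M \<Longrightarrow> q \<in> carrier M \<Longrightarrow> p \<bowtie> q \<in> carrier T"
  unfolding pt_def carrier_T by (rule TP.pure_tensor_closed) simp_all

lemma pt_add_left:
  "p \<in> carrier M \<Longrightarrow> p' \<in> carrier M \<Longrightarrow> q \<in> carrier M \<Longrightarrow>
   (p \<oplus> p') \<bowtie> q = p \<bowtie> q \<oplus>\<^bsub>T\<^esub> p' \<bowtie> q"
  using TP.pure_tensor_add_left[of p p' q] by (simp add: pt_def add_T) (simp add: ring_bimodule_def)

lemma pt_add_right:
  "p \<in> carrier M \<Longrightarrow> q \<in> carrier M \<Longrightarrow> q' \<in> carrier M \<Longrightarrow>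
   p \<bowtie> (q \<oplus> q') = p \<bowtie> q \<oplus>\<^bsub>T\<^esub> p \<bowtie> q'"
  using TP.pure_tensor_add_right[of p q q'] by (simp add: pt_def add_T) (simp add: ring_bimodule_def)

lemma pt_balanced:
  "p \<in> carrier M \<Longrightarrow> q \<in> carrier M \<Longrightarrow> n \<in> carrier N \<Longrightarrow> (p \<otimes> \<iota> n) \<bowtie> q = p \<bowtie> (\<iota> n \<otimes> q)"
  using TP.pure_tensor_balanced[of p n q] by (simp add: pt_def) (simp add: ring_bimodule_def)

lemma T_eqI:
  assumes "abelian_group H" "h \<in> addhom T H" "k \<in> addhom T H"
    and "\<And>p q. p \<in> carrier M \<Longrightarrow> q \<in> carrier M \<Longrightarrow> h (p \<bowtie> q) = k (p \<bowtie> q)"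
    and "t \<in> carrier T"
  shows "h t = k t"
  using TP.tensor_hom_eqI[of H h k t] assms
  unfolding addhom_T by (simp add: pt_def carrier_T)

text \<open>\<open>balanced_map\<close> for two copies of \<open>M\<close>, with the bimodule
  actions already replaced by products in \<open>M\<close>.\<close>

definition bal :: "('g, 'e) ring_scheme \<Rightarrow> ('m \<Rightarrow> 'm \<Rightarrow> 'g) \<Rightarrow> bool" where
  "bal G f \<longleftrightarrow> abelian_group G \<and>
     (\<forall>p\<in>carrier M. \<forall>q\<in>carrier M. f p q \<in> carrier G) \<and>
     (\<forall>p\<in>carrier M. \<forall>p'\<in>carrier M. \<forall>q\<in>carrier M. f (p \<oplus> p') q = f p q \<oplus>\<^bsub>G\<^esub> f p' q) \<and>
     (\<forall>p\<in>carrier M. \<forall>q\<in>carrier M. \<forall>q'\<in>carrier M. f p (q \<oplus> q') = f p q \<oplus>\<^bsub>G\<^esub> f p q') \<and>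
     (\<forall>p\<in>carrier M. \<forall>n\<in>carrier N. \<forall>q\<in>carrier M. f (p \<otimes> \<iota> n) q = f p (\<iota> n \<otimes> q))"

lemma balI:
  assumes "abelian_group G"
    and "\<And>p q. p \<in> carrier M \<Longrightarrow> q \<in> carrier M \<Longrightarrow> f p q \<in> carrier G"
    and "\<And>p p' q. p \<in> carrier M \<Longrightarrow> p' \<in> carrier M \<Longrightarrow> q \<in> carrier M \<Longrightarrow>
           f (p \<oplus> p') q = f p q \<oplus>\<^bsub>G\<^esub> f p' q"
    and "\<And>p q q'. p \<in> carrier M \<Longrightarrow> q \<in> carrier M \<Longrightarrow> q' \<in> carrier M \<Longrightarrow>
           f p (q \<oplus> q') = f p q \<oplus>\<^bsub>G\<^esub> f p q'"
    and "\<And>p n q. p \<in> carrier M \<Longrightarrow> n \<in> carrier N \<Longrightarrow> q \<in> carrier M \<Longrightarrow>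
           f (p \<otimes> \<iota> n) q = f p (\<iota> n \<otimes> q)"
  shows "bal G f"
  using assms by (simp add: bal_def)

lemma bal_abelian: "bal G f \<Longrightarrow> abelian_group G"
  by (simp add: bal_def)

lemma bal_balanced_map: "bal G f \<Longrightarrow> TP.balanced_map G f"
  unfolding bal_def TP.balanced_map_def by (simp add: ring_bimodule_def)

lemma lift_pt:
  "bal G f \<Longrightarrow> p \<in> carrier M \<Longrightarrow> q \<in> carrier M \<Longrightarrow> tensor_lift G f (p \<bowtie> q) = f p q"
  unfolding pt_def by (intro TP.tensor_lift_pure bal_balanced_map) simp_all

lemma lift_hom: "bal G f \<Longrightarrow> tensor_lift G f \<in> addhom T G"
  unfolding addhom_T by (intro TP.tensor_lift_hom bal_balanced_map)

lemma lift_closed: "bal G f \<Longrightarrow> t \<in> carrier T \<Longrightarrow> tensor_lift G f t \<in> carrier G"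
  using addhom_closed[OF lift_hom] .

lemma lift_add: "bal G f \<Longrightarrow> t \<in> carrier T \<Longrightarrow> u \<in> carrier T \<Longrightarrow>
    tensor_lift G f (t \<oplus>\<^bsub>T\<^esub> u) = tensor_lift G f t \<oplus>\<^bsub>G\<^esub> tensor_lift G f u"
  using addhom_add[OF lift_hom] .

text \<open>Additivity in the inserted map rather than in the tensor. It yields additivity in a
  parameter, such as \<open>m\<close> in \<open>ctr a m t\<close>.\<close>

lemma lift_add_fun:
  assumes "bal G f" "bal G g" "bal G h"
    and "\<And>p q. p \<in> carrier M \<Longrightarrow> q \<in> carrier M \<Longrightarrow> h p q = f p q \<oplus>\<^bsub>G\<^esub> g p q"
    and "t \<in> carrier T"
  shows "tensor_lift G h t = tensor_lift G f t \<oplus>\<^bsub>G\<^esub> tensor_lift G g t"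
proof -
  interpret G: abelian_group G using assms(1) by (rule bal_abelian)
  note [simp] = lift_closed[OF assms(1)] lift_closed[OF assms(2)]
  have "(\<lambda>t. tensor_lift G f t \<oplus>\<^bsub>G\<^esub> tensor_lift G g t) \<in> addhom T G"
    by (intro addhomI) (simp_all add: lift_add[OF assms(1)] lift_add[OF assms(2)] G.a_ac)
  then show ?thesis
    by (rule T_eqI[OF G.abelian_group_axioms lift_hom[OF assms(3)], of
          "\<lambda>t. tensor_lift G f t \<oplus>\<^bsub>G\<^esub> tensor_lift G g t"])
      (simp_all add: lift_pt[OF assms(1)] lift_pt[OF assms(2)] lift_pt[OF assms(3)] assms(4,5))
qed

lemma bal_lact_TG:
  assumes "m \<in> carrier M" shows "bal TP.TG (\<lambda>p q. (m \<otimes> p) \<bowtie> q)"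
  using assms by (intro balI TP.abelian_group_TG)
    (auto simp: r_distr pt_add_left pt_add_right pt_balanced[symmetric] m_assoc carrier_T[symmetric]
      add_T[symmetric])

lemma bal_ract_TG:
  assumes "m \<in> carrier M" shows "bal TP.TG (\<lambda>p q. p \<bowtie> (q \<otimes> m))"
  using assms by (intro balI TP.abelian_group_TG)
    (auto simp: l_distr pt_add_left pt_add_right pt_balanced m_assoc carrier_T[symmetric]
      add_T[symmetric])

lemma lact_T_eq: "m \<triangleright> t = tensor_lift TP.TG (\<lambda>p q. (m \<otimes> p) \<bowtie> q) t"
  and ract_T_eq: "t \<triangleleft> m = tensor_lift TP.TG (\<lambda>p q. p \<bowtie> (q \<otimes> m)) t"
  by (simp_all add: tensor_square_def tensor_product_def pt_def) (simp_all add: ring_bimodule_def)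

lemma lact_T_hom: "m \<in> carrier M \<Longrightarrow> (\<lambda>t. m \<triangleright> t) \<in> addhom T T"
  using lift_hom[OF bal_lact_TG] by (simp add: lact_T_eq[abs_def] addhom_T)

lemma ract_T_hom: "m \<in> carrier M \<Longrightarrow> (\<lambda>t. t \<triangleleft> m) \<in> addhom T T"
  using lift_hom[OF bal_ract_TG] by (simp add: ract_T_eq[abs_def] addhom_T)

lemma lact_T_pt [simp]:
  "m \<in> carrier M \<Longrightarrow> p \<in> carrier M \<Longrightarrow> q \<in> carrier M \<Longrightarrow> m \<triangleright> p \<bowtie> q = (m \<otimes> p) \<bowtie> q"
  unfolding lact_T_eq by (rule lift_pt[OF bal_lact_TG])

lemma ract_T_pt [simp]:
  "m \<in> carrier M \<Longrightarrow> p \<in> carrier M \<Longrightarrow> q \<in> carrier M \<Longrightarrow> p \<bowtie> q \<triangleleft> m = p \<bowtie> (q \<otimes> m)"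
  unfolding ract_T_eq by (rule lift_pt[OF bal_ract_TG])

lemmas lact_T_closed [simp] = addhom_closed[OF lact_T_hom]
lemmas ract_T_closed [simp] = addhom_closed[OF ract_T_hom]
lemmas lact_T_add = addhom_add[OF lact_T_hom]
lemmas ract_T_add = addhom_add[OF ract_T_hom]

lemma lact_T_add_scalar:
  assumes "m \<in> carrier M" "m' \<in> carrier M" "t \<in> carrier T"
  shows "(m \<oplus> m') \<triangleright> t = m \<triangleright> t \<oplus>\<^bsub>T\<^esub> m' \<triangleright> t"
  by (rule T_eqI[of T "\<lambda>t. (m \<oplus> m') \<triangleright> t" "\<lambda>t. m \<triangleright> t \<oplus>\<^bsub>T\<^esub> m' \<triangleright> t"])
    (use assms in \<open>auto intro!: addhomI T.abelian_group_axioms simp: lact_T_add l_distr pt_add_left T.a_ac\<close>)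

lemma ract_T_add_scalar:
  assumes "m \<in> carrier M" "m' \<in> carrier M" "t \<in> carrier T"
  shows "t \<triangleleft> (m \<oplus> m') = t \<triangleleft> m \<oplus>\<^bsub>T\<^esub> t \<triangleleft> m'"
  by (rule T_eqI[of T "\<lambda>t. t \<triangleleft> (m \<oplus> m')" "\<lambda>t. t \<triangleleft> m \<oplus>\<^bsub>T\<^esub> t \<triangleleft> m'"])
    (use assms in \<open>auto intro!: addhomI T.abelian_group_axioms simp: ract_T_add r_distr pt_add_right T.a_ac\<close>)

lemma lact_T_mult:
  assumes "m \<in> carrier M" "m' \<in> carrier M" "t \<in> carrier T"
  shows "(m \<otimes> m') \<triangleright> t = m \<triangleright> m' \<triangleright> t"
  by (rule T_eqI[of T "\<lambda>t. (m \<otimes> m') \<triangleright> t" "\<lambda>t. m \<triangleright> m' \<triangleright> t"])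
    (use assms in \<open>auto intro!: addhomI T.abelian_group_axioms simp: lact_T_add m_assoc\<close>)

lemma ract_T_mult:
  assumes "m \<in> carrier M" "m' \<in> carrier M" "t \<in> carrier T"
  shows "t \<triangleleft> (m \<otimes> m') = t \<triangleleft> m \<triangleleft> m'"
  by (rule T_eqI[of T "\<lambda>t. t \<triangleleft> (m \<otimes> m')" "\<lambda>t. t \<triangleleft> m \<triangleleft> m'"])
    (use assms in \<open>auto intro!: addhomI T.abelian_group_axioms simp: ract_T_add m_assoc\<close>)

lemma lact_T_one [simp]: "t \<in> carrier T \<Longrightarrow> \<one> \<triangleright> t = t"
  by (rule T_eqI[of T "\<lambda>t. \<one> \<triangleright> t" "\<lambda>t. t"])
    (auto intro!: addhomI T.abelian_group_axioms simp: lact_T_add)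

lemma ract_T_one [simp]: "t \<in> carrier T \<Longrightarrow> t \<triangleleft> \<one> = t"
  by (rule T_eqI[of T "\<lambda>t. t \<triangleleft> \<one>" "\<lambda>t. t"])
    (auto intro!: addhomI T.abelian_group_axioms simp: ract_T_add)

lemma lact_ract_T:
  assumes "m \<in> carrier M" "m' \<in> carrier M" "t \<in> carrier T"
  shows "(m \<triangleright> t) \<triangleleft> m' = m \<triangleright> (t \<triangleleft> m')"
  by (rule T_eqI[of T "\<lambda>t. (m \<triangleright> t) \<triangleleft> m'" "\<lambda>t. m \<triangleright> (t \<triangleleft> m')"])
    (use assms in \<open>auto intro!: addhomI T.abelian_group_axioms simp: ract_T_add lact_T_add\<close>)

section \<open>Multiplication on the tensor square and separability elements\<close>

lemma bal_mult: "bal M (\<lambda>p q. p \<otimes> q)"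
  by (intro balI M.abelian_group_axioms) (auto simp: l_distr r_distr m_assoc)

abbreviation \<mu> where "\<mu> \<equiv> tensor_lift M (\<lambda>p q. p \<otimes> q)"

lemmas \<mu>_pt = lift_pt[OF bal_mult]
lemmas \<mu>_hom = lift_hom[OF bal_mult]
lemmas \<mu>_closed [simp] = lift_closed[OF bal_mult]

lemma \<mu>_lact:
  assumes "m \<in> carrier M" "t \<in> carrier T"
  shows "\<mu> (m \<triangleright> t) = m \<otimes> \<mu> t"
  by (rule T_eqI[of M "\<lambda>t. \<mu> (m \<triangleright> t)" "\<lambda>t. m \<otimes> \<mu> t"])
    (use assms in \<open>auto intro!: addhomI M.abelian_group_axioms simp: lact_T_add lift_add[OF bal_mult] r_distr \<mu>_pt m_assoc\<close>)

text \<open>These are the Casimir elements of the extension; those that multiply to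
  \<open>\<one>\<close> are its separability elements.\<close>

definition casimir :: "(('m \<times> 'm) \<Rightarrow>\<^sub>0 int) set \<Rightarrow> bool" where
  "casimir s \<longleftrightarrow> s \<in> carrier T \<and> (\<forall>m\<in>carrier M. m \<triangleright> s = s \<triangleleft> m)"

text \<open>A bimodule section \<open>\<sigma>\<close> of the multiplication is determined by
  \<open>\<sigma> \<one>\<close>, since left and right linearity both compute
  \<open>\<sigma> m\<close> from it; this forces \<open>\<sigma> \<one>\<close> to be central.
  Conversely a central \<open>s\<close> gives the section
  \<open>m \<mapsto> m \<triangleright> s\<close>.\<close>

lemma separable_extension_iff:
  "separable_extension N M \<iota> \<longleftrightarrow> (\<exists>s. casimir s \<and> \<mu> s = \<one>)"
proof
  assume "separable_extension N M \<iota>"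
  then obtain \<sigma>
    where \<sigma>: "\<sigma> \<in> bimodule_hom (carrier M) (carrier M) (ring_bimodule M id id) T"
    and sec: "\<And>x. x \<in> carrier M \<Longrightarrow> \<mu> (\<sigma> x) = x"
    unfolding separable_extension_def by blast
  have "\<sigma> \<one> \<in> carrier T"
    using addhom_closed[OF bimodule_hom_add[OF \<sigma>]] by simp
  moreover have "m \<triangleright> \<sigma> \<one> = \<sigma> \<one> \<triangleleft> m" if m: "m \<in> carrier M" for m
  proof -
    have "\<sigma> (m \<otimes> \<one>) = m \<triangleright> \<sigma> \<one>"
      using bimodule_hom_lact[OF \<sigma> m, of \<one>] by (simp add: ring_bimodule_def)
    moreover have "\<sigma> (\<one> \<otimes> m) = \<sigma> \<one> \<triangleleft> m"
      using bimodule_hom_ract[OF \<sigma> m, of \<one>] by (simp add: ring_bimodule_def)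
    ultimately show ?thesis using r_one[OF m] l_one[OF m] by metis
  qed
  ultimately show "\<exists>s. casimir s \<and> \<mu> s = \<one>"
    unfolding casimir_def using sec[OF one_closed] by blast
next
  assume "\<exists>s. casimir s \<and> \<mu> s = \<one>"
  then obtain s where s: "s \<in> carrier T" "\<And>m. m \<in> carrier M \<Longrightarrow> m \<triangleright> s = s \<triangleleft> m" "\<mu> s = \<one>"
    unfolding casimir_def by blast
  have "(\<lambda>m. m \<triangleright> s) \<in> bimodule_hom (carrier M) (carrier M) (ring_bimodule M id id) T"
    unfolding bimodule_hom_def
  proof (intro CollectI conjI ballI)
    show "(\<lambda>m. m \<triangleright> s) \<in> addhom (ring_bimodule M id id) T"
      by (rule addhomI) (simp_all add: s(1) ring_bimodule_def lact_T_add_scalar)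
  next
    fix m x assume mx: "m \<in> carrier M" "x \<in> carrier (ring_bimodule M id id)"
    show "lact (ring_bimodule M id id) m x \<triangleright> s = m \<triangleright> x \<triangleright> s"
      using mx s(1) by (simp add: ring_bimodule_def lact_T_mult)
    have "x \<triangleright> (s \<triangleleft> m) = x \<triangleright> m \<triangleright> s"
      using mx s(1) by (simp add: s(2)[of m])
    then show "ract (ring_bimodule M id id) x m \<triangleright> s = (x \<triangleright> s) \<triangleleft> m"
      using mx s(1) by (simp add: ring_bimodule_def lact_T_mult lact_ract_T)
  qed
  moreover have "\<mu> (m \<triangleright> s) = m" if "m \<in> carrier M" for m
    using s(1,3) that by (simp add: \<mu>_lact)
  ultimately show "separable_extension N M \<iota>"
    unfolding separable_extension_def by (intro bexI[of _ "\<lambda>m. m \<triangleright> s"] ballI)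
qed

end

text \<open>An algebra is an extension of its scalars, so tensor squares over \<open>K\<close> and
  their Casimir elements are available for \<open>R\<close>, \<open>A\<close> and \<open>B\<close>
  as further instances of \<open>ring_ext\<close>.\<close>

lemma (in assoc_algebra) ring_ext_scalars: "ring_ext R M (\<lambda>k. k \<odot>\<^bsub>M\<^esub> \<one>\<^bsub>M\<^esub>)"
proof -
  have "(\<lambda>k. k \<odot>\<^bsub>M\<^esub> \<one>\<^bsub>M\<^esub>) \<in> ring_hom R M"
  proof (rule ring_hom_memI)
    fix x y assume "x \<in> carrier R" "y \<in> carrier R"
    then show "(x \<otimes> y) \<odot>\<^bsub>M\<^esub> \<one>\<^bsub>M\<^esub> = (x \<odot>\<^bsub>M\<^esub> \<one>\<^bsub>M\<^esub>) \<otimes>\<^bsub>M\<^esub> (y \<odot>\<^bsub>M\<^esub> \<one>\<^bsub>M\<^esub>)"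
      using smult_assoc1[of x y "\<one>\<^bsub>M\<^esub>"] smult_mult_left[of x "\<one>\<^bsub>M\<^esub>" "y \<odot>\<^bsub>M\<^esub> \<one>\<^bsub>M\<^esub>"]
      by simp
  qed (simp_all add: smult_l_distr)
  then show ?thesis
    by (intro ring_ext.intro ring_ext_axioms.intro R.ring_axioms ring_axioms)
qed

context ring_ext
begin

section \<open>Linear endomorphisms, the centralizer and the invariants\<close>

definition left_linear :: "('m \<Rightarrow> 'm) \<Rightarrow> bool" where
  "left_linear a \<longleftrightarrow> a \<in> addhom M M \<and> (\<forall>n\<in>carrier N. \<forall>x\<in>carrier M. a (\<iota> n \<otimes> x) = \<iota> n \<otimes> a x)"

definition right_linear :: "('m \<Rightarrow> 'm) \<Rightarrow> bool" where
  "right_linear a \<longleftrightarrow> a \<in> addhom M M \<and> (\<forall>n\<in>carrier N. \<forall>x\<in>carrier M. a (x \<otimes> \<iota> n) = a x \<otimes> \<iota> n)"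

definition bilinear :: "('m \<Rightarrow> 'm) \<Rightarrow> bool" where
  "bilinear a \<longleftrightarrow> left_linear a \<and> right_linear a"

lemma left_linear_hom: "left_linear a \<Longrightarrow> a \<in> addhom M M"
  and left_linear_left: "left_linear a \<Longrightarrow> n \<in> carrier N \<Longrightarrow> x \<in> carrier M \<Longrightarrow> a (\<iota> n \<otimes> x) = \<iota> n \<otimes> a x"
  and right_linear_hom: "right_linear a \<Longrightarrow> a \<in> addhom M M"
  and right_linear_right: "right_linear a \<Longrightarrow> n \<in> carrier N \<Longrightarrow> x \<in> carrier M \<Longrightarrow> a (x \<otimes> \<iota> n) = a x \<otimes> \<iota> n"
  and bilinear_left: "bilinear a \<Longrightarrow> left_linear a"
  and bilinear_right: "bilinear a \<Longrightarrow> right_linear a"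
  by (simp_all add: left_linear_def right_linear_def bilinear_def)

lemma bilinearI:
  assumes "\<And>x. x \<in> carrier M \<Longrightarrow> a x \<in> carrier M"
    and "\<And>x y. x \<in> carrier M \<Longrightarrow> y \<in> carrier M \<Longrightarrow> a (x \<oplus> y) = a x \<oplus> a y"
    and "\<And>n x. n \<in> carrier N \<Longrightarrow> x \<in> carrier M \<Longrightarrow> a (\<iota> n \<otimes> x) = \<iota> n \<otimes> a x"
    and "\<And>n x. n \<in> carrier N \<Longrightarrow> x \<in> carrier M \<Longrightarrow> a (x \<otimes> \<iota> n) = a x \<otimes> \<iota> n"
  shows "bilinear a"
  using assms by (auto simp: bilinear_def left_linear_def right_linear_def intro!: addhomI)

lemmas lin_closed = left_linear_hom[THEN addhom_closed] right_linear_hom[THEN addhom_closed]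
lemmas lin_add = left_linear_hom[THEN addhom_add] right_linear_hom[THEN addhom_add]

definition centralizer :: "'m set" where
  "centralizer = {r \<in> carrier M. \<forall>n\<in>carrier N. \<iota> n \<otimes> r = r \<otimes> \<iota> n}"

lemma centralizer_closed: "r \<in> centralizer \<Longrightarrow> r \<in> carrier M"
  and centralizer_comm: "r \<in> centralizer \<Longrightarrow> n \<in> carrier N \<Longrightarrow> \<iota> n \<otimes> r = r \<otimes> \<iota> n"
  by (simp_all add: centralizer_def)

definition invariants :: "(('m \<times> 'm) \<Rightarrow>\<^sub>0 int) set set" where
  "invariants = {b \<in> carrier T. \<forall>n\<in>carrier N. \<iota> n \<triangleright> b = b \<triangleleft> \<iota> n}"

lemma invariants_closed: "b \<in> invariants \<Longrightarrow> b \<in> carrier T"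
  and invariants_comm: "b \<in> invariants \<Longrightarrow> n \<in> carrier N \<Longrightarrow> \<iota> n \<triangleright> b = b \<triangleleft> \<iota> n"
  by (simp_all add: invariants_def)

text \<open>Both \<open>n a(1)\<close> and \<open>a(1) n\<close> equal the value of \<open>a\<close>
  at the image of \<open>n\<close>. This is the map from \<open>A\<close> to \<open>R\<close> used
  for the split direction.\<close>

lemma bilinear_one_centralizer:
  assumes "bilinear a" shows "a \<one> \<in> centralizer"
proof -
  have "\<iota> n \<otimes> a \<one> = a \<one> \<otimes> \<iota> n" if "n \<in> carrier N" for n
    using left_linear_left[OF bilinear_left[OF assms] that one_closed]
      right_linear_right[OF bilinear_right[OF assms] that one_closed] that by simp
  then show ?thesis
    using lin_closed(1)[OF bilinear_left[OF assms]] by (simp add: centralizer_def)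
qed

lemma bilinear_mult_left:
  assumes "r \<in> centralizer" shows "bilinear (\<lambda>x. r \<otimes> x)"
proof (rule bilinearI)
  fix n x assume nx: "n \<in> carrier N" "x \<in> carrier M"
  have "r \<otimes> (\<iota> n \<otimes> x) = (\<iota> n \<otimes> r) \<otimes> x"
    using nx assms by (simp add: centralizer_comm centralizer_closed m_assoc)
  then show "r \<otimes> (\<iota> n \<otimes> x) = \<iota> n \<otimes> (r \<otimes> x)"
    using nx assms by (simp add: centralizer_closed m_assoc)
qed (use assms in \<open>auto simp: centralizer_closed r_distr m_assoc\<close>)

subsection \<open>Contractions of the tensor square\<close>

definition appl :: "('m \<Rightarrow> 'm) \<Rightarrow> (('m \<times> 'm) \<Rightarrow>\<^sub>0 int) set \<Rightarrow> 'm" where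
  "appl a = tensor_lift M (\<lambda>p q. a p \<otimes> q)"

lemma bal_appl: "right_linear a \<Longrightarrow> bal M (\<lambda>p q. a p \<otimes> q)"
  by (intro balI M.abelian_group_axioms)
    (auto simp: lin_closed lin_add l_distr r_distr right_linear_right m_assoc)

lemma appl_hom: "right_linear a \<Longrightarrow> appl a \<in> addhom T M"
  unfolding appl_def by (intro lift_hom bal_appl)

lemmas appl_closed = appl_hom[THEN addhom_closed]
lemmas appl_add = appl_hom[THEN addhom_add]

lemma appl_pt: "right_linear a \<Longrightarrow> p \<in> carrier M \<Longrightarrow> q \<in> carrier M \<Longrightarrow> appl a (p \<bowtie> q) = a p \<otimes> q"
  unfolding appl_def by (intro lift_pt bal_appl)

lemma appl_ract:
  assumes "right_linear a" "m \<in> carrier M" "t \<in> carrier T"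
  shows "appl a (t \<triangleleft> m) = appl a t \<otimes> m"
  by (rule T_eqI[of M "\<lambda>t. appl a (t \<triangleleft> m)" "\<lambda>t. appl a t \<otimes> m"])
    (use assms in \<open>auto intro!: addhomI M.abelian_group_axioms
      simp: ract_T_add appl_closed appl_add l_distr appl_pt lin_closed m_assoc\<close>)

lemma appl_lact:
  assumes "bilinear a" "n \<in> carrier N" "t \<in> carrier T"
  shows "appl a (\<iota> n \<triangleright> t) = \<iota> n \<otimes> appl a t"
proof -
  note a = bilinear_left[OF assms(1)] bilinear_right[OF assms(1)]
  show ?thesis
    by (rule T_eqI[of M "\<lambda>t. appl a (\<iota> n \<triangleright> t)" "\<lambda>t. \<iota> n \<otimes> appl a t"])
      (use assms(2,3) a in \<open>auto intro!: addhomI M.abelian_group_axioms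
        simp: lact_T_add appl_closed appl_add r_distr appl_pt lin_closed left_linear_left m_assoc\<close>)
qed

text \<open>An element of \<open>N\<close> on the left moves into the first factor by left linearity
  of \<open>a\<close>, across \<open>b\<close> by invariance, and out on the right. With
  \<open>a = \<beta> k\<close> these values are the matrix entries over \<open>R\<close> in both
  constructions of dual bases.\<close>

lemma appl_centralizer:
  assumes "bilinear a" "b \<in> invariants"
  shows "appl a b \<in> centralizer"
proof -
  note a = bilinear_left[OF assms(1)] bilinear_right[OF assms(1)]
  have "\<iota> n \<otimes> appl a b = appl a b \<otimes> \<iota> n" if "n \<in> carrier N" for n
    using assms that a
    by (simp add: appl_lact[symmetric] invariants_comm invariants_closed appl_ract)
  then show ?thesis
    using assms a by (simp add: centralizer_def appl_closed invariants_closed)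
qed

definition apr :: "('m \<Rightarrow> 'm) \<Rightarrow> (('m \<times> 'm) \<Rightarrow>\<^sub>0 int) set \<Rightarrow> (('m \<times> 'm) \<Rightarrow>\<^sub>0 int) set" where
  "apr a = tensor_lift T (\<lambda>p q. p \<bowtie> a q)"

lemma bal_apr: "left_linear a \<Longrightarrow> bal T (\<lambda>p q. p \<bowtie> a q)"
  by (intro balI T.abelian_group_axioms)
    (auto simp: lin_closed lin_add pt_add_left pt_add_right left_linear_left pt_balanced)

lemma apr_hom: "left_linear a \<Longrightarrow> apr a \<in> addhom T T"
  unfolding apr_def by (intro lift_hom bal_apr)

lemmas apr_closed = apr_hom[THEN addhom_closed]
lemmas apr_add = apr_hom[THEN addhom_add]

lemma apr_pt: "left_linear a \<Longrightarrow> p \<in> carrier M \<Longrightarrow> q \<in> carrier M \<Longrightarrow> apr a (p \<bowtie> q) = p \<bowtie> a q"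
  unfolding apr_def by (intro lift_pt bal_apr)

lemma apr_lact:
  assumes "left_linear a" "m \<in> carrier M" "t \<in> carrier T"
  shows "apr a (m \<triangleright> t) = m \<triangleright> apr a t"
  by (rule T_eqI[of T "\<lambda>t. apr a (m \<triangleright> t)" "\<lambda>t. m \<triangleright> apr a t"])
    (use assms in \<open>auto intro!: addhomI T.abelian_group_axioms
      simp: lact_T_add apr_closed apr_add apr_pt lin_closed\<close>)

lemma apr_ract:
  assumes "bilinear a" "n \<in> carrier N" "t \<in> carrier T"
  shows "apr a (t \<triangleleft> \<iota> n) = apr a t \<triangleleft> \<iota> n"
proof -
  note a = bilinear_left[OF assms(1)] bilinear_right[OF assms(1)]
  show ?thesis
    by (rule T_eqI[of T "\<lambda>t. apr a (t \<triangleleft> \<iota> n)" "\<lambda>t. apr a t \<triangleleft> \<iota> n"])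
      (use assms(2,3) a in \<open>auto intro!: addhomI T.abelian_group_axioms
        simp: ract_T_add apr_closed apr_add apr_pt lin_closed right_linear_right\<close>)
qed

lemma casimir_closed: "casimir s \<Longrightarrow> s \<in> carrier T"
  and casimir_comm: "casimir s \<Longrightarrow> m \<in> carrier M \<Longrightarrow> m \<triangleright> s = s \<triangleleft> m"
  by (simp_all add: casimir_def)

text \<open>Applying \<open>a\<close> to the second factor keeps left \<open>M\<close>-linearity,
  but on the right only linearity over \<open>N\<close>. Membership in \<open>B\<close> asks for no
  more, and this is where the families \<open>v k\<close> in \<open>B\<close> come from.\<close>

lemma apr_casimir_invariants:
  assumes "bilinear a" "casimir s"
  shows "apr a s \<in> invariants"
  using assms bilinear_left[OF assms(1)]
  by (auto simp: invariants_def apr_closed casimir_closed casimir_comm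
      apr_ract apr_lact[symmetric])

text \<open>The parameter \<open>m\<close> stays inside \<open>a\<close> so that an invariant
  \<open>b\<close> defines the endomorphism \<open>m \<mapsto> b^1 a(b^2 m)\<close>, an element of
  \<open>A\<close>.\<close>

definition ctr :: "('m \<Rightarrow> 'm) \<Rightarrow> 'm \<Rightarrow> (('m \<times> 'm) \<Rightarrow>\<^sub>0 int) set \<Rightarrow> 'm" where
  "ctr a m = tensor_lift M (\<lambda>p q. p \<otimes> a (q \<otimes> m))"

lemma bal_ctr: "left_linear a \<Longrightarrow> m \<in> carrier M \<Longrightarrow> bal M (\<lambda>p q. p \<otimes> a (q \<otimes> m))"
  by (intro balI M.abelian_group_axioms)
    (auto simp: lin_closed lin_add l_distr r_distr left_linear_left m_assoc)

lemma ctr_hom: "left_linear a \<Longrightarrow> m \<in> carrier M \<Longrightarrow> ctr a m \<in> addhom T M"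
  unfolding ctr_def by (intro lift_hom bal_ctr)

lemmas ctr_closed = ctr_hom[THEN addhom_closed]
lemmas ctr_add = ctr_hom[THEN addhom_add]

lemma ctr_pt: "left_linear a \<Longrightarrow> m \<in> carrier M \<Longrightarrow> p \<in> carrier M \<Longrightarrow> q \<in> carrier M \<Longrightarrow>
    ctr a m (p \<bowtie> q) = p \<otimes> a (q \<otimes> m)"
  unfolding ctr_def by (intro lift_pt bal_ctr)

lemma ctr_lact:
  assumes "left_linear a" "m \<in> carrier M" "x \<in> carrier M" "t \<in> carrier T"
  shows "ctr a m (x \<triangleright> t) = x \<otimes> ctr a m t"
  by (rule T_eqI[of M "\<lambda>t. ctr a m (x \<triangleright> t)" "\<lambda>t. x \<otimes> ctr a m t"])
    (use assms in \<open>auto intro!: addhomI M.abelian_group_axioms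
      simp: lact_T_add ctr_closed ctr_add ctr_pt lin_closed r_distr m_assoc\<close>)

lemma ctr_ract:
  assumes "left_linear a" "m \<in> carrier M" "x \<in> carrier M" "t \<in> carrier T"
  shows "ctr a m (t \<triangleleft> x) = ctr a (x \<otimes> m) t"
  by (rule T_eqI[of M "\<lambda>t. ctr a m (t \<triangleleft> x)" "\<lambda>t. ctr a (x \<otimes> m) t"])
    (use assms in \<open>auto intro!: addhomI M.abelian_group_axioms
      simp: ract_T_add ctr_closed ctr_add ctr_pt lin_closed r_distr m_assoc\<close>)

lemma ctr_add_arg:
  assumes "left_linear a" "m \<in> carrier M" "m' \<in> carrier M" "t \<in> carrier T"
  shows "ctr a (m \<oplus> m') t = ctr a m t \<oplus> ctr a m' t"
  unfolding ctr_def
  by (rule lift_add_fun) (use assms in \<open>auto intro!: bal_ctr simp: r_distr lin_closed lin_add\<close>)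

lemma ctr_mult_right:
  assumes "bilinear a" "m \<in> carrier M" "n \<in> carrier N" "t \<in> carrier T"
  shows "ctr a (m \<otimes> \<iota> n) t = ctr a m t \<otimes> \<iota> n"
proof -
  note a = bilinear_left[OF assms(1)] bilinear_right[OF assms(1)]
  show ?thesis
    by (rule T_eqI[of M "\<lambda>t. ctr a (m \<otimes> \<iota> n) t" "\<lambda>t. ctr a m t \<otimes> \<iota> n"])
      (use assms(2-4) a in \<open>auto intro!: addhomI M.abelian_group_axioms
        simp: ctr_closed ctr_add ctr_pt lin_closed l_distr right_linear_right m_assoc[symmetric]\<close>)
qed

text \<open>Left linearity is where invariance enters: multiplying \<open>m\<close> by
  \<open>n\<close> on the left multiplies \<open>b\<close> by \<open>n\<close> on the right, which
  is the same as multiplying \<open>b\<close>, and so the value, on the left.\<close>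

lemma ctr_bilinear:
  assumes "bilinear a" "b \<in> invariants"
  shows "bilinear (\<lambda>m. ctr a m b)"
proof -
  note a = bilinear_left[OF assms(1)] bilinear_right[OF assms(1)]
  note b = invariants_closed[OF assms(2)]
  show ?thesis
  proof (rule bilinearI)
    fix n x assume nx: "n \<in> carrier N" "x \<in> carrier M"
    then show "ctr a (\<iota> n \<otimes> x) b = \<iota> n \<otimes> ctr a x b"
      using ctr_ract[OF a(1) nx(2), of "\<iota> n" b] ctr_lact[OF a(1) nx(2), of "\<iota> n" b] b
      by (simp add: invariants_comm[OF assms(2)])
  qed (use assms a b in \<open>auto simp: ctr_closed ctr_add_arg ctr_mult_right\<close>)
qed

subsection \<open>The ring structure on the invariants\<close>

text \<open>The product of \<open>B\<close>, but with a second argument ranging over all of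
  \<open>T\<close>: it makes \<open>T\<close> a left \<open>B\<close>-module. Since this action
  commutes with both actions of \<open>M\<close>, associativity and the action on Casimir elements
  come from one operation.\<close>

definition insert_inv ::
    "(('m \<times> 'm) \<Rightarrow>\<^sub>0 int) set \<Rightarrow> (('m \<times> 'm) \<Rightarrow>\<^sub>0 int) set \<Rightarrow> (('m \<times> 'm) \<Rightarrow>\<^sub>0 int) set"
    (infixr \<open>\<star>\<close> 66) where
  "b \<star> t = tensor_lift T (\<lambda>p q. (p \<triangleright> b) \<triangleleft> q) t"

lemma bal_insert: "b \<in> invariants \<Longrightarrow> bal T (\<lambda>p q. (p \<triangleright> b) \<triangleleft> q)"
  by (intro balI T.abelian_group_axioms)
    (auto simp: invariants_closed lact_T_add_scalar ract_T_add_scalar ract_T_add lact_T_mult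
      invariants_comm lact_ract_T ract_T_mult)

lemma insert_hom: "b \<in> invariants \<Longrightarrow> (\<lambda>t. b \<star> t) \<in> addhom T T"
  unfolding insert_inv_def by (intro lift_hom bal_insert)

lemmas insert_closed = insert_hom[THEN addhom_closed]
lemmas insert_add = insert_hom[THEN addhom_add]

lemma insert_pt: "b \<in> invariants \<Longrightarrow> p \<in> carrier M \<Longrightarrow> q \<in> carrier M \<Longrightarrow> b \<star> p \<bowtie> q = (p \<triangleright> b) \<triangleleft> q"
  unfolding insert_inv_def by (intro lift_pt bal_insert)

lemma insert_lact:
  assumes "b \<in> invariants" "m \<in> carrier M" "t \<in> carrier T"
  shows "b \<star> (m \<triangleright> t) = m \<triangleright> (b \<star> t)"
  by (rule T_eqI[of T "\<lambda>t. b \<star> (m \<triangleright> t)" "\<lambda>t. m \<triangleright> (b \<star> t)"])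
    (use assms in \<open>auto intro!: addhomI T.abelian_group_axioms
      simp: lact_T_add insert_closed insert_add insert_pt invariants_closed lact_T_mult lact_ract_T\<close>)

lemma insert_ract:
  assumes "b \<in> invariants" "m \<in> carrier M" "t \<in> carrier T"
  shows "b \<star> (t \<triangleleft> m) = (b \<star> t) \<triangleleft> m"
  by (rule T_eqI[of T "\<lambda>t. b \<star> (t \<triangleleft> m)" "\<lambda>t. (b \<star> t) \<triangleleft> m"])
    (use assms in \<open>auto intro!: addhomI T.abelian_group_axioms
      simp: ract_T_add insert_closed insert_add insert_pt invariants_closed ract_T_mult\<close>)

lemma insert_invariants: "b \<in> invariants \<Longrightarrow> c \<in> invariants \<Longrightarrow> b \<star> c \<in> invariants"
  by (auto simp: invariants_def[THEN eqset_imp_iff, of "b \<star> c"] insert_closed invariants_closed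
      insert_lact[symmetric] insert_ract[symmetric] invariants_comm)

text \<open>Insertion of \<open>b\<close> is linear over \<open>M\<close> on both sides, so
  \<open>B\<close> acts on the Casimir elements. The map \<open>r\<close> is read off from this
  action.\<close>

lemma insert_casimir: "b \<in> invariants \<Longrightarrow> casimir s \<Longrightarrow> casimir (b \<star> s)"
  by (simp add: casimir_def insert_closed insert_lact[symmetric] insert_ract[symmetric])

lemma unit_invariants: "\<one> \<bowtie> \<one> \<in> invariants"
  using pt_balanced[of \<one> \<one>] by (auto simp: invariants_def)

lemma insert_unit_left: "t \<in> carrier T \<Longrightarrow> \<one> \<bowtie> \<one> \<star> t = t"
  by (rule T_eqI[of T "\<lambda>t. \<one> \<bowtie> \<one> \<star> t" "\<lambda>t. t"])
    (auto intro!: addhomI T.abelian_group_axioms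
      simp: insert_closed insert_add insert_pt unit_invariants)

lemma insert_unit_right: "b \<in> invariants \<Longrightarrow> b \<star> \<one> \<bowtie> \<one> = b"
  by (simp add: insert_pt invariants_closed)

lemma insert_assoc:
  assumes "b \<in> invariants" "c \<in> invariants" "t \<in> carrier T"
  shows "(b \<star> c) \<star> t = b \<star> c \<star> t"
  by (rule T_eqI[of T "\<lambda>t. (b \<star> c) \<star> t" "\<lambda>t. b \<star> c \<star> t"])
    (use assms in \<open>auto intro!: addhomI T.abelian_group_axioms
      simp: insert_closed insert_add insert_pt invariants_closed insert_invariants
        insert_lact insert_ract\<close>)

lemma invariants_add: "b \<in> invariants \<Longrightarrow> c \<in> invariants \<Longrightarrow> b \<oplus>\<^bsub>T\<^esub> c \<in> invariants"
  by (auto simp: invariants_def lact_T_add ract_T_add)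

lemma insert_add_left:
  assumes "b \<in> invariants" "c \<in> invariants" "t \<in> carrier T"
  shows "(b \<oplus>\<^bsub>T\<^esub> c) \<star> t = b \<star> t \<oplus>\<^bsub>T\<^esub> c \<star> t"
  by (rule T_eqI[of T "\<lambda>t. (b \<oplus>\<^bsub>T\<^esub> c) \<star> t" "\<lambda>t. b \<star> t \<oplus>\<^bsub>T\<^esub> c \<star> t"])
    (use assms in \<open>auto intro!: addhomI T.abelian_group_axioms
      simp: insert_closed insert_add insert_pt invariants_closed invariants_add T.a_ac
        lact_T_add ract_T_add\<close>)

lemma centralizer_right_invariants: "r \<in> centralizer \<Longrightarrow> \<one> \<bowtie> r \<in> invariants"
  by (auto simp: invariants_def centralizer_closed centralizer_comm[symmetric] pt_balanced[symmetric])

lemma centralizer_left_invariants: "r \<in> centralizer \<Longrightarrow> r \<bowtie> \<one> \<in> invariants"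
  by (auto simp: invariants_def centralizer_closed centralizer_comm pt_balanced)

text \<open>Right multiplication by \<open>r\<close> is the product
  \<open>b \<star> \<one> \<bowtie> r\<close> inside the invariants.\<close>

lemma invariants_ract_centralizer:
  assumes "b \<in> invariants" "r \<in> centralizer"
  shows "b \<triangleleft> r \<in> invariants"
  using insert_invariants[OF assms(1) centralizer_right_invariants[OF assms(2)]] assms
  by (simp add: insert_pt invariants_closed centralizer_closed)

end

section \<open>Separable algebras\<close>

context ring_ext
begin

lemma pt_hom_left: "q \<in> carrier M \<Longrightarrow> (\<lambda>p. p \<bowtie> q) \<in> addhom M T"
  by (intro addhomI) (simp_all add: pt_add_left)

lemma pt_hom_right: "p \<in> carrier M \<Longrightarrow> (\<lambda>q. p \<bowtie> q) \<in> addhom M T"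
  by (intro addhomI) (simp_all add: pt_add_right)

lemmas pt_sum_left = addhom_finsum[OF M.abelian_group_axioms T.abelian_group_axioms pt_hom_left]
lemmas pt_sum_right = addhom_finsum[OF M.abelian_group_axioms T.abelian_group_axioms pt_hom_right]

end

lemma separable_algebra_iff:
  assumes "assoc_algebra K A"
  shows "separable_algebra K A \<longleftrightarrow>
    (\<exists>s. ring_ext.casimir K A (\<lambda>k. k \<odot>\<^bsub>A\<^esub> \<one>\<^bsub>A\<^esub>) s \<and> tensor_lift A (\<lambda>p q. p \<otimes>\<^bsub>A\<^esub> q) s = \<one>\<^bsub>A\<^esub>)"
  using ring_ext.separable_extension_iff[OF assoc_algebra.ring_ext_scalars[OF assms]] assms
  by (simp add: separable_algebra_def)

text \<open>If \<open>\<Sum> e\<^sub>1 \<otimes> e\<^sub>2\<close> is a separability element of \<open>R\<close>, then \<open>\<Sum> u\<^sub>k j(e\<^sub>1) \<otimes> j(e\<^sub>2) v\<^sub>k\<close>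
  is one of \<open>A\<close>.\<close>

lemma separable_algebra_dual_bases:
  fixes A :: "('k, 'a) module" and R :: "('k, 'r) module"
  assumes sep: "separable_algebra K R" and A: "assoc_algebra K A"
    and j: "j \<in> algebra_hom K R A"
    and I: "finite I" and u: "\<And>k. k \<in> I \<Longrightarrow> u k \<in> carrier A" and v: "\<And>k. k \<in> I \<Longrightarrow> v k \<in> carrier A"
    and uv: "(\<Oplus>\<^bsub>A\<^esub>k\<in>I. u k \<otimes>\<^bsub>A\<^esub> v k) = \<one>\<^bsub>A\<^esub>"
    and act: "\<And>g. g \<in> carrier A \<Longrightarrow> \<exists>\<rho>. (\<forall>k\<in>I. \<forall>l\<in>I. \<rho> k l \<in> carrier R) \<and>
        (\<forall>l\<in>I. g \<otimes>\<^bsub>A\<^esub> u l = (\<Oplus>\<^bsub>A\<^esub>k\<in>I. u k \<otimes>\<^bsub>A\<^esub> j (\<rho> k l))) \<and>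
        (\<forall>k\<in>I. v k \<otimes>\<^bsub>A\<^esub> g = (\<Oplus>\<^bsub>A\<^esub>l\<in>I. j (\<rho> k l) \<otimes>\<^bsub>A\<^esub> v l))"
  shows "separable_algebra K A"
proof -
  interpret RA: assoc_algebra K R using sep by (simp add: separable_algebra_def)
  interpret AA: assoc_algebra K A by fact
  interpret RR: ring_ext K R "\<lambda>k. k \<odot>\<^bsub>R\<^esub> \<one>\<^bsub>R\<^esub>" by (rule RA.ring_ext_scalars)
  interpret AE: ring_ext K A "\<lambda>k. k \<odot>\<^bsub>A\<^esub> \<one>\<^bsub>A\<^esub>" by (rule AA.ring_ext_scalars)
  have jk: "j (k \<odot>\<^bsub>R\<^esub> \<one>\<^bsub>R\<^esub>) = k \<odot>\<^bsub>A\<^esub> \<one>\<^bsub>A\<^esub>" if "k \<in> carrier K" for k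
    using j that ring_hom_one[of j R A] by (auto simp: algebra_hom_def)
  have jh: "j \<in> ring_hom R A" using j by (simp add: algebra_hom_def)
  note jcl [simp] = ring_hom_closed[OF jh]
  note jmult = ring_hom_mult[OF jh]
  note jadd = ring_hom_add[OF jh]
  note jone = ring_hom_one[OF jh]
  note [simp] = u v
  obtain e where e: "RR.casimir e" and \<mu>e: "RR.\<mu> e = \<one>\<^bsub>R\<^esub>"
    using sep separable_algebra_iff[OF RA.assoc_algebra_axioms] by auto
  have eT: "e \<in> carrier RR.T" using e by (rule RR.casimir_closed)
  \<comment> \<open>\<open>\<Psi> k l\<close> maps \<open>e\<close> to
    \<open>u_k e^1 (x) e^2 v_l\<close>. Only the diagonal enters the separability element, but
    moving \<open>g\<close> through it produces the mixed terms.\<close>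
  define \<Psi> where "\<Psi> k l = tensor_lift AE.T (\<lambda>r r'. AE.pt (u k \<otimes>\<^bsub>A\<^esub> j r) (j r' \<otimes>\<^bsub>A\<^esub> v l))" for k l
  have bal: "RR.bal AE.T (\<lambda>r r'. AE.pt (u k \<otimes>\<^bsub>A\<^esub> j r) (j r' \<otimes>\<^bsub>A\<^esub> v l))" if kl: "k \<in> I" "l \<in> I" for k l
  proof (rule RR.balI[OF AE.T.abelian_group_axioms])
    fix r c r' assume rc: "r \<in> carrier R" "c \<in> carrier K" "r' \<in> carrier R"
    have "AE.pt (u k \<otimes>\<^bsub>A\<^esub> j (r \<otimes>\<^bsub>R\<^esub> (c \<odot>\<^bsub>R\<^esub> \<one>\<^bsub>R\<^esub>))) (j r' \<otimes>\<^bsub>A\<^esub> v l) =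
        AE.pt ((u k \<otimes>\<^bsub>A\<^esub> j r) \<otimes>\<^bsub>A\<^esub> (c \<odot>\<^bsub>A\<^esub> \<one>\<^bsub>A\<^esub>)) (j r' \<otimes>\<^bsub>A\<^esub> v l)"
      using rc kl by (simp only: jmult jk RA.smult_closed RA.one_closed AA.m_assoc u jcl AA.smult_closed AA.one_closed)
    also have "\<dots> = AE.pt (u k \<otimes>\<^bsub>A\<^esub> j r) ((c \<odot>\<^bsub>A\<^esub> \<one>\<^bsub>A\<^esub>) \<otimes>\<^bsub>A\<^esub> (j r' \<otimes>\<^bsub>A\<^esub> v l))"
      using rc kl by (intro AE.pt_balanced) auto
    also have "\<dots> = AE.pt (u k \<otimes>\<^bsub>A\<^esub> j r) (j ((c \<odot>\<^bsub>R\<^esub> \<one>\<^bsub>R\<^esub>) \<otimes>\<^bsub>R\<^esub> r') \<otimes>\<^bsub>A\<^esub> v l)"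
      using rc kl by (simp only: jmult jk RA.smult_closed RA.one_closed AA.m_assoc v jcl AA.smult_closed AA.one_closed)
    finally show "AE.pt (u k \<otimes>\<^bsub>A\<^esub> j (r \<otimes>\<^bsub>R\<^esub> (c \<odot>\<^bsub>R\<^esub> \<one>\<^bsub>R\<^esub>))) (j r' \<otimes>\<^bsub>A\<^esub> v l) =
        AE.pt (u k \<otimes>\<^bsub>A\<^esub> j r) (j ((c \<odot>\<^bsub>R\<^esub> \<one>\<^bsub>R\<^esub>) \<otimes>\<^bsub>R\<^esub> r') \<otimes>\<^bsub>A\<^esub> v l)" .
  qed (use kl in \<open>simp_all add: jadd AA.r_distr AA.l_distr AE.pt_add_left AE.pt_add_right\<close>)
  have \<Psi>_hom: "\<Psi> k l \<in> addhom RR.T AE.T" if "k \<in> I" "l \<in> I" for k l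
    unfolding \<Psi>_def using bal that by (intro RR.lift_hom)
  have \<Psi>_pt: "\<Psi> k l (RR.pt r r') = AE.pt (u k \<otimes>\<^bsub>A\<^esub> j r) (j r' \<otimes>\<^bsub>A\<^esub> v l)"
    if "k \<in> I" "l \<in> I" "r \<in> carrier R" "r' \<in> carrier R" for k l r r'
    unfolding \<Psi>_def using bal that by (intro RR.lift_pt)
  have \<Psi>_cl [simp]: "\<Psi> k l t \<in> carrier AE.T" if "k \<in> I" "l \<in> I" "t \<in> carrier RR.T" for k l t
    using addhom_closed[OF \<Psi>_hom] that by blast
  define s where "s = (\<Oplus>\<^bsub>AE.T\<^esub>k\<in>I. \<Psi> k k e)"
  have sT: "s \<in> carrier AE.T" unfolding s_def using eT by (intro AE.T.finsum_closed) auto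
  have cas: "AE.casimir s"
    unfolding AE.casimir_def
  proof (intro conjI ballI sT)
    fix g assume g [simp]: "g \<in> carrier A"
    from act[OF g] obtain \<rho> where \<rho>: "\<And>k l. k \<in> I \<Longrightarrow> l \<in> I \<Longrightarrow> \<rho> k l \<in> carrier R"
      and gu: "\<And>l. l \<in> I \<Longrightarrow> g \<otimes>\<^bsub>A\<^esub> u l = (\<Oplus>\<^bsub>A\<^esub>k\<in>I. u k \<otimes>\<^bsub>A\<^esub> j (\<rho> k l))"
      and vg: "\<And>k. k \<in> I \<Longrightarrow> v k \<otimes>\<^bsub>A\<^esub> g = (\<Oplus>\<^bsub>A\<^esub>l\<in>I. j (\<rho> k l) \<otimes>\<^bsub>A\<^esub> v l)"
      by blast
    note [simp] = \<rho>
    \<comment> \<open>The coefficients of \<open>g u_l\<close> are absorbed into the left factor of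
      the tensor over \<open>R\<close>; \<open>right\<close> does the same for \<open>v_k g\<close>
      with the same matrix.\<close>
    have left: "lact AE.T g (\<Psi> l l t) = (\<Oplus>\<^bsub>AE.T\<^esub>k\<in>I. \<Psi> k l (lact RR.T (\<rho> k l) t))"
      if l: "l \<in> I" and t: "t \<in> carrier RR.T" for l t
    proof (rule RR.T_eqI[OF AE.T.abelian_group_axioms _ _ _ t])
      show "(\<lambda>t. lact AE.T g (\<Psi> l l t)) \<in> addhom RR.T AE.T"
        by (rule addhom_comp[OF \<Psi>_hom[OF l l] AE.lact_T_hom[OF g]])
      show "(\<lambda>t. \<Oplus>\<^bsub>AE.T\<^esub>k\<in>I. \<Psi> k l (lact RR.T (\<rho> k l) t)) \<in> addhom RR.T AE.T"
        using I l \<rho>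
        by (intro addhom_sum[OF RR.T.abelian_group_axioms AE.T.abelian_group_axioms]
            addhom_comp[OF RR.lact_T_hom \<Psi>_hom]) auto
    next
      fix r r' assume r: "r \<in> carrier R" "r' \<in> carrier R"
      have "lact AE.T g (\<Psi> l l (RR.pt r r')) = AE.pt ((g \<otimes>\<^bsub>A\<^esub> u l) \<otimes>\<^bsub>A\<^esub> j r) (j r' \<otimes>\<^bsub>A\<^esub> v l)"
        using r l by (simp add: \<Psi>_pt AA.m_assoc)
      also have "\<dots> = AE.pt (\<Oplus>\<^bsub>A\<^esub>k\<in>I. (u k \<otimes>\<^bsub>A\<^esub> j (\<rho> k l)) \<otimes>\<^bsub>A\<^esub> j r) (j r' \<otimes>\<^bsub>A\<^esub> v l)"
        unfolding gu[OF l] using r l I by (subst AA.finsum_ldistr) auto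
      also have "\<dots> = (\<Oplus>\<^bsub>AE.T\<^esub>k\<in>I. AE.pt ((u k \<otimes>\<^bsub>A\<^esub> j (\<rho> k l)) \<otimes>\<^bsub>A\<^esub> j r) (j r' \<otimes>\<^bsub>A\<^esub> v l))"
        using r l I by (intro AE.pt_sum_left) auto
      also have "\<dots> = (\<Oplus>\<^bsub>AE.T\<^esub>k\<in>I. \<Psi> k l (lact RR.T (\<rho> k l) (RR.pt r r')))"
        using r l by (intro AE.T.finsum_cong') (auto simp: \<Psi>_pt jmult AA.m_assoc)
      finally show "lact AE.T g (\<Psi> l l (RR.pt r r')) = (\<Oplus>\<^bsub>AE.T\<^esub>k\<in>I. \<Psi> k l (lact RR.T (\<rho> k l) (RR.pt r r')))" .
    qed
    have right: "ract AE.T (\<Psi> k k t) g = (\<Oplus>\<^bsub>AE.T\<^esub>l\<in>I. \<Psi> k l (ract RR.T t (\<rho> k l)))"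
      if k: "k \<in> I" and t: "t \<in> carrier RR.T" for k t
    proof (rule RR.T_eqI[OF AE.T.abelian_group_axioms _ _ _ t])
      show "(\<lambda>t. ract AE.T (\<Psi> k k t) g) \<in> addhom RR.T AE.T"
        by (rule addhom_comp[OF \<Psi>_hom[OF k k] AE.ract_T_hom[OF g]])
      show "(\<lambda>t. \<Oplus>\<^bsub>AE.T\<^esub>l\<in>I. \<Psi> k l (ract RR.T t (\<rho> k l))) \<in> addhom RR.T AE.T"
        using I k \<rho>
        by (intro addhom_sum[OF RR.T.abelian_group_axioms AE.T.abelian_group_axioms]
            addhom_comp[OF RR.ract_T_hom \<Psi>_hom]) auto
    next
      fix r r' assume r: "r \<in> carrier R" "r' \<in> carrier R"
      have "ract AE.T (\<Psi> k k (RR.pt r r')) g = AE.pt (u k \<otimes>\<^bsub>A\<^esub> j r) (j r' \<otimes>\<^bsub>A\<^esub> (v k \<otimes>\<^bsub>A\<^esub> g))"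
        using r k by (simp add: \<Psi>_pt AA.m_assoc)
      also have "\<dots> = AE.pt (u k \<otimes>\<^bsub>A\<^esub> j r) (\<Oplus>\<^bsub>A\<^esub>l\<in>I. j r' \<otimes>\<^bsub>A\<^esub> (j (\<rho> k l) \<otimes>\<^bsub>A\<^esub> v l))"
        unfolding vg[OF k] using r k I by (subst AA.finsum_rdistr) auto
      also have "\<dots> = (\<Oplus>\<^bsub>AE.T\<^esub>l\<in>I. AE.pt (u k \<otimes>\<^bsub>A\<^esub> j r) (j r' \<otimes>\<^bsub>A\<^esub> (j (\<rho> k l) \<otimes>\<^bsub>A\<^esub> v l)))"
        using r k I by (intro AE.pt_sum_right) auto
      also have "\<dots> = (\<Oplus>\<^bsub>AE.T\<^esub>l\<in>I. \<Psi> k l (ract RR.T (RR.pt r r') (\<rho> k l)))"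
        using r k by (intro AE.T.finsum_cong') (auto simp: \<Psi>_pt jmult AA.m_assoc)
      finally show "ract AE.T (\<Psi> k k (RR.pt r r')) g = (\<Oplus>\<^bsub>AE.T\<^esub>l\<in>I. \<Psi> k l (ract RR.T (RR.pt r r') (\<rho> k l)))" .
    qed
    have "lact AE.T g s = (\<Oplus>\<^bsub>AE.T\<^esub>l\<in>I. lact AE.T g (\<Psi> l l e))"
      unfolding s_def using I eT
      by (intro addhom_finsum[OF AE.T.abelian_group_axioms AE.T.abelian_group_axioms AE.lact_T_hom]) auto
    also have "\<dots> = (\<Oplus>\<^bsub>AE.T\<^esub>l\<in>I. \<Oplus>\<^bsub>AE.T\<^esub>k\<in>I. \<Psi> k l (lact RR.T (\<rho> k l) e))"
      using eT by (intro AE.T.finsum_cong') (auto simp: left intro!: AE.T.finsum_closed)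
    also have "\<dots> = (\<Oplus>\<^bsub>AE.T\<^esub>k\<in>I. \<Oplus>\<^bsub>AE.T\<^esub>l\<in>I. \<Psi> k l (lact RR.T (\<rho> k l) e))"
      using eT I by (intro AE.T.finsum_swap) auto
    \<comment> \<open>The decisive step: \<open>e\<close> is central over \<open>R\<close>, so each
      matrix entry passes from its left to its right.\<close>
    also have "\<dots> = (\<Oplus>\<^bsub>AE.T\<^esub>k\<in>I. \<Oplus>\<^bsub>AE.T\<^esub>l\<in>I. \<Psi> k l (ract RR.T e (\<rho> k l)))"
      using eT by (intro AE.T.finsum_cong') (auto simp: RR.casimir_comm[OF e] intro!: AE.T.finsum_closed)
    also have "\<dots> = (\<Oplus>\<^bsub>AE.T\<^esub>k\<in>I. ract AE.T (\<Psi> k k e) g)"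
      using eT by (intro AE.T.finsum_cong') (auto simp: right)
    also have "\<dots> = ract AE.T s g"
      unfolding s_def using I eT
      by (intro addhom_finsum[symmetric, OF AE.T.abelian_group_axioms AE.T.abelian_group_axioms AE.ract_T_hom]) auto
    finally show "lact AE.T g s = ract AE.T s g" .
  qed
  have \<mu>\<Psi>: "AE.\<mu> (\<Psi> k k t) = u k \<otimes>\<^bsub>A\<^esub> (j (RR.\<mu> t) \<otimes>\<^bsub>A\<^esub> v k)" if k: "k \<in> I" and t: "t \<in> carrier RR.T" for k t
  proof (rule RR.T_eqI[OF AA.abelian_group_axioms _ _ _ t])
    show "(\<lambda>t. AE.\<mu> (\<Psi> k k t)) \<in> addhom RR.T A"
      by (rule addhom_comp[OF \<Psi>_hom[OF k k] AE.\<mu>_hom])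
    show "(\<lambda>t. u k \<otimes>\<^bsub>A\<^esub> (j (RR.\<mu> t) \<otimes>\<^bsub>A\<^esub> v k)) \<in> addhom RR.T A"
      using k by (intro addhomI) (simp_all add: RR.lift_add[OF RR.bal_mult] jadd AA.l_distr AA.r_distr)
  qed (use k in \<open>simp add: \<Psi>_pt AE.\<mu>_pt RR.\<mu>_pt jmult AA.m_assoc\<close>)
  have "AE.\<mu> s = (\<Oplus>\<^bsub>A\<^esub>k\<in>I. AE.\<mu> (\<Psi> k k e))"
    unfolding s_def using I eT
    by (intro addhom_finsum[OF AE.T.abelian_group_axioms AA.abelian_group_axioms AE.\<mu>_hom]) auto
  also have "\<dots> = (\<Oplus>\<^bsub>A\<^esub>k\<in>I. u k \<otimes>\<^bsub>A\<^esub> v k)"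
    using eT by (intro AA.finsum_cong') (auto simp: \<mu>\<Psi> \<mu>e jone)
  finally have "AE.\<mu> s = \<one>\<^bsub>A\<^esub>" using uv by simp
  then show ?thesis
    using cas separable_algebra_iff[OF A] by blast
qed

locale algebra_ext = NA: assoc_algebra K N + MA: assoc_algebra K M
  for K :: "('k, 'x) ring_scheme" and N :: "('k, 'n) module" and M :: "('k, 'm) module" (structure) +
  fixes \<iota> :: "'n \<Rightarrow> 'm"
  assumes \<iota>_algebra_hom: "\<iota> \<in> algebra_hom K N M"

sublocale algebra_ext \<subseteq> ring_ext N M \<iota>
  by (intro ring_ext.intro ring_ext_axioms.intro NA.ring_axioms MA.ring_axioms)
    (use \<iota>_algebra_hom in \<open>simp add: algebra_hom_def\<close>)

context algebra_ext
begin

lemma \<iota>_scalar: "k \<in> carrier K \<Longrightarrow> \<iota> (k \<odot>\<^bsub>N\<^esub> \<one>\<^bsub>N\<^esub>) = k \<odot>\<^bsub>M\<^esub> \<one>"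
  using \<iota>_algebra_hom ring_hom_one[OF \<iota>_hom] by (simp add: algebra_hom_def)

text \<open>\<open>K\<close> acts on \<open>M\<close> through \<open>N\<close>, so
  \<open>N\<close>-linear maps are automatically \<open>K\<close>-linear. This is why
  \<open>A\<close> is a \<open>K\<close>-algebra although its carrier mentions only
  \<open>N\<close>.\<close>

lemma smult_eq_mult: "k \<in> carrier K \<Longrightarrow> x \<in> carrier M \<Longrightarrow> k \<odot>\<^bsub>M\<^esub> x = \<iota> (k \<odot>\<^bsub>N\<^esub> \<one>\<^bsub>N\<^esub>) \<otimes> x"
  using MA.smult_mult_left[of k \<one> x] by (simp add: \<iota>_scalar)

section \<open>The \<open>K\<close>-algebra structures on \<open>A\<close> and
  \<open>B\<close>\<close>

abbreviation "A \<equiv> bimodule_End_algebra N M \<iota>"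
abbreviation "B \<equiv> tensor_invariant_algebra N M \<iota>"
abbreviation "R \<equiv> centralizer_algebra N M \<iota>"

lemma carrier_A: "h \<in> carrier A \<longleftrightarrow> bilinear h \<and> h \<in> extensional (carrier M)"
  by (auto simp: bimodule_End_algebra_def bimodule_hom_def bilinear_def left_linear_def
      right_linear_def ring_bimodule_def hom_def)

lemma A_simps:
  "g \<otimes>\<^bsub>A\<^esub> h = compose (carrier M) g h" "\<one>\<^bsub>A\<^esub> = (\<lambda>x\<in>carrier M. x)"
  "\<zero>\<^bsub>A\<^esub> = (\<lambda>x\<in>carrier M. \<zero>)" "g \<oplus>\<^bsub>A\<^esub> h = (\<lambda>x\<in>carrier M. g x \<oplus> h x)"
  "k \<odot>\<^bsub>A\<^esub> h = (\<lambda>x\<in>carrier M. k \<odot>\<^bsub>M\<^esub> h x)"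
  by (simp_all add: bimodule_End_algebra_def)

lemma bilinear_cong:
  assumes "bilinear g" "\<And>x. x \<in> carrier M \<Longrightarrow> h x = g x"
  shows "bilinear h"
  using assms
  by (auto simp: bilinear_def left_linear_def right_linear_def hom_def Pi_def)

lemma restrict_carrier_A: "bilinear h \<Longrightarrow> restrict h (carrier M) \<in> carrier A"
  by (auto simp: carrier_A elim: bilinear_cong)

lemma carrier_A_bilinear: "h \<in> carrier A \<Longrightarrow> bilinear h"
  by (simp add: carrier_A)

lemma bilinear_closed: "bilinear h \<Longrightarrow> x \<in> carrier M \<Longrightarrow> h x \<in> carrier M"
  and bilinear_add: "bilinear h \<Longrightarrow> x \<in> carrier M \<Longrightarrow> y \<in> carrier M \<Longrightarrow> h (x \<oplus> y) = h x \<oplus> h y"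
  and bilinear_lmult: "bilinear h \<Longrightarrow> n \<in> carrier N \<Longrightarrow> x \<in> carrier M \<Longrightarrow> h (\<iota> n \<otimes> x) = \<iota> n \<otimes> h x"
  and bilinear_rmult: "bilinear h \<Longrightarrow> n \<in> carrier N \<Longrightarrow> x \<in> carrier M \<Longrightarrow> h (x \<otimes> \<iota> n) = h x \<otimes> \<iota> n"
  by (auto simp: bilinear_def left_linear_def right_linear_def hom_def)

lemma bilinear_smult: "bilinear h \<Longrightarrow> k \<in> carrier K \<Longrightarrow> x \<in> carrier M \<Longrightarrow> h (k \<odot>\<^bsub>M\<^esub> x) = k \<odot>\<^bsub>M\<^esub> h x"
  by (simp add: smult_eq_mult bilinear_lmult bilinear_closed)

lemma A_eqI:
  "g \<in> carrier A \<Longrightarrow> h \<in> carrier A \<Longrightarrow> (\<And>x. x \<in> carrier M \<Longrightarrow> g x = h x) \<Longrightarrow> g = h"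
  by (auto simp: carrier_A intro: extensionalityI)

lemma bilinear_comp: "bilinear g \<Longrightarrow> bilinear h \<Longrightarrow> bilinear (\<lambda>x. g (h x))"
  by (rule bilinearI) (simp_all add: bilinear_closed bilinear_add bilinear_lmult bilinear_rmult)

lemma bilinear_plus: "bilinear g \<Longrightarrow> bilinear h \<Longrightarrow> bilinear (\<lambda>x. g x \<oplus> h x)"
  by (rule bilinearI)
    (simp_all add: bilinear_closed bilinear_add bilinear_lmult bilinear_rmult MA.l_distr MA.r_distr MA.a_ac)

lemma bilinear_zero_map: "bilinear (\<lambda>x. \<zero>)"
  by (rule bilinearI) simp_all

lemma bilinear_id: "bilinear (\<lambda>x. x)"
  by (rule bilinearI) simp_all

lemma bilinear_uminus: "bilinear h \<Longrightarrow> bilinear (\<lambda>x. \<ominus> h x)"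
  by (rule bilinearI)
    (simp_all add: bilinear_closed bilinear_add bilinear_lmult bilinear_rmult MA.l_minus MA.r_minus MA.minus_add)

lemma bilinear_smult_map: "bilinear h \<Longrightarrow> k \<in> carrier K \<Longrightarrow> bilinear (\<lambda>x. k \<odot>\<^bsub>M\<^esub> h x)"
  by (rule bilinearI)
    (simp_all add: bilinear_closed bilinear_add bilinear_lmult bilinear_rmult MA.smult_r_distr
      MA.smult_mult_left MA.smult_mult_right)

lemma A_closed:
  "g \<in> carrier A \<Longrightarrow> h \<in> carrier A \<Longrightarrow> g \<otimes>\<^bsub>A\<^esub> h \<in> carrier A"
  "g \<in> carrier A \<Longrightarrow> h \<in> carrier A \<Longrightarrow> g \<oplus>\<^bsub>A\<^esub> h \<in> carrier A"
  "\<one>\<^bsub>A\<^esub> \<in> carrier A" "\<zero>\<^bsub>A\<^esub> \<in> carrier A"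
  "k \<in> carrier K \<Longrightarrow> h \<in> carrier A \<Longrightarrow> k \<odot>\<^bsub>A\<^esub> h \<in> carrier A"
  unfolding A_simps compose_def
  subgoal by (rule restrict_carrier_A, rule bilinear_comp) (rule carrier_A_bilinear, assumption)+
  subgoal by (rule restrict_carrier_A, rule bilinear_plus) (rule carrier_A_bilinear, assumption)+
  subgoal by (rule restrict_carrier_A, rule bilinear_id)
  subgoal by (rule restrict_carrier_A, rule bilinear_zero_map)
  subgoal by (rule restrict_carrier_A, rule bilinear_smult_map, rule carrier_A_bilinear)
  done

lemma A_apply:
  assumes "x \<in> carrier M"
  shows "(g \<otimes>\<^bsub>A\<^esub> h) x = g (h x)" "\<one>\<^bsub>A\<^esub> x = x" "\<zero>\<^bsub>A\<^esub> x = \<zero>" "(g \<oplus>\<^bsub>A\<^esub> h) x = g x \<oplus> h x"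
    "(k \<odot>\<^bsub>A\<^esub> h) x = k \<odot>\<^bsub>M\<^esub> h x"
  using assms by (simp_all add: A_simps compose_def)

lemma abelian_group_A: "abelian_group A"
proof (rule abelian_groupI)
  fix h assume h: "h \<in> carrier A"
  let ?m = "restrict (\<lambda>x. \<ominus> h x) (carrier M)"
  have m: "?m \<in> carrier A"
    by (rule restrict_carrier_A, rule bilinear_uminus, rule carrier_A_bilinear, rule h)
  moreover have "?m \<oplus>\<^bsub>A\<^esub> h = \<zero>\<^bsub>A\<^esub>"
    using h m by (intro A_eqI A_closed)
      (simp_all add: A_apply bilinear_closed[OF carrier_A_bilinear] MA.l_neg)
  ultimately show "\<exists>g\<in>carrier A. g \<oplus>\<^bsub>A\<^esub> h = \<zero>\<^bsub>A\<^esub>" by blast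
qed (auto intro!: A_closed A_eqI simp: A_apply A_closed carrier_A_bilinear bilinear_closed MA.a_ac)

lemma assoc_algebra_A: "assoc_algebra K A"
proof -
  note cl = A_closed carrier_A_bilinear bilinear_closed
  have "monoid A"
    by (rule monoidI) (auto intro!: A_closed A_eqI simp: A_apply cl)
  then have "ring A"
    by (intro ringI abelian_group_A)
      (auto intro!: A_closed A_eqI simp: A_apply cl bilinear_add[OF carrier_A_bilinear])
  moreover have "module K A"
    by (intro moduleI abelian_group_A NA.R.is_cring)
      (auto intro!: A_closed A_eqI simp: A_apply cl MA.smult_l_distr MA.smult_r_distr MA.smult_assoc1)
  moreover have "assoc_algebra_axioms K A"
    by unfold_locales
      (auto intro!: A_closed A_eqI simp: A_apply cl bilinear_smult[OF carrier_A_bilinear])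
  ultimately show ?thesis by (simp add: assoc_algebra_def)
qed

lemma carrier_B: "carrier B = invariants"
  and mult_B: "b \<otimes>\<^bsub>B\<^esub> c = b \<star> c"
  and one_B: "\<one>\<^bsub>B\<^esub> = \<one> \<bowtie> \<one>"
  and zero_B: "\<zero>\<^bsub>B\<^esub> = \<zero>\<^bsub>T\<^esub>"
  and add_B: "add B = add T"
  and smult_B: "k \<odot>\<^bsub>B\<^esub> b = (k \<odot>\<^bsub>M\<^esub> \<one>) \<triangleright> b"
  by (simp_all add: tensor_invariant_algebra_def Let_def invariants_def insert_inv_def pt_def)

lemmas B_simps = carrier_B mult_B one_B zero_B add_B smult_B

lemma abelian_group_B: "abelian_group B"
proof (rule abelian_groupI, unfold B_simps)
  fix b assume b: "b \<in> invariants"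
  note bT = invariants_closed[OF b]
  have "\<ominus>\<^bsub>T\<^esub> b \<in> invariants"
    using bT addhom_uminus[OF T.abelian_group_axioms T.abelian_group_axioms lact_T_hom]
      addhom_uminus[OF T.abelian_group_axioms T.abelian_group_axioms ract_T_hom]
    by (auto simp: invariants_def invariants_comm[OF b])
  then show "\<exists>c\<in>invariants. c \<oplus>\<^bsub>T\<^esub> b = \<zero>\<^bsub>T\<^esub>" using T.l_neg[OF bT] by blast
next
  show "\<zero>\<^bsub>T\<^esub> \<in> invariants"
    using addhom_zero[OF T.abelian_group_axioms T.abelian_group_axioms lact_T_hom]
      addhom_zero[OF T.abelian_group_axioms T.abelian_group_axioms ract_T_hom]
    by (auto simp: invariants_def)
qed (auto simp: invariants_add invariants_closed T.a_ac)

text \<open>A scalar multiple of \<open>\<one>\<close> lies in the centralizer, and acting by it on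
  the left is the product of \<open>b\<close> with an invariant.\<close>

lemma scalar_invariants:
  assumes "k \<in> carrier K" "b \<in> invariants" shows "(k \<odot>\<^bsub>M\<^esub> \<one>) \<triangleright> b \<in> invariants"
proof -
  have "k \<odot>\<^bsub>M\<^esub> \<one> \<in> centralizer"
    using assms by (auto simp: centralizer_def MA.smult_mult_left MA.smult_mult_right)
  from insert_invariants[OF assms(2) centralizer_left_invariants[OF this]]
  show ?thesis using assms by (simp add: insert_pt invariants_closed)
qed

lemma assoc_algebra_B: "assoc_algebra K B"
proof -
  note cl = insert_invariants invariants_closed invariants_add scalar_invariants unit_invariants
    insert_closed
  have monoid: "monoid B"
    by (rule monoidI, unfold B_simps)
      (auto simp: cl insert_assoc insert_unit_left insert_unit_right)
  have "ring B"
    by (rule ringI[OF abelian_group_B monoid]; unfold B_simps)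
      (auto simp: cl insert_add insert_add_left)
  moreover have "module K B"
  proof (rule moduleI[OF NA.R.is_cring abelian_group_B]; unfold B_simps)
    fix a b x assume *: "a \<in> carrier K" "b \<in> carrier K" "x \<in> invariants"
    have "(a \<otimes>\<^bsub>K\<^esub> b) \<odot>\<^bsub>M\<^esub> \<one> = (a \<odot>\<^bsub>M\<^esub> \<one>) \<otimes> (b \<odot>\<^bsub>M\<^esub> \<one>)"
      using * MA.smult_mult_left[of a \<one> "b \<odot>\<^bsub>M\<^esub> \<one>"] by (simp add: MA.smult_assoc1)
    then show "((a \<otimes>\<^bsub>K\<^esub> b) \<odot>\<^bsub>M\<^esub> \<one>) \<triangleright> x = (a \<odot>\<^bsub>M\<^esub> \<one>) \<triangleright> (b \<odot>\<^bsub>M\<^esub> \<one>) \<triangleright> x"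
      using * by (simp add: lact_T_mult cl)
  qed (auto simp: cl MA.smult_l_distr lact_T_add lact_T_add_scalar)
  moreover have "assoc_algebra_axioms K B"
  proof (rule assoc_algebra_axioms.intro; unfold B_simps)
    fix k b c assume *: "k \<in> carrier K" "b \<in> invariants" "c \<in> invariants"
    show "b \<star> ((k \<odot>\<^bsub>M\<^esub> \<one>) \<triangleright> c) = (k \<odot>\<^bsub>M\<^esub> \<one>) \<triangleright> (b \<star> c)"
      using * by (simp add: insert_lact cl)
    \<comment> \<open>Scalar multiples of \<open>\<one>\<close> commute with all of
      \<open>M\<close>, so they pass over the first factor of the tensor into which \<open>b\<close>
      is inserted.\<close>
    have sc: "(k \<odot>\<^bsub>M\<^esub> \<one>) \<triangleright> p \<triangleright> b = p \<triangleright> (k \<odot>\<^bsub>M\<^esub> \<one>) \<triangleright> b" if "p \<in> carrier M" for p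
      using * that by (simp add: lact_T_mult[symmetric] cl MA.smult_mult_left MA.smult_mult_right)
    show "((k \<odot>\<^bsub>M\<^esub> \<one>) \<triangleright> b) \<star> c = (k \<odot>\<^bsub>M\<^esub> \<one>) \<triangleright> (b \<star> c)"
      by (rule T_eqI[of T "\<lambda>c. ((k \<odot>\<^bsub>M\<^esub> \<one>) \<triangleright> b) \<star> c" "\<lambda>c. (k \<odot>\<^bsub>M\<^esub> \<one>) \<triangleright> (b \<star> c)"])
        (use * in \<open>auto intro!: addhomI T.abelian_group_axioms
          simp: cl insert_add lact_T_add insert_pt lact_ract_T[symmetric] sc\<close>)
  qed
  ultimately show ?thesis by (simp add: assoc_algebra_def)
qed

end

section \<open>Direct summands and depth two\<close>

lemma (in abelian_group) add_diff_cancel: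
  "x \<in> carrier G \<Longrightarrow> y \<in> carrier G \<Longrightarrow> x \<oplus> (y \<oplus> \<ominus> x) = y"
  by (subst a_lcomm) (simp_all add: r_neg)

lemma additive_subgroupI':
  assumes "abelian_group Q" "U \<subseteq> carrier Q" "\<zero>\<^bsub>Q\<^esub> \<in> U"
    and "\<And>x y. x \<in> U \<Longrightarrow> y \<in> U \<Longrightarrow> x \<oplus>\<^bsub>Q\<^esub> y \<in> U" "\<And>x. x \<in> U \<Longrightarrow> \<ominus>\<^bsub>Q\<^esub> x \<in> U"
  shows "additive_subgroup U Q"
  using assms by (auto intro!: additive_subgroupI subgroup.intro simp: a_inv_def)

text \<open>The projection along a complement \<open>V\<close>: \<open>p x\<close> is the only
  \<open>u\<close> in \<open>U\<close> with \<open>x - u\<close> in \<open>V\<close>. By this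
  uniqueness, recorded as \<open>pI\<close>, additivity and linearity of \<open>p\<close> reduce to
  closure of \<open>U\<close> and \<open>V\<close>.\<close>

lemma direct_summand_projection:
  fixes Q :: "('s, 't, 'a) bimodule"
  assumes ds: "direct_summand S T U Q" and Q: "abelian_group Q"
    and l: "\<And>s. s \<in> S \<Longrightarrow> lact Q s \<in> addhom Q Q"
    and r: "\<And>t. t \<in> T \<Longrightarrow> (\<lambda>x. ract Q x t) \<in> addhom Q Q"
  obtains p where "p \<in> bimodule_hom S T Q Q" "\<And>x. x \<in> carrier Q \<Longrightarrow> p x \<in> U"
    "\<And>u. u \<in> U \<Longrightarrow> p u = u"
proof -
  interpret Q: abelian_group Q by fact
  from ds obtain V where U: "subbimodule S T U Q" and V: "subbimodule S T V Q"
    and UV: "U <+>\<^bsub>Q\<^esub> V = carrier Q" and int: "U \<inter> V = {\<zero>\<^bsub>Q\<^esub>}"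
    unfolding direct_summand_def by blast
  interpret U: additive_subgroup U Q using U by (simp add: subbimodule_def)
  interpret V: additive_subgroup V Q using V by (simp add: subbimodule_def)
  note Ul = U.a_Hcarr and Vl = V.a_Hcarr
  have uniq: "u = u'" if "u \<in> U" "u' \<in> U" "x \<in> carrier Q" "x \<ominus>\<^bsub>Q\<^esub> u \<in> V" "x \<ominus>\<^bsub>Q\<^esub> u' \<in> V" for u u' x
  proof -
    have c: "u \<in> carrier Q" "u' \<in> carrier Q" using that Ul by auto
    have "(x \<ominus>\<^bsub>Q\<^esub> u') \<ominus>\<^bsub>Q\<^esub> (x \<ominus>\<^bsub>Q\<^esub> u) = u \<ominus>\<^bsub>Q\<^esub> u'"
      using c that(3) by (simp add: a_minus_def Q.minus_add Q.a_ac Q.r_neg1 Q.r_neg2 Q.add_diff_cancel)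
    moreover have "(x \<ominus>\<^bsub>Q\<^esub> u') \<ominus>\<^bsub>Q\<^esub> (x \<ominus>\<^bsub>Q\<^esub> u) \<in> V" "u \<ominus>\<^bsub>Q\<^esub> u' \<in> U"
      using that unfolding a_minus_def by auto
    ultimately have "u \<ominus>\<^bsub>Q\<^esub> u' = \<zero>\<^bsub>Q\<^esub>" using int by auto
    then have "(u \<ominus>\<^bsub>Q\<^esub> u') \<oplus>\<^bsub>Q\<^esub> u' = u'" using c by simp
    then show ?thesis using c by (simp add: a_minus_def Q.a_assoc Q.l_neg)
  qed
  have ex: "\<exists>u. u \<in> U \<and> x \<ominus>\<^bsub>Q\<^esub> u \<in> V" if x: "x \<in> carrier Q" for x
  proof -
    obtain u v where uv: "u \<in> U" "v \<in> V" "x = u \<oplus>\<^bsub>Q\<^esub> v"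
      using x unfolding UV[symmetric] by (auto simp: set_add_def set_mult_def)
    have "x \<ominus>\<^bsub>Q\<^esub> u = v"
      using uv Ul[of u] Vl[of v] by (simp add: a_minus_def Q.a_ac Q.r_neg1 Q.r_neg2 Q.add_diff_cancel)
    then show ?thesis using uv by blast
  qed
  define p where "p x = (SOME u. u \<in> U \<and> x \<ominus>\<^bsub>Q\<^esub> u \<in> V)" for x
  have p: "p x \<in> U" "x \<ominus>\<^bsub>Q\<^esub> p x \<in> V" if "x \<in> carrier Q" for x
    using someI_ex[OF ex[OF that]] by (auto simp: p_def)
  have pI: "p x = u" if "x \<in> carrier Q" "u \<in> U" "x \<ominus>\<^bsub>Q\<^esub> u \<in> V" for x u
    using uniq[OF p(1)[OF that(1)] that(2,1) p(2)[OF that(1)] that(3)] .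
  have pc: "p x \<in> carrier Q" if "x \<in> carrier Q" for x using p(1)[OF that] Ul by blast
  have "p \<in> addhom Q Q"
  proof (rule addhomI)
    fix x y assume xy: "x \<in> carrier Q" "y \<in> carrier Q"
    have "(x \<oplus>\<^bsub>Q\<^esub> y) \<ominus>\<^bsub>Q\<^esub> (p x \<oplus>\<^bsub>Q\<^esub> p y) = (x \<ominus>\<^bsub>Q\<^esub> p x) \<oplus>\<^bsub>Q\<^esub> (y \<ominus>\<^bsub>Q\<^esub> p y)"
      using xy pc by (simp add: a_minus_def Q.minus_add Q.a_ac)
    then show "p (x \<oplus>\<^bsub>Q\<^esub> y) = p x \<oplus>\<^bsub>Q\<^esub> p y"
      using xy p by (intro pI) auto
  qed (rule pc)
  moreover have "p (lact Q s x) = lact Q s (p x)" if s: "s \<in> S" and x: "x \<in> carrier Q" for s x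
  proof (rule pI)
    show "lact Q s x \<in> carrier Q" by (rule addhom_closed[OF l[OF s] x])
    show "lact Q s (p x) \<in> U" using U s p(1)[OF x] by (simp add: subbimodule_def)
    have "lact Q s (x \<ominus>\<^bsub>Q\<^esub> p x) \<in> V" using V s p(2)[OF x] by (simp add: subbimodule_def)
    then show "lact Q s x \<ominus>\<^bsub>Q\<^esub> lact Q s (p x) \<in> V"
      by (simp add: addhom_minus[OF Q Q l[OF s] x pc[OF x]])
  qed
  moreover have "p (ract Q x t) = ract Q (p x) t" if t: "t \<in> T" and x: "x \<in> carrier Q" for t x
  proof (rule pI)
    show "ract Q x t \<in> carrier Q" by (rule addhom_closed[OF r[OF t] x])
    show "ract Q (p x) t \<in> U" using U t p(1)[OF x] by (simp add: subbimodule_def)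
    have "ract Q (x \<ominus>\<^bsub>Q\<^esub> p x) t \<in> V" using V t p(2)[OF x] by (simp add: subbimodule_def)
    then show "ract Q x t \<ominus>\<^bsub>Q\<^esub> ract Q (p x) t \<in> V"
      by (simp add: addhom_minus[OF Q Q r[OF t] x pc[OF x]])
  qed
  ultimately have "p \<in> bimodule_hom S T Q Q" by (simp add: bimodule_hom_def)
  moreover have "p u = u" if "u \<in> U" for u
    using that Ul[OF that] by (intro pI) (auto simp: a_minus_def Q.r_neg V.zero_closed)
  ultimately show ?thesis using that p(1) by blast
qed

text \<open>The retraction is the projection onto the summand followed by the inverse of
  \<open>h\<close>. Its linearity is tested after applying the injective map
  \<open>h\<close>.\<close>

lemma iso_to_direct_summand_retraction:
  fixes Q :: "('s, 't, 'a) bimodule" and P :: "('s, 't, 'b) bimodule"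
  assumes iso: "iso_to_direct_summand S T P Q" and P: "abelian_group P" and Q: "abelian_group Q"
    and lP: "\<And>s x. s \<in> S \<Longrightarrow> x \<in> carrier P \<Longrightarrow> lact P s x \<in> carrier P"
    and rP: "\<And>t x. t \<in> T \<Longrightarrow> x \<in> carrier P \<Longrightarrow> ract P x t \<in> carrier P"
    and l: "\<And>s. s \<in> S \<Longrightarrow> lact Q s \<in> addhom Q Q"
    and r: "\<And>t. t \<in> T \<Longrightarrow> (\<lambda>x. ract Q x t) \<in> addhom Q Q"
  obtains h g where "h \<in> bimodule_hom S T P Q" "g \<in> bimodule_hom S T Q P"
    "\<And>x. x \<in> carrier P \<Longrightarrow> g (h x) = x"
proof -
  interpret P: abelian_group P by fact
  from iso obtain U h where ds: "direct_summand S T U Q" and h: "h \<in> bimodule_hom S T P Q"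
    and bij: "bij_betw h (carrier P) U"
    unfolding iso_to_direct_summand_def by blast
  obtain p where p: "p \<in> bimodule_hom S T Q Q" "\<And>x. x \<in> carrier Q \<Longrightarrow> p x \<in> U"
    "\<And>u. u \<in> U \<Longrightarrow> p u = u"
    using direct_summand_projection[OF ds Q l r] by blast
  define g where "g = (\<lambda>x. inv_into (carrier P) h (p x))"
  have g: "g x \<in> carrier P" "h (g x) = p x" if "x \<in> carrier Q" for x
    using bij p(2)[OF that] bij_betw_inv_into_right[OF bij]
    by (auto simp: g_def bij_betw_def inv_into_into)
  have inj: "x = y" if "h x = h y" "x \<in> carrier P" "y \<in> carrier P" for x y
    using bij that by (auto simp: bij_betw_def inj_on_def)
  note hadd = addhom_add[OF bimodule_hom_add[OF h]] and hl = bimodule_hom_lact[OF h]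
    and hr = bimodule_hom_ract[OF h]
  note padd = addhom_add[OF bimodule_hom_add[OF p(1)]] and pl = bimodule_hom_lact[OF p(1)]
    and pr = bimodule_hom_ract[OF p(1)]
  note Qcl = addhom_closed[OF l] addhom_closed[OF r] abelian_monoid.a_closed[OF abelian_group.axioms(1)[OF Q]]
  have "g (x \<oplus>\<^bsub>Q\<^esub> y) = g x \<oplus>\<^bsub>P\<^esub> g y" if "x \<in> carrier Q" "y \<in> carrier Q" for x y
    by (rule inj) (simp_all add: that g Qcl hadd padd)
  then have "g \<in> addhom Q P" using g by (intro addhomI) auto
  moreover have "g (lact Q s x) = lact P s (g x)" if "s \<in> S" "x \<in> carrier Q" for s x
    by (rule inj) (simp_all add: that g Qcl hl pl lP)
  moreover have "g (ract Q x t) = ract P (g x) t" if "t \<in> T" "x \<in> carrier Q" for t x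
    by (rule inj) (simp_all add: that g Qcl hr pr rP)
  ultimately have "g \<in> bimodule_hom S T Q P" by (simp add: bimodule_hom_def)
  moreover have "g (h x) = x" if x: "x \<in> carrier P" for x
  proof -
    have "h x \<in> U" using bij x by (auto simp: bij_betw_def)
    then show ?thesis
      using x bij by (simp add: g_def p(3) bij_betw_def inv_into_f_f)
  qed
  ultimately show ?thesis using that h by blast
qed

lemma abelian_group_bimodule_power:
  assumes "abelian_group Q" shows "abelian_group (bimodule_power n Q)"
proof -
  interpret Q: abelian_group Q by fact
  show ?thesis
  proof (rule abelian_groupI)
    fix u assume "u \<in> carrier (bimodule_power n Q)"
    then have u: "u \<in> {..<n} \<rightarrow>\<^sub>E carrier Q" by (simp add: bimodule_power_def)
    show "\<exists>v\<in>carrier (bimodule_power n Q). v \<oplus>\<^bsub>bimodule_power n Q\<^esub> u = \<zero>\<^bsub>bimodule_power n Q\<^esub>"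
      using u by (intro bexI[of _ "\<lambda>i\<in>{..<n}. \<ominus>\<^bsub>Q\<^esub> u i"])
        (auto simp: bimodule_power_def fun_eq_iff restrict_def PiE_iff extensional_def Q.l_neg)
  qed (auto simp: bimodule_power_def fun_eq_iff restrict_def PiE_iff extensional_def Q.a_ac)
qed

lemma eval_bimodule_power: "i < n \<Longrightarrow> (\<lambda>u. u i) \<in> addhom (bimodule_power n Q) Q"
  by (rule addhomI) (auto simp: bimodule_power_def)

section \<open>Quasibases from depth two, and split extensions through projections\<close>

context ring_ext
begin

lemma abelian_group_tensor_square: "abelian_group (tensor_square N M \<iota> f g)"
  by (rule abelian_group_cong[OF T.abelian_group_axioms
        tensor_square_carrier tensor_square_zero tensor_square_add])

text \<open>Take the splitting \<open>h\<close>, \<open>g\<close> of \<open>M (x) M\<close> inside a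
  power of \<open>M\<close> as an \<open>N\<close>-\<open>M\<close>-bimodule. Then
  \<open>b k\<close> is the image under \<open>g\<close> of the \<open>k\<close>-th unit vector and
  \<open>\<beta> k m\<close> is the \<open>k\<close>-th coordinate of
  \<open>h (m \<bowtie> \<one>)\<close>; the expansion is
  \<open>g (h (m \<bowtie> \<one>)) = m \<bowtie> \<one>\<close> in coordinates.\<close>

lemma D2_quasibases:
  assumes "D2_extension N M \<iota>"
  shows "\<exists>(n::nat) b \<beta>. (\<forall>k<n. b k \<in> invariants) \<and> (\<forall>k<n. bilinear (\<beta> k)) \<and>
    (\<forall>m\<in>carrier M. m \<bowtie> \<one> = (\<Oplus>\<^bsub>T\<^esub>k\<in>{..<n}. b k \<triangleleft> \<beta> k m))"
proof -
  let ?P = "tensor_square N M \<iota> \<iota> id :: ('n, 'm, (('m \<times> 'm) \<Rightarrow>\<^sub>0 int) set) bimodule"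
  let ?L = "ring_bimodule M \<iota> id :: ('n, 'm, 'm) bimodule"
  obtain n where iso: "iso_to_direct_summand (carrier N) (carrier M) ?P (bimodule_power n ?L)"
    using assms unfolding D2_extension_def by blast
  let ?Q = "bimodule_power n ?L"
  note Q0 = abelian_group_ring_bimodule[of \<iota> id]
  note Q = abelian_group_bimodule_power[OF Q0, of n]
  interpret Q: abelian_group ?Q by (rule Q)
  note P_carrier = tensor_square_carrier[of \<iota> id] and P_add = tensor_square_add[of \<iota> id]
    and P_lact = tensor_square_lact[of \<iota> id] and P_ract = tensor_square_ract[of \<iota> id]
  note P = abelian_group_tensor_square[of \<iota> id]
  have Qc: "carrier ?Q = {..<n} \<rightarrow>\<^sub>E carrier M"
    by (simp add: bimodule_power_def)
  have l: "lact ?Q s \<in> addhom ?Q ?Q" if "s \<in> carrier N" for s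
    using that by (intro addhomI)
      (auto simp: bimodule_power_def ring_bimodule_def fun_eq_iff r_distr PiE_iff)
  have r: "(\<lambda>x. ract ?Q x t) \<in> addhom ?Q ?Q" if "t \<in> carrier M" for t
    using that by (intro addhomI)
      (auto simp: bimodule_power_def ring_bimodule_def fun_eq_iff l_distr PiE_iff)
  obtain h g where h: "h \<in> bimodule_hom (carrier N) (carrier M) ?P ?Q"
    and g: "g \<in> bimodule_hom (carrier N) (carrier M) ?Q ?P"
    and gh: "\<And>x. x \<in> carrier ?P \<Longrightarrow> g (h x) = x"
    by (rule iso_to_direct_summand_retraction[OF iso P Q _ _ l r])
      (auto simp: P_carrier P_lact P_ract)
  \<comment> \<open>For \<open>k \<ge> n\<close> this is the zero vector, so \<open>E k\<close> lies
    in the power for every \<open>k\<close> and needs no bound on the index.\<close>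
  define E where "E k = (\<lambda>i\<in>{..<n}. if i = k then \<one> else \<zero>)" for k
  have E: "E k \<in> carrier ?Q" for k unfolding Qc by (auto simp: E_def)
  define b where "b k = g (E k)" for k
  define \<beta> where "\<beta> k m = h (m \<bowtie> \<one>) k" for k m
  have hc: "h t \<in> {..<n} \<rightarrow>\<^sub>E carrier M" if "t \<in> carrier T" for t
    using addhom_closed[OF bimodule_hom_add[OF h], of t] that by (simp add: P_carrier Qc)
  have bT: "b k \<in> carrier T" for k
    using addhom_closed[OF bimodule_hom_add[OF g] E] by (simp add: b_def P_carrier)
  have b: "b k \<in> invariants" if "k < n" for k
  proof -
    have "\<iota> s \<triangleright> b k = b k \<triangleleft> \<iota> s" if s: "s \<in> carrier N" for s
    proof -
      have "\<iota> s \<triangleright> b k = g (lact ?Q s (E k))"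
        using bimodule_hom_lact[OF g s E] by (simp add: b_def P_lact)
      \<comment> \<open>Unit vectors commute with \<open>N\<close>: on either side the result has
        \<open>\<iota> s\<close> at place \<open>k\<close> and zero elsewhere. Hence their images
        are invariant.\<close>
      also have "lact ?Q s (E k) = ract ?Q (E k) (\<iota> s)"
        using s by (auto simp: bimodule_power_def ring_bimodule_def E_def fun_eq_iff)
      also have "g (ract ?Q (E k) (\<iota> s)) = b k \<triangleleft> \<iota> s"
        using bimodule_hom_ract[OF g \<iota>_closed[OF s] E] by (simp add: b_def P_ract)
      finally show ?thesis .
    qed
    then show ?thesis using bT by (simp add: invariants_def)
  qed
  moreover have "bilinear (\<beta> k)" if k: "k < n" for k
  proof (rule bilinearI)
    show "\<beta> k x \<in> carrier M" if "x \<in> carrier M" for x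
      using hc[of "x \<bowtie> \<one>"] that k by (auto simp: \<beta>_def)
    show "\<beta> k (x \<oplus> y) = \<beta> k x \<oplus> \<beta> k y" if "x \<in> carrier M" "y \<in> carrier M" for x y
    proof -
      have "h (x \<bowtie> \<one> \<oplus>\<^bsub>?P\<^esub> y \<bowtie> \<one>) = h (x \<bowtie> \<one>) \<oplus>\<^bsub>?Q\<^esub> h (y \<bowtie> \<one>)"
        using that by (intro addhom_add[OF bimodule_hom_add[OF h]]) (auto simp: P_carrier)
      then show ?thesis
        using that k by (simp add: \<beta>_def pt_add_left P_add)
          (simp add: bimodule_power_def ring_bimodule_def)
    qed
    show "\<beta> k (\<iota> s \<otimes> x) = \<iota> s \<otimes> \<beta> k x" if s: "s \<in> carrier N" "x \<in> carrier M" for s x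
    proof -
      have "h (lact ?P s (x \<bowtie> \<one>)) = lact ?Q s (h (x \<bowtie> \<one>))"
        using s by (intro bimodule_hom_lact[OF h]) (auto simp: P_carrier)
      then show ?thesis
        using s k by (simp add: \<beta>_def P_lact)
          (simp add: bimodule_power_def ring_bimodule_def)
    qed
    \<comment> \<open>Right linearity of \<open>h\<close> concerns the second factor, but
      balancedness turns \<open>(x \<otimes> \<iota> s) \<bowtie> \<one>\<close> into
      \<open>x \<bowtie> \<iota> s\<close>.\<close>
    show "\<beta> k (x \<otimes> \<iota> s) = \<beta> k x \<otimes> \<iota> s" if s: "s \<in> carrier N" "x \<in> carrier M" for s x
    proof -
      have "h (ract ?P (x \<bowtie> \<one>) (\<iota> s)) = ract ?Q (h (x \<bowtie> \<one>)) (\<iota> s)"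
        using s by (intro bimodule_hom_ract[OF h]) (auto simp: P_carrier)
      then show ?thesis
        using s k pt_balanced[of x \<one> s] by (simp add: \<beta>_def P_ract)
          (simp add: bimodule_power_def ring_bimodule_def)
    qed
  qed
  moreover have "m \<bowtie> \<one> = (\<Oplus>\<^bsub>T\<^esub>k\<in>{..<n}. b k \<triangleleft> \<beta> k m)" if m: "m \<in> carrier M" for m
  proof -
    have \<beta>c: "\<beta> k m \<in> carrier M" if "k < n" for k
      using hc[of "m \<bowtie> \<one>"] that m by (auto simp: \<beta>_def)
    have rE: "ract ?Q (E k) (\<beta> k m) \<in> carrier ?Q" if "k < n" for k
      by (rule addhom_closed[OF r[OF \<beta>c[OF that]] E])
    have "h (m \<bowtie> \<one>) = (\<Oplus>\<^bsub>?Q\<^esub>k\<in>{..<n}. ract ?Q (E k) (\<beta> k m))"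
    proof (rule PiE_ext[OF hc])
      show "(\<Oplus>\<^bsub>?Q\<^esub>k\<in>{..<n}. ract ?Q (E k) (\<beta> k m)) \<in> {..<n} \<rightarrow>\<^sub>E carrier M"
        unfolding Qc[symmetric] using rE by (intro Q.finsum_closed) auto
      fix i assume i: "i \<in> {..<n}"
      have "(\<Oplus>\<^bsub>?Q\<^esub>k\<in>{..<n}. ract ?Q (E k) (\<beta> k m)) i =
          (\<Oplus>\<^bsub>?L\<^esub>k\<in>{..<n}. ract ?Q (E k) (\<beta> k m) i)"
        using i rE by (intro addhom_finsum[OF Q Q0 eval_bimodule_power]) auto
      also have "\<dots> = (\<Oplus>\<^bsub>?L\<^esub>k\<in>{..<n}. if i = k then \<beta> k m else \<zero>\<^bsub>?L\<^esub>)"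
        using i \<beta>c by (intro abelian_monoid.finsum_cong'[OF abelian_group.axioms(1)[OF Q0]])
          (auto simp: bimodule_power_def ring_bimodule_def E_def)
      also have "\<dots> = \<beta> i m"
        using i \<beta>c by (intro abelian_monoid.finsum_singleton[OF abelian_group.axioms(1)[OF Q0]]) auto
      finally show "h (m \<bowtie> \<one>) i = (\<Oplus>\<^bsub>?Q\<^esub>k\<in>{..<n}. ract ?Q (E k) (\<beta> k m)) i"
        by (simp add: \<beta>_def)
    qed (use m in simp)
    then have "m \<bowtie> \<one> = g (\<Oplus>\<^bsub>?Q\<^esub>k\<in>{..<n}. ract ?Q (E k) (\<beta> k m))"
      using gh[of "m \<bowtie> \<one>"] m by (simp add: P_carrier)
    also have "\<dots> = (\<Oplus>\<^bsub>T\<^esub>k\<in>{..<n}. g (ract ?Q (E k) (\<beta> k m)))"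
    proof (rule addhom_finsum[OF Q T.abelian_group_axioms])
      show "g \<in> addhom ?Q T"
        using bimodule_hom_add[OF g] addhom_cong[of ?Q ?Q ?P T]
        by (simp add: P_carrier P_add)
    qed (use rE in \<open>simp_all only: finite_lessThan Pi_iff lessThan_iff\<close>, blast)
    also have "\<dots> = (\<Oplus>\<^bsub>T\<^esub>k\<in>{..<n}. b k \<triangleleft> \<beta> k m)"
      using \<beta>c bT by (intro T.finsum_cong')
        (auto simp: bimodule_hom_ract[OF g _ E] b_def P_ract)
    finally show ?thesis .
  qed
  ultimately show ?thesis by blast
qed

text \<open>A complement yields the projection along it. Conversely \<open>F \<one> = \<one>\<close>
  and linearity make \<open>F\<close> the identity on the image of \<open>N\<close>, so its kernel
  is a complement. \<open>F\<close> takes values in \<open>M\<close>, which avoids inverting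
  \<open>\<iota>\<close>.\<close>

lemma split_extension_iff:
  "split_extension N M \<iota> \<longleftrightarrow> (\<exists>F. bilinear F \<and> (\<forall>x\<in>carrier M. F x \<in> \<iota> ` carrier N) \<and> F \<one> = \<one>)"
proof
  let ?Q = "ring_bimodule M \<iota> \<iota> :: ('n, 'n, 'm) bimodule"
  note Q = abelian_group_ring_bimodule[of \<iota> \<iota>]
  {
    assume "split_extension N M \<iota>"
    then have ds: "direct_summand (carrier N) (carrier N) (\<iota> ` carrier N) ?Q"
      by (simp add: split_extension_def)
    have l: "lact ?Q s \<in> addhom ?Q ?Q" if "s \<in> carrier N" for s
      using that by (intro addhomI) (auto simp: ring_bimodule_def r_distr)
    have r: "(\<lambda>x. ract ?Q x t) \<in> addhom ?Q ?Q" if "t \<in> carrier N" for t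
      using that by (intro addhomI) (auto simp: ring_bimodule_def l_distr)
    obtain p where p: "p \<in> bimodule_hom (carrier N) (carrier N) ?Q ?Q"
      "\<And>x. x \<in> carrier ?Q \<Longrightarrow> p x \<in> \<iota> ` carrier N" "\<And>u. u \<in> \<iota> ` carrier N \<Longrightarrow> p u = u"
      using direct_summand_projection[OF ds Q l r] by blast
    have "bilinear p"
      using p(1) addhom_closed[OF bimodule_hom_add[OF p(1)]] addhom_add[OF bimodule_hom_add[OF p(1)]]
        bimodule_hom_lact[OF p(1)] bimodule_hom_ract[OF p(1)]
      by (intro bilinearI) (simp_all add: ring_bimodule_def)
    moreover have "p \<one> = \<one>"
      using p(3)[of \<one>] ring_hom_one[OF \<iota>_hom] N.one_closed by (metis imageI)
    ultimately show "\<exists>F. bilinear F \<and> (\<forall>x\<in>carrier M. F x \<in> \<iota> ` carrier N) \<and> F \<one> = \<one>"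
      using p(2) by auto
  next
    assume "\<exists>F. bilinear F \<and> (\<forall>x\<in>carrier M. F x \<in> \<iota> ` carrier N) \<and> F \<one> = \<one>"
    then obtain F where F: "bilinear F" "\<And>x. x \<in> carrier M \<Longrightarrow> F x \<in> \<iota> ` carrier N" "F \<one> = \<one>"
      by blast
    note lF = bilinear_left[OF F(1)] and rF = bilinear_right[OF F(1)]
    note Fh = left_linear_hom[OF lF]
    have \<iota>h: "\<iota> \<in> addhom N M"
      by (intro addhomI) (simp_all add: ring_hom_add[OF \<iota>_hom])
    note \<iota>_zero = addhom_zero[OF N.abelian_group_axioms M.abelian_group_axioms \<iota>h]
    note \<iota>_uminus = addhom_uminus[OF N.abelian_group_axioms M.abelian_group_axioms \<iota>h]
    have F\<iota>: "F (\<iota> n) = \<iota> n" if "n \<in> carrier N" for n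
      using left_linear_left[OF lF that one_closed] that F(3) by simp
    have zero_mem: "\<zero> \<in> \<iota> ` carrier N"
      using \<iota>_zero image_eqI[of \<zero> \<iota> "\<zero>\<^bsub>N\<^esub>" "carrier N"] by simp
    have neg: "\<ominus>\<^bsub>?Q\<^esub> x = \<ominus> x" for x
      by (simp add: a_inv_def m_inv_def ring_bimodule_def)
    let ?U = "\<iota> ` carrier N" and ?V = "{x \<in> carrier M. F x = \<zero>}"
    have "additive_subgroup ?U ?Q"
    proof (rule additive_subgroupI'[OF Q])
      show "\<zero>\<^bsub>?Q\<^esub> \<in> ?U"
        using zero_mem by (simp add: ring_bimodule_def)
      show "x \<oplus>\<^bsub>?Q\<^esub> y \<in> ?U" if "x \<in> ?U" "y \<in> ?U" for x y
        using that by (auto simp: ring_bimodule_def addhom_add[OF \<iota>h, symmetric])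
      show "\<ominus>\<^bsub>?Q\<^esub> x \<in> ?U" if "x \<in> ?U" for x
        using that by (auto simp: neg \<iota>_uminus[symmetric])
    qed auto
    then have U: "subbimodule (carrier N) (carrier N) ?U ?Q"
      by (auto simp: subbimodule_def ring_bimodule_def ring_hom_mult[OF \<iota>_hom, symmetric])
    have "additive_subgroup ?V ?Q"
      using addhom_zero[OF M.abelian_group_axioms M.abelian_group_axioms Fh]
        addhom_uminus[OF M.abelian_group_axioms M.abelian_group_axioms Fh]
      by (intro additive_subgroupI'[OF Q]) (auto simp: neg, auto simp: ring_bimodule_def addhom_add[OF Fh])
    then have V: "subbimodule (carrier N) (carrier N) ?V ?Q"
      by (auto simp: subbimodule_def ring_bimodule_def left_linear_left[OF lF] right_linear_right[OF rF])
    have "?U <+>\<^bsub>?Q\<^esub> ?V = carrier ?Q"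
    proof (intro equalityI subsetI)
      fix x assume "x \<in> ?U <+>\<^bsub>?Q\<^esub> ?V"
      then show "x \<in> carrier ?Q"
        by (auto simp: set_add_def set_mult_def ring_bimodule_def)
    next
      fix x assume "x \<in> carrier ?Q"
      then have x: "x \<in> carrier M" by simp
      note Fx = addhom_closed[OF Fh x]
      have "F (F x) = F x" using F(2)[OF x] F\<iota> by auto
      then have "F (x \<ominus> F x) = F x \<ominus> F x"
        by (simp only: addhom_minus[OF M.abelian_group_axioms M.abelian_group_axioms Fh x Fx])
      also have "\<dots> = \<zero>" unfolding a_minus_def by (rule M.r_neg[OF Fx])
      finally have "x \<ominus> F x \<in> ?V" using x Fx by simp
      moreover have "x = F x \<oplus> (x \<ominus> F x)"
        using x Fx by (simp add: a_minus_def M.add_diff_cancel)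
      ultimately have "\<exists>u\<in>?U. \<exists>v\<in>?V. x = u \<oplus> v"
        using F(2)[OF x] by blast
      then show "x \<in> ?U <+>\<^bsub>?Q\<^esub> ?V"
        by (simp add: set_add_def set_mult_def ring_bimodule_def)
    qed
    moreover have "?U \<inter> ?V = {\<zero>\<^bsub>?Q\<^esub>}"
      using F\<iota> zero_mem \<iota>_zero addhom_zero[OF M.abelian_group_axioms M.abelian_group_axioms Fh]
      by (auto simp: ring_bimodule_def)
    ultimately show "split_extension N M \<iota>"
      unfolding split_extension_def direct_summand_def using U V by blast
  }
qed

end

section \<open>Split extensions and the endomorphism algebra\<close>

locale depth_two_ext = algebra_ext K N M \<iota>
  for K :: "('k, 'x) ring_scheme" and N :: "('k, 'n) module" and M :: "('k, 'm) module" (structure)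
    and \<iota> :: "'n \<Rightarrow> 'm" +
  fixes d :: nat and b :: "nat \<Rightarrow> (('m \<times> 'm) \<Rightarrow>\<^sub>0 int) set" and \<beta> :: "nat \<Rightarrow> 'm \<Rightarrow> 'm"
  assumes b_inv: "k < d \<Longrightarrow> b k \<in> invariants"
    and \<beta>_bilinear: "k < d \<Longrightarrow> bilinear (\<beta> k)"
    and quasibasis: "m \<in> carrier M \<Longrightarrow> m \<bowtie> \<one> = (\<Oplus>\<^bsub>T\<^esub>k\<in>{..<d}. b k \<triangleleft> \<beta> k m)"
begin

lemma b_closed [simp]: "k < d \<Longrightarrow> b k \<in> carrier T"
  using b_inv by (rule invariants_closed)

lemma \<beta>_closed [simp]: "k < d \<Longrightarrow> m \<in> carrier M \<Longrightarrow> \<beta> k m \<in> carrier M"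
  using \<beta>_bilinear by (rule bilinear_closed)

lemmas \<beta>_right = \<beta>_bilinear[THEN bilinear_right]
lemmas \<beta>_left = \<beta>_bilinear[THEN bilinear_left]

lemma quasibasis_hom:
  assumes "abelian_group H" "h \<in> addhom T H" "m \<in> carrier M"
  shows "h (m \<bowtie> \<one>) = (\<Oplus>\<^bsub>H\<^esub>k\<in>{..<d}. h (b k \<triangleleft> \<beta> k m))"
  unfolding quasibasis[OF assms(3)]
  by (rule addhom_finsum[OF T.abelian_group_axioms assms(1,2)]) (use assms in auto)

text \<open>Multiply the expansion of \<open>p \<bowtie> \<one>\<close> by \<open>q\<close> on the
  right. Thus the \<open>b k\<close> generate \<open>T\<close> as a right \<open>M\<close>-module,
  with coordinates \<open>\<beta>_k(t^1) t^2\<close>.\<close>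

lemma quasibasis_expand:
  assumes "t \<in> carrier T"
  shows "t = (\<Oplus>\<^bsub>T\<^esub>k\<in>{..<d}. b k \<triangleleft> appl (\<beta> k) t)"
proof (rule T_eqI[of T "\<lambda>t. t" "\<lambda>t. \<Oplus>\<^bsub>T\<^esub>k\<in>{..<d}. b k \<triangleleft> appl (\<beta> k) t"])
  have "(\<lambda>t. b k \<triangleleft> appl (\<beta> k) t) \<in> addhom T T" if "k < d" for k
    using that \<beta>_right
    by (intro addhomI) (simp_all add: appl_closed appl_add ract_T_add_scalar)
  then show "(\<lambda>t. \<Oplus>\<^bsub>T\<^esub>k\<in>{..<d}. b k \<triangleleft> appl (\<beta> k) t) \<in> addhom T T"
    by (intro addhom_sum T.abelian_group_axioms) auto
next
  fix p q assume pq: "p \<in> carrier M" "q \<in> carrier M"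
  have "p \<bowtie> q = p \<bowtie> \<one> \<triangleleft> q" using pq by simp
  also have "\<dots> = (\<Oplus>\<^bsub>T\<^esub>k\<in>{..<d}. (b k \<triangleleft> \<beta> k p) \<triangleleft> q)"
    using pq by (intro quasibasis_hom T.abelian_group_axioms ract_T_hom)
  also have "\<dots> = (\<Oplus>\<^bsub>T\<^esub>k\<in>{..<d}. b k \<triangleleft> appl (\<beta> k) (p \<bowtie> q))"
    using pq by (intro T.finsum_cong') (auto simp: appl_pt \<beta>_right ract_T_mult)
  finally show "p \<bowtie> q = (\<Oplus>\<^bsub>T\<^esub>k\<in>{..<d}. b k \<triangleleft> appl (\<beta> k) (p \<bowtie> q))" .
qed (use assms in \<open>simp_all add: T.abelian_group_axioms addhom_id\<close>)

text \<open>The quasibasis plays the role of a coproduct on the endomorphism algebra, so that an element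
  invariant under that algebra already commutes with every endomorphism in \<open>End(M\<^sub>N)\<close>.\<close>

lemma balanced_mem_image:
  assumes bal: "balanced_extension N M \<iota>" and c: "c \<in> carrier M"
    and inv: "\<And>\<gamma>. bilinear \<gamma> \<Longrightarrow> \<gamma> c = \<gamma> \<one> \<otimes> c"
  shows "c \<in> \<iota> ` carrier N"
proof -
  have comm: "h (x \<otimes> c) = h x \<otimes> c" if h: "h \<in> right_End N M \<iota>" and x: "x \<in> carrier M" for h x
  proof -
    have "right_linear h"
      using h by (auto simp: right_End_def right_linear_def)
    then have a: "right_linear (\<lambda>p. h (x \<otimes> p))"
      using x by (auto simp: right_linear_def hom_def Pi_def MA.r_distr MA.m_assoc[symmetric])
    note cl = appl_closed[OF a]
    \<comment> \<open>Contracting the expansion of \<open>m \<bowtie> \<one>\<close> with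
      \<open>p \<mapsto> h (x \<otimes> p)\<close> writes a one-sided endomorphism in terms of the
      bilinear maps \<open>\<beta> k\<close>, for which \<open>inv\<close> is available.\<close>
    have *: "h (x \<otimes> m) = (\<Oplus>k\<in>{..<d}. appl (\<lambda>p. h (x \<otimes> p)) (b k) \<otimes> \<beta> k m)" if m: "m \<in> carrier M" for m
    proof -
      have "h (x \<otimes> m) = appl (\<lambda>p. h (x \<otimes> p)) (m \<bowtie> \<one>)"
        using m lin_closed(2)[OF a m] by (simp add: appl_pt a)
      also have "\<dots> = (\<Oplus>k\<in>{..<d}. appl (\<lambda>p. h (x \<otimes> p)) (b k \<triangleleft> \<beta> k m))"
        using m by (intro quasibasis_hom MA.abelian_group_axioms appl_hom a)
      also have "\<dots> = (\<Oplus>k\<in>{..<d}. appl (\<lambda>p. h (x \<otimes> p)) (b k) \<otimes> \<beta> k m)"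
        using m by (intro MA.finsum_cong') (auto simp: appl_ract a cl)
      finally show ?thesis .
    qed
    \<comment> \<open>Here \<open>\<beta> k c\<close> becomes
      \<open>\<beta> k \<one> \<otimes> c\<close>. Removing \<open>c\<close> on the right leaves the
      same expansion at \<open>m = \<one>\<close>.\<close>
    have "h (x \<otimes> c) = (\<Oplus>k\<in>{..<d}. (appl (\<lambda>p. h (x \<otimes> p)) (b k) \<otimes> \<beta> k \<one>) \<otimes> c)"
      unfolding *[OF c] using c
      by (intro MA.finsum_cong') (auto simp: inv[OF \<beta>_bilinear] cl MA.m_assoc)
    also have "\<dots> = h (x \<otimes> \<one>) \<otimes> c"
      unfolding *[OF MA.one_closed] using c cl by (subst MA.finsum_ldistr) auto
    finally show ?thesis using x by simp
  qed
  have rc: "h x \<in> carrier M" if "h \<in> right_End N M \<iota>" "x \<in> carrier M" for h x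
    using that by (auto simp: right_End_def hom_def)
  \<comment> \<open>Right multiplication by \<open>c\<close> commutes with every endomorphism in
    \<open>right_End\<close>, so balancedness identifies it with right multiplication by an element
    of \<open>N\<close>.\<close>
  have "(\<lambda>x\<in>carrier M. x \<otimes> c) \<in> {g \<in> addhom M M \<inter> extensional (carrier M).
      \<forall>h\<in>right_End N M \<iota>. \<forall>x\<in>carrier M. g (h x) = h (g x)}"
    using c comm rc by (auto intro!: addhomI simp: MA.l_distr)
  also have "\<dots> = (\<lambda>n. \<lambda>x\<in>carrier M. x \<otimes> \<iota> n) ` carrier N"
    using bal by (simp add: balanced_extension_def bij_betw_def)
  finally obtain n where n: "n \<in> carrier N" "(\<lambda>x\<in>carrier M. x \<otimes> c) = (\<lambda>x\<in>carrier M. x \<otimes> \<iota> n)"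
    by blast
  have "c = \<iota> n" using fun_cong[OF n(2), of \<one>] n(1) c by simp
  then show ?thesis using n(1) by blast
qed

lemma eval_A: "x \<in> carrier M \<Longrightarrow> (\<lambda>h. h x) \<in> addhom A M"
  by (intro addhomI) (simp_all add: A_apply bilinear_closed[OF carrier_A_bilinear])

text \<open>A separability element \<open>\<Sum> e\<^sub>1 \<otimes> e\<^sub>2\<close> of the endomorphism algebra yields the bimodule
  projection \<open>m \<mapsto> \<Sum> e\<^sub>1 (e\<^sub>2(1) m)\<close> onto \<open>N\<close>.\<close>

lemma split_of_separable_End:
  assumes bal: "balanced_extension N M \<iota>" and sep: "separable_algebra K A"
  shows "split_extension N M \<iota>"
proof -
  interpret AA: assoc_algebra K A by (rule assoc_algebra_A)
  interpret AE: ring_ext K A "\<lambda>k. k \<odot>\<^bsub>A\<^esub> \<one>\<^bsub>A\<^esub>" by (rule AA.ring_ext_scalars)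
  obtain e where e: "AE.casimir e" and \<mu>e: "AE.\<mu> e = \<one>\<^bsub>A\<^esub>"
    using sep separable_algebra_iff[OF assoc_algebra_A] by auto
  note eT = AE.casimir_closed[OF e]
  note bil = carrier_A_bilinear and cl = bilinear_closed[OF carrier_A_bilinear]
  define L where "L m = tensor_lift M (\<lambda>g h. g (h \<one> \<otimes> m))" for m
  have bL: "AE.bal M (\<lambda>g h. g (h \<one> \<otimes> m))" if m: "m \<in> carrier M" for m
  proof (rule AE.balI[OF MA.abelian_group_axioms])
    fix g k h assume *: "g \<in> carrier A" "k \<in> carrier K" "h \<in> carrier A"
    then show "(g \<otimes>\<^bsub>A\<^esub> (k \<odot>\<^bsub>A\<^esub> \<one>\<^bsub>A\<^esub>)) (h \<one> \<otimes> m) = g (((k \<odot>\<^bsub>A\<^esub> \<one>\<^bsub>A\<^esub>) \<otimes>\<^bsub>A\<^esub> h) \<one> \<otimes> m)"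
      using m by (simp add: A_apply cl MA.smult_mult_left)
  qed (use m in \<open>simp_all add: A_apply cl bilinear_add[OF bil] MA.l_distr\<close>)
  have L_hom: "L m \<in> addhom AE.T M" if "m \<in> carrier M" for m
    unfolding L_def using bL[OF that] by (rule AE.lift_hom)
  have L_pt: "L m (AE.pt g h) = g (h \<one> \<otimes> m)" if "m \<in> carrier M" "g \<in> carrier A" "h \<in> carrier A" for m g h
    unfolding L_def using bL[OF that(1)] that(2,3) by (rule AE.lift_pt)
  note L_cl = addhom_closed[OF L_hom] and L_add = addhom_add[OF L_hom]
  have L_lact: "L m (lact AE.T g u) = g (L m u)" if "m \<in> carrier M" "g \<in> carrier A" "u \<in> carrier AE.T" for m g u
  proof (rule AE.T_eqI[OF MA.abelian_group_axioms _ _ _ that(3)])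
    show "(\<lambda>u. L m (lact AE.T g u)) \<in> addhom AE.T M"
      by (rule addhom_comp[OF AE.lact_T_hom[OF that(2)] L_hom[OF that(1)]])
    show "(\<lambda>u. g (L m u)) \<in> addhom AE.T M"
      by (rule addhom_comp[OF L_hom[OF that(1)] left_linear_hom[OF bilinear_left[OF bil[OF that(2)]]]])
  qed (use that in \<open>simp add: L_pt A_apply cl del: id_apply\<close>)
  \<comment> \<open>After right multiplication by \<open>g\<close> the second factor is evaluated at
    \<open>g \<one>\<close>, so \<open>L m\<close> sees \<open>g\<close> only through that
    value.\<close>
  have L_ract: "L m (ract AE.T u g) = L m (ract AE.T u h)"
    if "m \<in> carrier M" "g \<in> carrier A" "h \<in> carrier A" "g \<one> = h \<one>" "u \<in> carrier AE.T" for m g h u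
  proof (rule AE.T_eqI[OF MA.abelian_group_axioms _ _ _ that(5)])
    show "(\<lambda>u. L m (ract AE.T u g)) \<in> addhom AE.T M"
      by (rule addhom_comp[OF AE.ract_T_hom[OF that(2)] L_hom[OF that(1)]])
    show "(\<lambda>u. L m (ract AE.T u h)) \<in> addhom AE.T M"
      by (rule addhom_comp[OF AE.ract_T_hom[OF that(3)] L_hom[OF that(1)]])
  qed (use that in \<open>simp add: L_pt A_apply cl del: id_apply\<close>)
  have image: "L m e \<in> \<iota> ` carrier N" if m: "m \<in> carrier M" for m
  proof (rule balanced_mem_image[OF bal L_cl[OF m eT]])
    fix \<gamma> assume \<gamma>: "bilinear \<gamma>"
    \<comment> \<open>By \<open>L_ract\<close>, \<open>\<gamma>\<close> may be exchanged for left
      multiplication by \<open>\<gamma> \<one>\<close>, which also belongs to \<open>A\<close>.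
      Centrality of \<open>e\<close> brings either map to the right and back.\<close>
    let ?g = "restrict \<gamma> (carrier M)" and ?r = "\<lambda>x\<in>carrier M. \<gamma> \<one> \<otimes> x"
    have g: "?g \<in> carrier A" by (rule restrict_carrier_A[OF \<gamma>])
    have r: "?r \<in> carrier A"
      by (rule restrict_carrier_A[OF bilinear_mult_left[OF bilinear_one_centralizer[OF \<gamma>]]])
    have "\<gamma> (L m e) = L m (lact AE.T ?g e)"
      using L_lact[OF m g eT] L_cl[OF m eT] by simp
    also have "\<dots> = L m (ract AE.T e ?r)"
      using L_ract[OF m g r _ eT] \<gamma> by (simp add: AE.casimir_comm[OF e g] bilinear_closed)
    also have "\<dots> = ?r (L m e)"
      using L_lact[OF m r eT] by (simp add: AE.casimir_comm[OF e r])
    finally show "\<gamma> (L m e) = \<gamma> \<one> \<otimes> L m e"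
      using L_cl[OF m eT] by simp
  qed
  have cent: "h \<one> \<otimes> (\<iota> n \<otimes> x) = \<iota> n \<otimes> (h \<one> \<otimes> x)"
    if "h \<in> carrier A" "n \<in> carrier N" "x \<in> carrier M" for h n x
    using bilinear_lmult[OF bilinear_mult_left[OF bilinear_one_centralizer[OF bil[OF that(1)]]] that(2,3)] .
  have "bilinear (\<lambda>m. L m e)"
  proof (rule bilinearI)
    show "L (x \<oplus> y) e = L x e \<oplus> L y e" if "x \<in> carrier M" "y \<in> carrier M" for x y
      unfolding L_def using that
      by (intro AE.lift_add_fun bL eT) (simp_all add: cl MA.r_distr bilinear_add[OF bil])
    show "L (\<iota> n \<otimes> x) e = \<iota> n \<otimes> L x e" if "n \<in> carrier N" "x \<in> carrier M" for n x
      by (rule AE.T_eqI[of M "L (\<iota> n \<otimes> x)" "\<lambda>u. \<iota> n \<otimes> L x u"])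
        (use that eT in \<open>auto intro!: addhomI MA.abelian_group_axioms
          simp: L_hom L_cl L_add MA.r_distr L_pt cl cent bilinear_lmult[OF bil]\<close>)
    show "L (x \<otimes> \<iota> n) e = L x e \<otimes> \<iota> n" if "n \<in> carrier N" "x \<in> carrier M" for n x
      by (rule AE.T_eqI[of M "L (x \<otimes> \<iota> n)" "\<lambda>u. L x u \<otimes> \<iota> n"])
        (use that eT in \<open>auto intro!: addhomI MA.abelian_group_axioms
          simp: L_hom L_cl L_add MA.l_distr L_pt cl MA.m_assoc[symmetric] bilinear_rmult[OF bil]\<close>)
  qed (rule L_cl[OF _ eT])
  moreover have "L \<one> e = \<one>"
  proof -
    \<comment> \<open>At \<open>m = \<one>\<close> the formula is composition evaluated at
      \<open>\<one>\<close>, so the normalization of \<open>e\<close> gives the value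
      \<open>\<one>\<close>.\<close>
    have "L \<one> u = (AE.\<mu> u) \<one>" if "u \<in> carrier AE.T" for u
      by (rule AE.T_eqI[OF MA.abelian_group_axioms L_hom[OF MA.one_closed]
            addhom_comp[OF AE.\<mu>_hom eval_A[OF MA.one_closed]] _ that])
        (simp add: L_pt AE.\<mu>_pt A_apply cl)
    then show ?thesis using eT \<mu>e by (simp add: A_apply)
  qed
  ultimately show ?thesis
    unfolding split_extension_iff using image by blast
qed

lemma carrier_R: "carrier R = centralizer"
  by (simp add: centralizer_algebra_def centralizer_def)

lemma R_simps: "x \<otimes>\<^bsub>R\<^esub> y = x \<otimes> y" "x \<oplus>\<^bsub>R\<^esub> y = x \<oplus> y" "\<one>\<^bsub>R\<^esub> = \<one>" "k \<odot>\<^bsub>R\<^esub> x = k \<odot>\<^bsub>M\<^esub> x"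
  by (simp_all add: centralizer_algebra_def)

section \<open>From a projection onto \<open>N\<close> to separability of \<open>A\<close>\<close>

definition apl :: "('m \<Rightarrow> 'm) \<Rightarrow> (('m \<times> 'm) \<Rightarrow>\<^sub>0 int) set \<Rightarrow> (('m \<times> 'm) \<Rightarrow>\<^sub>0 int) set" where
  "apl a = tensor_lift T (\<lambda>p q. a p \<bowtie> q)"

lemma bal_apl: "bilinear a \<Longrightarrow> bal T (\<lambda>p q. a p \<bowtie> q)"
  by (intro balI T.abelian_group_axioms)
    (auto simp: bilinear_closed bilinear_add pt_add_left pt_add_right bilinear_rmult pt_balanced)

lemma apl_hom: "bilinear a \<Longrightarrow> apl a \<in> addhom T T"
  unfolding apl_def by (intro lift_hom bal_apl)

lemmas apl_closed = apl_hom[THEN addhom_closed]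
lemmas apl_add = apl_hom[THEN addhom_add]

lemma apl_pt: "bilinear a \<Longrightarrow> p \<in> carrier M \<Longrightarrow> q \<in> carrier M \<Longrightarrow> apl a (p \<bowtie> q) = a p \<bowtie> q"
  unfolding apl_def by (intro lift_pt bal_apl)

lemma apl_ract:
  assumes "bilinear a" "m \<in> carrier M" "t \<in> carrier T"
  shows "apl a (t \<triangleleft> m) = apl a t \<triangleleft> m"
  by (rule T_eqI[of T "\<lambda>t. apl a (t \<triangleleft> m)" "\<lambda>t. apl a t \<triangleleft> m"])
    (use assms in \<open>auto intro!: addhomI T.abelian_group_axioms
      simp: ract_T_add apl_closed apl_add apl_pt bilinear_closed\<close>)

lemma apl_lact:
  assumes "bilinear a" "n \<in> carrier N" "t \<in> carrier T"
  shows "apl a (\<iota> n \<triangleright> t) = \<iota> n \<triangleright> apl a t"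
  by (rule T_eqI[of T "\<lambda>t. apl a (\<iota> n \<triangleright> t)" "\<lambda>t. \<iota> n \<triangleright> apl a t"])
    (use assms in \<open>auto intro!: addhomI T.abelian_group_axioms
      simp: lact_T_add apl_closed apl_add apl_pt bilinear_closed bilinear_lmult\<close>)

lemma apl_invariants: "bilinear a \<Longrightarrow> t \<in> invariants \<Longrightarrow> apl a t \<in> invariants"
  by (auto simp: invariants_def apl_closed apl_ract[symmetric] apl_lact[symmetric])

text \<open>\<open>F\<close> takes values in \<open>N\<close>, so right \<open>N\<close>-linearity
  gives \<open>g(p) F(q m) = g(p F(q m))\<close>. Composing \<open>u k\<close> with \<open>g\<close>
  therefore amounts to applying \<open>g\<close> to the first factor of \<open>b k\<close>.\<close>

lemma ctr_apl:
  assumes F: "bilinear F" "\<And>x. x \<in> carrier M \<Longrightarrow> F x \<in> \<iota> ` carrier N"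
    and g: "bilinear g" and m: "m \<in> carrier M" and t: "t \<in> carrier T"
  shows "ctr F m (apl g t) = g (ctr F m t)"
proof (rule T_eqI[OF MA.abelian_group_axioms _ _ _ t])
  note lF = bilinear_left[OF F(1)]
  show "(\<lambda>t. ctr F m (apl g t)) \<in> addhom T M"
    by (rule addhom_comp[OF apl_hom[OF g] ctr_hom[OF lF m]])
  show "(\<lambda>t. g (ctr F m t)) \<in> addhom T M"
    by (rule addhom_comp[OF ctr_hom[OF lF m] left_linear_hom[OF bilinear_left[OF g]]])
  fix p q assume pq: "p \<in> carrier M" "q \<in> carrier M"
  then obtain n where "n \<in> carrier N" "F (q \<otimes> m) = \<iota> n"
    using F(2)[of "q \<otimes> m"] m by auto
  then show "ctr F m (apl g (p \<bowtie> q)) = g (ctr F m (p \<bowtie> q))"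
    using pq m g lF by (simp add: apl_pt ctr_pt bilinear_closed bilinear_rmult)
qed

lemma separable_End_of_split:
  assumes sepR: "separable_algebra K R" and split: "split_extension N M \<iota>"
  shows "separable_algebra K A"
proof -
  obtain F where F: "bilinear F" "\<And>x. x \<in> carrier M \<Longrightarrow> F x \<in> \<iota> ` carrier N" "F \<one> = \<one>"
    using split unfolding split_extension_iff by blast
  note lF = bilinear_left[OF F(1)]
  define u where "u k = restrict (\<lambda>m. ctr F m (b k)) (carrier M)" for k
  define v where "v k = restrict (\<beta> k) (carrier M)" for k
  define j where "j r = restrict (\<lambda>x. r \<otimes> x) (carrier M)" for r
  have uA: "u k \<in> carrier A" if "k < d" for k
    unfolding u_def by (rule restrict_carrier_A[OF ctr_bilinear[OF F(1) b_inv[OF that]]])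
  have vA: "v k \<in> carrier A" if "k < d" for k
    unfolding v_def by (rule restrict_carrier_A[OF \<beta>_bilinear[OF that]])
  have jA: "j r \<in> carrier A" if "r \<in> centralizer" for r
    unfolding j_def by (rule restrict_carrier_A[OF bilinear_mult_left[OF that]])
  have j: "j \<in> algebra_hom K R A"
    unfolding algebra_hom_def
  proof (intro CollectI conjI ring_hom_memI ballI)
    fix x y assume "x \<in> carrier R" "y \<in> carrier R"
    then show "j (x \<otimes>\<^bsub>R\<^esub> y) = j x \<otimes>\<^bsub>A\<^esub> j y" "j (x \<oplus>\<^bsub>R\<^esub> y) = j x \<oplus>\<^bsub>A\<^esub> j y"
      by (auto simp: j_def carrier_R R_simps A_simps compose_def centralizer_closed fun_eq_iff
          restrict_def MA.m_assoc MA.l_distr)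
  next
    fix k x assume "k \<in> carrier K" "x \<in> carrier R"
    then show "j (k \<odot>\<^bsub>R\<^esub> x) = k \<odot>\<^bsub>A\<^esub> j x"
      by (auto simp: j_def carrier_R R_simps A_simps centralizer_closed fun_eq_iff restrict_def
          MA.smult_mult_left)
  qed (auto simp: carrier_R jA, auto simp: j_def R_simps A_simps fun_eq_iff restrict_def)
  have evalsum: "(\<Oplus>\<^bsub>A\<^esub>k\<in>{..<d}. f k) x = (\<Oplus>k\<in>{..<d}. f k x)"
    if "x \<in> carrier M" "\<And>k. k < d \<Longrightarrow> f k \<in> carrier A" for f x
    using that by (intro addhom_finsum[OF abelian_group_A MA.abelian_group_axioms eval_A]) auto
  have sumA: "(\<Oplus>\<^bsub>A\<^esub>k\<in>{..<d}. f k) \<in> carrier A" if "\<And>k. k < d \<Longrightarrow> f k \<in> carrier A" for f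
    using that by (intro abelian_monoid.finsum_closed[OF abelian_group.axioms(1)[OF abelian_group_A]]) auto
  show ?thesis
  proof (rule separable_algebra_dual_bases[OF sepR assoc_algebra_A j, of "{..<d}" u v])
    show "(\<Oplus>\<^bsub>A\<^esub>k\<in>{..<d}. u k \<otimes>\<^bsub>A\<^esub> v k) = \<one>\<^bsub>A\<^esub>"
    proof (rule A_eqI[OF sumA A_closed(3)])
      fix x assume x: "x \<in> carrier M"
      have "(\<Oplus>\<^bsub>A\<^esub>k\<in>{..<d}. u k \<otimes>\<^bsub>A\<^esub> v k) x = (\<Oplus>k\<in>{..<d}. (u k \<otimes>\<^bsub>A\<^esub> v k) x)"
        using x uA vA by (intro evalsum A_closed) auto
      \<comment> \<open>The argument \<open>\<beta> k x\<close> moves back onto \<open>b k\<close>,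
        where the sum collapses to \<open>x \<bowtie> \<one>\<close>. Its contraction is
        \<open>x \<otimes> F \<one> = x\<close>.\<close>
      also have "\<dots> = (\<Oplus>k\<in>{..<d}. ctr F \<one> (b k \<triangleleft> \<beta> k x))"
        using x lF by (intro MA.finsum_cong') (auto simp: A_apply u_def v_def ctr_ract ctr_closed)
      also have "\<dots> = ctr F \<one> (x \<bowtie> \<one>)"
        using x lF by (intro quasibasis_hom[symmetric] MA.abelian_group_axioms ctr_hom) auto
      also have "\<dots> = \<one>\<^bsub>A\<^esub> x" using x lF F(3) by (simp add: ctr_pt A_apply)
      finally show "(\<Oplus>\<^bsub>A\<^esub>k\<in>{..<d}. u k \<otimes>\<^bsub>A\<^esub> v k) x = \<one>\<^bsub>A\<^esub> x" .
    qed (use uA vA in \<open>auto intro: A_closed\<close>)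
  next
    fix g assume gA: "g \<in> carrier A"
    note g = carrier_A_bilinear[OF gA]
    \<comment> \<open>The \<open>k\<close>-th coordinate of \<open>g(b_l^1) (x) b_l^2\<close>, an
      invariant tensor; hence the entries lie in the centralizer.\<close>
    define \<rho> where "\<rho> k l = appl (\<beta> k) (apl g (b l))" for k l
    have \<rho>: "\<rho> k l \<in> centralizer" if "k < d" "l < d" for k l
      unfolding \<rho>_def using that by (intro appl_centralizer apl_invariants \<beta>_bilinear g b_inv)
    note \<rho>M = centralizer_closed[OF \<rho>]
    have "g \<otimes>\<^bsub>A\<^esub> u l = (\<Oplus>\<^bsub>A\<^esub>k\<in>{..<d}. u k \<otimes>\<^bsub>A\<^esub> j (\<rho> k l))" if l: "l < d" for l
    proof (rule A_eqI[OF _ sumA])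
      fix m assume m: "m \<in> carrier M"
      have "(g \<otimes>\<^bsub>A\<^esub> u l) m = ctr F m (apl g (b l))"
        using m l by (simp add: A_apply u_def ctr_apl[OF F(1,2) g])
      also have "\<dots> = ctr F m (\<Oplus>\<^bsub>T\<^esub>k\<in>{..<d}. b k \<triangleleft> \<rho> k l)"
        unfolding \<rho>_def using l g by (subst quasibasis_expand) (simp_all add: apl_closed)
      also have "\<dots> = (\<Oplus>k\<in>{..<d}. ctr F m (b k \<triangleleft> \<rho> k l))"
        using m l \<rho>M lF
        by (intro addhom_finsum[OF T.abelian_group_axioms MA.abelian_group_axioms ctr_hom]) auto
      also have "\<dots> = (\<Oplus>k\<in>{..<d}. (u k \<otimes>\<^bsub>A\<^esub> j (\<rho> k l)) m)"
        using m l \<rho>M lF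
        by (intro MA.finsum_cong') (auto simp: A_apply u_def j_def ctr_ract ctr_closed)
      also have "\<dots> = (\<Oplus>\<^bsub>A\<^esub>k\<in>{..<d}. u k \<otimes>\<^bsub>A\<^esub> j (\<rho> k l)) m"
        using m l uA jA \<rho> by (intro evalsum[symmetric] A_closed) auto
      finally show "(g \<otimes>\<^bsub>A\<^esub> u l) m = (\<Oplus>\<^bsub>A\<^esub>k\<in>{..<d}. u k \<otimes>\<^bsub>A\<^esub> j (\<rho> k l)) m" .
    qed (use l gA uA jA \<rho> in \<open>auto intro!: A_closed\<close>)
    moreover have "v k \<otimes>\<^bsub>A\<^esub> g = (\<Oplus>\<^bsub>A\<^esub>l\<in>{..<d}. j (\<rho> k l) \<otimes>\<^bsub>A\<^esub> v l)" if k: "k < d" for k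
    proof (rule A_eqI[OF _ sumA])
      fix m assume m: "m \<in> carrier M"
      have "(v k \<otimes>\<^bsub>A\<^esub> g) m = appl (\<beta> k) (apl g (m \<bowtie> \<one>))"
        using m k g by (simp add: A_apply v_def apl_pt appl_pt \<beta>_right bilinear_closed)
      \<comment> \<open>The same matrix appears by expanding \<open>m \<bowtie> \<one>\<close>
        before applying \<open>g\<close> and \<open>\<beta> k\<close>, instead of expanding the
        image of \<open>b l\<close>.\<close>
      also have "\<dots> = (\<Oplus>l\<in>{..<d}. appl (\<beta> k) (apl g (b l \<triangleleft> \<beta> l m)))"
        using m k g
        by (intro quasibasis_hom[of _ "\<lambda>t. appl (\<beta> k) (apl g t)"] MA.abelian_group_axioms
            addhom_comp[OF apl_hom appl_hom] \<beta>_right)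
      also have "\<dots> = (\<Oplus>l\<in>{..<d}. (j (\<rho> k l) \<otimes>\<^bsub>A\<^esub> v l) m)"
        using m k g
        by (intro MA.finsum_cong')
          (auto simp: A_apply v_def j_def \<rho>_def apl_ract appl_ract \<beta>_right apl_closed appl_closed)
      also have "\<dots> = (\<Oplus>\<^bsub>A\<^esub>l\<in>{..<d}. j (\<rho> k l) \<otimes>\<^bsub>A\<^esub> v l) m"
        using m k vA jA \<rho> by (intro evalsum[symmetric] A_closed) auto
      finally show "(v k \<otimes>\<^bsub>A\<^esub> g) m = (\<Oplus>\<^bsub>A\<^esub>l\<in>{..<d}. j (\<rho> k l) \<otimes>\<^bsub>A\<^esub> v l) m" .
    qed (use k gA vA jA \<rho> in \<open>auto intro!: A_closed\<close>)
    ultimately show "\<exists>\<rho>. (\<forall>k\<in>{..<d}. \<forall>l\<in>{..<d}. \<rho> k l \<in> carrier R) \<and>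
        (\<forall>l\<in>{..<d}. g \<otimes>\<^bsub>A\<^esub> u l = (\<Oplus>\<^bsub>A\<^esub>k\<in>{..<d}. u k \<otimes>\<^bsub>A\<^esub> j (\<rho> k l))) \<and>
        (\<forall>k\<in>{..<d}. v k \<otimes>\<^bsub>A\<^esub> g = (\<Oplus>\<^bsub>A\<^esub>l\<in>{..<d}. j (\<rho> k l) \<otimes>\<^bsub>A\<^esub> v l))"
      using \<rho> carrier_R by (intro exI[of _ \<rho>]) auto
  qed (use uA vA in auto)
qed

end

section \<open>Separable extensions and the invariant algebra\<close>

context depth_two_ext
begin

(* Higher-order unification eta-expands the constant id inside T; rewriting that with id_apply
   would hide T from all lemmas about it. *)
declare id_apply [simp del]

lemma insert_right_pt:
  "r \<in> centralizer \<Longrightarrow> p \<in> carrier M \<Longrightarrow> q \<in> carrier M \<Longrightarrow> \<one> \<bowtie> r \<star> p \<bowtie> q = p \<bowtie> (r \<otimes> q)"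
  by (simp add: insert_pt centralizer_right_invariants centralizer_closed)

lemma finsum_B:
  assumes "\<And>k. k < n \<Longrightarrow> f k \<in> invariants"
  shows "(\<Oplus>\<^bsub>B\<^esub>k\<in>{..<n}. f k) = (\<Oplus>\<^bsub>T\<^esub>k\<in>{..<(n::nat)}. f k)"
proof -
  have "(\<lambda>x. x) \<in> addhom B T"
    by (rule addhomI) (simp_all add: B_simps invariants_closed)
  from addhom_finsum[OF abelian_group_B T.abelian_group_axioms this, of "{..<n}" f] show ?thesis
    using assms by (simp add: B_simps Pi_def)
qed

lemma left_linear_apr_map:
  assumes "bilinear a" "t \<in> carrier T"
  shows "left_linear (\<lambda>q. appl a (q \<triangleright> t))"
  unfolding left_linear_def
  using assms bilinear_right[OF assms(1)]
  by (auto intro!: addhomI simp: appl_closed appl_add lact_T_add_scalar lact_T_mult appl_lact)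

text \<open>In factors, \<open>s^1 (x) a(s^2 t^1) t^2 = t^1 s^1 (x) a(s^2) t^2\<close>: the Casimir
  property carries \<open>t^1\<close> from the right of \<open>s\<close> to its left.\<close>

lemma apr_appl_casimir:
  assumes a: "bilinear a" and s: "casimir s" and t: "t \<in> carrier T"
  shows "apr (\<lambda>q. appl a (q \<triangleright> t)) s = apr a s \<star> t"
proof (rule T_eqI[OF T.abelian_group_axioms _ _ _ t])
  note la = bilinear_left[OF a] and ra = bilinear_right[OF a]
  note sT = casimir_closed[OF s]
  have w: "apr a s \<in> invariants" by (rule apr_casimir_invariants[OF a s])
  show "(\<lambda>t. apr a s \<star> t) \<in> addhom T T" by (rule insert_hom[OF w])
  show "(\<lambda>t. apr (\<lambda>q. appl a (q \<triangleright> t)) s) \<in> addhom T T"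
  proof (rule addhomI)
    fix t u assume tu: "t \<in> carrier T" "u \<in> carrier T"
    then show "apr (\<lambda>q. appl a (q \<triangleright> (t \<oplus>\<^bsub>T\<^esub> u))) s =
        apr (\<lambda>q. appl a (q \<triangleright> t)) s \<oplus>\<^bsub>T\<^esub> apr (\<lambda>q. appl a (q \<triangleright> u)) s"
      unfolding apr_def[of "\<lambda>q. appl a (q \<triangleright> (t \<oplus>\<^bsub>T\<^esub> u))"]
        apr_def[of "\<lambda>q. appl a (q \<triangleright> t)"] apr_def[of "\<lambda>q. appl a (q \<triangleright> u)"]
      by (intro lift_add_fun bal_apr left_linear_apr_map a sT)
        (simp_all add: lact_T_add appl_add ra appl_closed pt_add_right)
  qed (simp add: apr_closed left_linear_apr_map a sT)
  fix x y assume xy: "x \<in> carrier M" "y \<in> carrier M"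
  \<comment> \<open>Proved for every \<open>u\<close>, since a Casimir element cannot be compared on
    pure tensors; centrality of \<open>s\<close> is used only after specializing.\<close>
  have "apr (\<lambda>q. appl a (q \<triangleright> (x \<bowtie> y))) u = apr a (u \<triangleleft> x) \<triangleleft> y" if "u \<in> carrier T" for u
    by (rule T_eqI[of T "apr (\<lambda>q. appl a (q \<triangleright> (x \<bowtie> y)))" "\<lambda>u. apr a (u \<triangleleft> x) \<triangleleft> y"])
      (use xy that la ra in \<open>auto intro!: addhomI T.abelian_group_axioms
        simp: apr_hom left_linear_apr_map a apr_closed apr_add ract_T_add apr_pt lin_closed appl_pt\<close>)
  from this[OF sT] show "apr (\<lambda>q. appl a (q \<triangleright> (x \<bowtie> y))) s = apr a s \<star> x \<bowtie> y"
    using xy la sT by (simp add: casimir_comm[OF s, symmetric] apr_lact insert_pt[OF w])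
qed

text \<open>The product of \<open>B\<close> multiplies second factors in the given order and first
  factors in reverse. So \<open>\<one> \<bowtie> r\<close> respects products, whereas
  \<open>r \<bowtie> \<one>\<close> would reverse them.\<close>

lemma algebra_hom_R_B: "(\<lambda>r. \<one> \<bowtie> r) \<in> algebra_hom K R B"
  unfolding algebra_hom_def
proof (intro CollectI conjI ring_hom_memI ballI)
  fix x y assume "x \<in> carrier R" "y \<in> carrier R"
  then show "\<one> \<bowtie> (x \<otimes>\<^bsub>R\<^esub> y) = (\<one> \<bowtie> x) \<otimes>\<^bsub>B\<^esub> (\<one> \<bowtie> y)" "\<one> \<bowtie> (x \<oplus>\<^bsub>R\<^esub> y) = \<one> \<bowtie> x \<oplus>\<^bsub>B\<^esub> \<one> \<bowtie> y"
    by (simp_all add: carrier_R R_simps B_simps centralizer_closed insert_right_pt pt_add_right)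
next
  fix k x assume kx: "k \<in> carrier K" "x \<in> carrier R"
  then show "\<one> \<bowtie> (k \<odot>\<^bsub>R\<^esub> x) = k \<odot>\<^bsub>B\<^esub> (\<one> \<bowtie> x)"
    using pt_balanced[of \<one> x "k \<odot>\<^bsub>N\<^esub> \<one>\<^bsub>N\<^esub>"]
    by (simp add: carrier_R R_simps B_simps centralizer_closed smult_eq_mult[of k x]) (simp add: \<iota>_scalar)
qed (simp_all add: carrier_R R_simps B_simps centralizer_right_invariants)

lemma separable_invariants_of_separable_extension:
  assumes sepR: "separable_algebra K R" and sep: "separable_extension N M \<iota>"
  shows "separable_algebra K B"
proof -
  obtain s where s: "casimir s" and \<mu>s: "\<mu> s = \<one>"
    using sep separable_extension_iff by blast
  note sT = casimir_closed[OF s]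
  define v where "v k = apr (\<beta> k) s" for k
  have v: "v k \<in> invariants" if "k < d" for k
    unfolding v_def by (rule apr_casimir_invariants[OF \<beta>_bilinear[OF that] s])
  show ?thesis
  proof (rule separable_algebra_dual_bases[OF sepR assoc_algebra_B algebra_hom_R_B, of "{..<d}" b v])
    \<comment> \<open>In factors: \<open>sum_k t^1 b_k \<beta>_k(t^2)\<close> is \<open>t^1\<close>
      times the expansion of \<open>t^2 \<bowtie> \<one>\<close>. At \<open>t = s\<close> the
      condition \<open>\<mu> s = \<one>\<close> makes it the unit of \<open>B\<close>.\<close>
    have "(\<Oplus>\<^bsub>T\<^esub>k\<in>{..<d}. b k \<star> apr (\<beta> k) t) = \<mu> t \<bowtie> \<one>" if "t \<in> carrier T" for t
    proof (rule T_eqI[OF T.abelian_group_axioms _ _ _ that])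
      show "(\<lambda>t. \<Oplus>\<^bsub>T\<^esub>k\<in>{..<d}. b k \<star> apr (\<beta> k) t) \<in> addhom T T"
        by (intro addhom_sum T.abelian_group_axioms addhom_comp[OF apr_hom insert_hom])
          (auto simp: \<beta>_left b_inv)
      show "(\<lambda>t. \<mu> t \<bowtie> \<one>) \<in> addhom T T"
        by (rule addhom_comp[OF \<mu>_hom pt_hom_left[OF MA.one_closed]])
      fix p q assume pq: "p \<in> carrier M" "q \<in> carrier M"
      have "(\<Oplus>\<^bsub>T\<^esub>k\<in>{..<d}. b k \<star> apr (\<beta> k) (p \<bowtie> q)) = (\<Oplus>\<^bsub>T\<^esub>k\<in>{..<d}. p \<triangleright> (b k \<triangleleft> \<beta> k q))"
        using pq by (intro T.finsum_cong') (auto simp: apr_pt \<beta>_left insert_pt b_inv lact_ract_T)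
      also have "\<dots> = p \<triangleright> (q \<bowtie> \<one>)"
        using pq by (intro quasibasis_hom[symmetric] T.abelian_group_axioms lact_T_hom)
      finally show "(\<Oplus>\<^bsub>T\<^esub>k\<in>{..<d}. b k \<star> apr (\<beta> k) (p \<bowtie> q)) = \<mu> (p \<bowtie> q) \<bowtie> \<one>"
        using pq by (simp add: \<mu>_pt)
    qed
    from this[OF sT] show "(\<Oplus>\<^bsub>B\<^esub>k\<in>{..<d}. b k \<otimes>\<^bsub>B\<^esub> v k) = \<one>\<^bsub>B\<^esub>"
      using v b_inv \<mu>s by (simp add: mult_B one_B finsum_B insert_invariants v_def)
  next
    fix g assume "g \<in> carrier B"
    then have g: "g \<in> invariants" by (simp add: carrier_B)
    define \<rho> where "\<rho> k l = appl (\<beta> k) (g \<star> b l)" for k l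
    have \<rho>: "\<rho> k l \<in> centralizer" if "k < d" "l < d" for k l
      unfolding \<rho>_def using that by (intro appl_centralizer insert_invariants \<beta>_bilinear g b_inv)
    note \<rho>M = centralizer_closed[OF \<rho>]
    have "g \<otimes>\<^bsub>B\<^esub> b l = (\<Oplus>\<^bsub>B\<^esub>k\<in>{..<d}. b k \<otimes>\<^bsub>B\<^esub> (\<one> \<bowtie> \<rho> k l))" if l: "l < d" for l
    proof -
      have "g \<star> b l = (\<Oplus>\<^bsub>T\<^esub>k\<in>{..<d}. b k \<triangleleft> \<rho> k l)"
        unfolding \<rho>_def using l by (intro quasibasis_expand insert_closed g) auto
      also have "\<dots> = (\<Oplus>\<^bsub>T\<^esub>k\<in>{..<d}. b k \<star> \<one> \<bowtie> \<rho> k l)"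
        using l \<rho>M by (intro T.finsum_cong')
          (auto simp: insert_pt b_inv insert_closed)
      finally show ?thesis
        using l b_inv \<rho> by (simp add: mult_B finsum_B insert_invariants centralizer_right_invariants)
    qed
    moreover have "v k \<otimes>\<^bsub>B\<^esub> g = (\<Oplus>\<^bsub>B\<^esub>l\<in>{..<d}. (\<one> \<bowtie> \<rho> k l) \<otimes>\<^bsub>B\<^esub> v l)" if k: "k < d" for k
    proof -
      \<comment> \<open>Both sides of the second relation are
        \<open>s^1 (x) \<beta>_k(s^2 g^1) g^2\<close>: \<open>apr_appl_casimir\<close> identifies it
        with \<open>v k \<star> g\<close>, and expanding \<open>q \<bowtie> \<one>\<close> under the
        second factor produces the matrix.\<close>
      let ?a = "\<lambda>q. appl (\<beta> k) (q \<triangleright> g)"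
      note la = left_linear_apr_map[OF \<beta>_bilinear[OF k] invariants_closed[OF g]]
      have "(\<Oplus>\<^bsub>T\<^esub>l\<in>{..<d}. \<one> \<bowtie> \<rho> k l \<star> apr (\<beta> l) t) = apr ?a t" if "t \<in> carrier T" for t
      proof (rule T_eqI[OF T.abelian_group_axioms _ apr_hom[OF la] _ that])
        show "(\<lambda>t. \<Oplus>\<^bsub>T\<^esub>l\<in>{..<d}. \<one> \<bowtie> \<rho> k l \<star> apr (\<beta> l) t) \<in> addhom T T"
          using k by (intro addhom_sum T.abelian_group_axioms addhom_comp[OF apr_hom insert_hom])
            (auto simp: \<beta>_left centralizer_right_invariants \<rho>)
        fix p q assume pq: "p \<in> carrier M" "q \<in> carrier M"
        have "(\<Oplus>\<^bsub>T\<^esub>l\<in>{..<d}. \<one> \<bowtie> \<rho> k l \<star> apr (\<beta> l) (p \<bowtie> q)) = (\<Oplus>\<^bsub>T\<^esub>l\<in>{..<d}. p \<bowtie> (\<rho> k l \<otimes> \<beta> l q))"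
          using pq k \<rho>M by (intro T.finsum_cong') (auto simp: apr_pt \<beta>_left insert_right_pt \<rho>)
        also have "\<dots> = p \<bowtie> (\<Oplus>l\<in>{..<d}. \<rho> k l \<otimes> \<beta> l q)"
          using pq k \<rho>M by (intro pt_sum_right[symmetric]) auto
        also have "(\<Oplus>l\<in>{..<d}. \<rho> k l \<otimes> \<beta> l q) = (\<Oplus>l\<in>{..<d}. appl (\<beta> k) (g \<star> (b l \<triangleleft> \<beta> l q)))"
          using pq k g
          by (intro MA.finsum_cong') (auto simp: \<rho>_def insert_ract appl_ract \<beta>_right insert_closed appl_closed)
        also have "\<dots> = appl (\<beta> k) (g \<star> q \<bowtie> \<one>)"
          using pq k g
          by (intro quasibasis_hom[of _ "\<lambda>t. appl (\<beta> k) (g \<star> t)", symmetric] MA.abelian_group_axioms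
              addhom_comp[OF insert_hom appl_hom] \<beta>_right)
        finally show "(\<Oplus>\<^bsub>T\<^esub>l\<in>{..<d}. \<one> \<bowtie> \<rho> k l \<star> apr (\<beta> l) (p \<bowtie> q)) = apr ?a (p \<bowtie> q)"
          using pq la g by (simp add: apr_pt insert_pt invariants_closed)
      qed
      from this[OF sT] have "v k \<star> g = (\<Oplus>\<^bsub>T\<^esub>l\<in>{..<d}. \<one> \<bowtie> \<rho> k l \<star> v l)"
        using apr_appl_casimir[OF \<beta>_bilinear[OF k] s invariants_closed[OF g]] by (simp add: v_def)
      then show ?thesis
        using k v \<rho> by (simp add: mult_B finsum_B insert_invariants centralizer_right_invariants)
    qed
    ultimately show "\<exists>\<rho>. (\<forall>k\<in>{..<d}. \<forall>l\<in>{..<d}. \<rho> k l \<in> carrier R) \<and>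
        (\<forall>l\<in>{..<d}. g \<otimes>\<^bsub>B\<^esub> b l = (\<Oplus>\<^bsub>B\<^esub>k\<in>{..<d}. b k \<otimes>\<^bsub>B\<^esub> (\<one> \<bowtie> \<rho> k l))) \<and>
        (\<forall>k\<in>{..<d}. v k \<otimes>\<^bsub>B\<^esub> g = (\<Oplus>\<^bsub>B\<^esub>l\<in>{..<d}. (\<one> \<bowtie> \<rho> k l) \<otimes>\<^bsub>B\<^esub> v l))"
      using \<rho> carrier_R by (intro exI[of _ \<rho>]) auto
  qed (use v b_inv in \<open>auto simp: carrier_B\<close>)
qed

end

section \<open>Frobenius systems, the map \<open>r\<close>, and the converse for
  \<open>B\<close>\<close>

locale frobenius_depth_two_ext = depth_two_ext K N M \<iota> d b \<beta>
  for K :: "('k, 'x) ring_scheme" and N :: "('k, 'n) module" and M :: "('k, 'm) module" (structure)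
    and \<iota> :: "'n \<Rightarrow> 'm" and d b \<beta> +
  fixes E :: "'m \<Rightarrow> 'm" and c :: nat and x y :: "nat \<Rightarrow> 'm"
  assumes E: "bilinear E" and E_image: "m \<in> carrier M \<Longrightarrow> E m \<in> \<iota> ` carrier N"
    and x_closed [simp]: "i < c \<Longrightarrow> x i \<in> carrier M" and y_closed [simp]: "i < c \<Longrightarrow> y i \<in> carrier M"
    and dual_left: "m \<in> carrier M \<Longrightarrow> (\<Oplus>i\<in>{..<c}. x i \<otimes> E (y i \<otimes> m)) = m"
    and dual_right: "m \<in> carrier M \<Longrightarrow> (\<Oplus>i\<in>{..<c}. E (m \<otimes> x i) \<otimes> y i) = m"
begin

lemmas E_left = bilinear_left[OF E] and E_right = bilinear_right[OF E]

lemma E_closed [simp]: "m \<in> carrier M \<Longrightarrow> E m \<in> carrier M"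
  by (rule bilinear_closed[OF E])

lemma E_pt: "p \<in> carrier M \<Longrightarrow> q \<in> carrier M \<Longrightarrow> m \<in> carrier M \<Longrightarrow> (p \<otimes> E m) \<bowtie> q = p \<bowtie> (E m \<otimes> q)"
  using E_image[of m] pt_balanced by auto

definition dual :: "(('m \<times> 'm) \<Rightarrow>\<^sub>0 int) set" where
  "dual = (\<Oplus>\<^bsub>T\<^esub>i\<in>{..<c}. x i \<bowtie> y i)"

lemma dual_closed [simp]: "dual \<in> carrier T"
  unfolding dual_def by (rule T.finsum_closed) auto

lemma hom_dual:
  assumes "abelian_group H" "h \<in> addhom T H"
  shows "h dual = (\<Oplus>\<^bsub>H\<^esub>i\<in>{..<c}. h (x i \<bowtie> y i))"
  unfolding dual_def by (rule addhom_finsum[OF T.abelian_group_axioms assms]) auto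

text \<open>The usual dual basis argument: expand \<open>m \<otimes> x i\<close> in the
  \<open>x j\<close>, carry the coefficients, which lie in \<open>N\<close>, across the tensor sign,
  and collect them into \<open>y j \<otimes> m\<close>.\<close>

lemma casimir_dual: "casimir dual"
  unfolding casimir_def
proof (intro conjI ballI dual_closed)
  fix m assume m: "m \<in> carrier M"
  have "m \<triangleright> dual = (\<Oplus>\<^bsub>T\<^esub>i\<in>{..<c}. (m \<otimes> x i) \<bowtie> y i)"
    unfolding hom_dual[OF T.abelian_group_axioms lact_T_hom[OF m]]
    using m by (intro T.finsum_cong') auto
  also have "\<dots> = (\<Oplus>\<^bsub>T\<^esub>i\<in>{..<c}. \<Oplus>\<^bsub>T\<^esub>j\<in>{..<c}. x j \<bowtie> (E (y j \<otimes> (m \<otimes> x i)) \<otimes> y i))"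
  proof (intro T.finsum_cong' refl)
    fix i assume "i \<in> {..<c}"
    then have i: "i < c" by simp
    have "(m \<otimes> x i) \<bowtie> y i = (\<Oplus>j\<in>{..<c}. x j \<otimes> E (y j \<otimes> (m \<otimes> x i))) \<bowtie> y i"
      using m i by (simp add: dual_left)
    also have "\<dots> = (\<Oplus>\<^bsub>T\<^esub>j\<in>{..<c}. (x j \<otimes> E (y j \<otimes> (m \<otimes> x i))) \<bowtie> y i)"
      using m i by (intro pt_sum_left) auto
    also have "\<dots> = (\<Oplus>\<^bsub>T\<^esub>j\<in>{..<c}. x j \<bowtie> (E (y j \<otimes> (m \<otimes> x i)) \<otimes> y i))"
      using m i by (intro T.finsum_cong') (auto simp: E_pt)
    finally show "(m \<otimes> x i) \<bowtie> y i = (\<Oplus>\<^bsub>T\<^esub>j\<in>{..<c}. x j \<bowtie> (E (y j \<otimes> (m \<otimes> x i)) \<otimes> y i))" .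
  qed (use m in \<open>auto intro!: T.finsum_closed\<close>)
  also have "\<dots> = (\<Oplus>\<^bsub>T\<^esub>j\<in>{..<c}. \<Oplus>\<^bsub>T\<^esub>i\<in>{..<c}. x j \<bowtie> (E (y j \<otimes> (m \<otimes> x i)) \<otimes> y i))"
    using m by (intro T.finsum_swap) auto
  also have "\<dots> = (\<Oplus>\<^bsub>T\<^esub>j\<in>{..<c}. x j \<bowtie> y j \<triangleleft> m)"
  proof (intro T.finsum_cong' refl)
    fix j assume "j \<in> {..<c}"
    then have j: "j < c" by simp
    have "(\<Oplus>\<^bsub>T\<^esub>i\<in>{..<c}. x j \<bowtie> (E (y j \<otimes> (m \<otimes> x i)) \<otimes> y i)) =
        x j \<bowtie> (\<Oplus>i\<in>{..<c}. E (y j \<otimes> (m \<otimes> x i)) \<otimes> y i)"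
      using m j by (intro pt_sum_right[symmetric]) auto
    also have "(\<Oplus>i\<in>{..<c}. E (y j \<otimes> (m \<otimes> x i)) \<otimes> y i) = (\<Oplus>i\<in>{..<c}. E ((y j \<otimes> m) \<otimes> x i) \<otimes> y i)"
      using m j by (intro MA.finsum_cong') (auto simp: MA.m_assoc)
    finally show "(\<Oplus>\<^bsub>T\<^esub>i\<in>{..<c}. x j \<bowtie> (E (y j \<otimes> (m \<otimes> x i)) \<otimes> y i)) = x j \<bowtie> y j \<triangleleft> m"
      using m j by (simp add: dual_right)
  qed (use m in auto)
  also have "\<dots> = dual \<triangleleft> m"
    by (rule hom_dual[OF T.abelian_group_axioms ract_T_hom[OF m], symmetric])
  finally show "m \<triangleright> dual = dual \<triangleleft> m" .
qed

lemma casimir_invariants: "casimir w \<Longrightarrow> w \<in> invariants"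
  by (simp add: casimir_def invariants_def)

lemma ctr_dual: "m \<in> carrier M \<Longrightarrow> ctr E m dual = m"
  using hom_dual[OF MA.abelian_group_axioms ctr_hom[OF E_left]] dual_left[of m]
  by (simp add: ctr_pt E_left cong: MA.finsum_cong)

lemma right_linear_E_mult: "m \<in> carrier M \<Longrightarrow> right_linear (\<lambda>p. E (m \<otimes> p))"
  by (auto simp: right_linear_def hom_def Pi_def MA.r_distr bilinear_add[OF E]
      MA.m_assoc[symmetric] bilinear_rmult[OF E])

lemma appl_dual: "m \<in> carrier M \<Longrightarrow> appl (\<lambda>p. E (m \<otimes> p)) dual = m"
  using hom_dual[OF MA.abelian_group_axioms appl_hom[OF right_linear_E_mult]] dual_right[of m]
  by (simp add: appl_pt right_linear_E_mult cong: MA.finsum_cong)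

lemma appl_E_closed [simp]: "t \<in> carrier T \<Longrightarrow> appl E t \<in> carrier M"
  by (rule appl_closed[OF E_right])

text \<open>Dual bases give \<open>w = sum_j x_j (x) E(y_j w^1) w^2\<close>. Since \<open>w\<close>
  is central, \<open>y_j\<close> reappears at the far right, and the remaining coefficient
  \<open>E(w^1) w^2\<close> is the same for every \<open>j\<close>.\<close>

lemma casimir_eq_dual:
  assumes w: "casimir w"
  shows "w = \<one> \<bowtie> appl E w \<star> dual"
proof -
  note wT = casimir_closed[OF w]
  have \<rho>: "appl E w \<in> centralizer"
    by (rule appl_centralizer[OF E casimir_invariants[OF w]])
  have "(\<Oplus>\<^bsub>T\<^esub>j\<in>{..<c}. x j \<bowtie> appl E (y j \<triangleright> t)) = t" if "t \<in> carrier T" for t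
  proof (rule T_eqI[OF T.abelian_group_axioms _ addhom_id _ that])
    show "(\<lambda>t. \<Oplus>\<^bsub>T\<^esub>j\<in>{..<c}. x j \<bowtie> appl E (y j \<triangleright> t)) \<in> addhom T T"
      by (intro addhom_sum T.abelian_group_axioms
          addhom_comp[OF addhom_comp[OF lact_T_hom appl_hom[OF E_right]] pt_hom_right]) auto
    fix p q assume pq: "p \<in> carrier M" "q \<in> carrier M"
    have "(\<Oplus>\<^bsub>T\<^esub>j\<in>{..<c}. x j \<bowtie> appl E (y j \<triangleright> p \<bowtie> q)) = (\<Oplus>\<^bsub>T\<^esub>j\<in>{..<c}. (x j \<otimes> E (y j \<otimes> p)) \<bowtie> q)"
      using pq by (intro T.finsum_cong') (auto simp: appl_pt E_right E_pt)
    also have "\<dots> = (\<Oplus>j\<in>{..<c}. x j \<otimes> E (y j \<otimes> p)) \<bowtie> q"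
      using pq by (intro pt_sum_left[symmetric]) auto
    finally show "(\<Oplus>\<^bsub>T\<^esub>j\<in>{..<c}. x j \<bowtie> appl E (y j \<triangleright> p \<bowtie> q)) = p \<bowtie> q"
      using pq by (simp add: dual_left)
  qed
  from this[OF wT] have "w = (\<Oplus>\<^bsub>T\<^esub>j\<in>{..<c}. x j \<bowtie> appl E (y j \<triangleright> w))" by simp
  also have "\<dots> = (\<Oplus>\<^bsub>T\<^esub>j\<in>{..<c}. \<one> \<bowtie> appl E w \<star> x j \<bowtie> y j)"
    using \<rho> wT by (intro T.finsum_cong')
      (auto simp: casimir_comm[OF w] appl_ract E_right insert_right_pt centralizer_closed)
  also have "\<dots> = \<one> \<bowtie> appl E w \<star> dual"
    using hom_dual[OF T.abelian_group_axioms insert_hom[OF centralizer_right_invariants[OF \<rho>]]] by simp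
  finally show ?thesis .
qed

text \<open>The coefficient that \<open>casimir_eq_dual\<close> assigns to the Casimir element
  \<open>w \<star> dual\<close>; in factors it is \<open>sum_i E(x_i w^1) w^2 y_i\<close>.\<close>

definition r :: "(('m \<times> 'm) \<Rightarrow>\<^sub>0 int) set \<Rightarrow> 'm" where
  "r w = appl E (w \<star> dual)"

lemma r_centralizer: "w \<in> invariants \<Longrightarrow> r w \<in> centralizer"
  unfolding r_def by (rule appl_centralizer[OF E insert_invariants[OF _ casimir_invariants[OF casimir_dual]]])

lemma r_closed [simp]: "w \<in> invariants \<Longrightarrow> r w \<in> carrier M"
  by (rule centralizer_closed[OF r_centralizer])

lemma insert_dual: "w \<in> invariants \<Longrightarrow> w \<star> dual = \<one> \<bowtie> r w \<star> dual"
  unfolding r_def by (rule casimir_eq_dual[OF insert_casimir[OF _ casimir_dual]])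

text \<open>On \<open>dual\<close>, \<open>w\<close> acts as \<open>\<one> \<bowtie> r w\<close>;
  letting \<open>v\<close> act afterwards, the two products have the same effect on
  \<open>dual\<close>, which is all that \<open>r\<close> sees. So \<open>r\<close> transports the
  action of \<open>B\<close> on Casimir elements to \<open>R\<close>.\<close>

lemma r_insert:
  assumes "v \<in> invariants" "w \<in> invariants"
  shows "r (v \<star> w) = r (v \<star> \<one> \<bowtie> r w)"
proof -
  have "(v \<star> w) \<star> dual = v \<star> \<one> \<bowtie> r w \<star> dual"
    using assms by (simp add: insert_assoc insert_dual[OF assms(2), symmetric])
  also have "\<dots> = (v \<star> \<one> \<bowtie> r w) \<star> dual"
    using assms by (simp add: insert_assoc centralizer_right_invariants r_centralizer)
  finally show ?thesis by (simp add: r_def[of "v \<star> w"] r_def[of "v \<star> \<one> \<bowtie> r w"])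
qed

text \<open>Contract the expansion of \<open>m \<bowtie> \<one>\<close> with
  \<open>t \<mapsto> t^1 E(t^2 q)\<close>. This eliminates the quasibasis wherever
  \<open>\<gamma> k\<close> follows \<open>\<beta> k\<close>.\<close>

lemma ctr_b_sum:
  assumes "m \<in> carrier M" "q \<in> carrier M"
  shows "(\<Oplus>k\<in>{..<d}. ctr E (\<beta> k m \<otimes> q) (b k)) = m \<otimes> E q"
proof -
  have "(\<Oplus>k\<in>{..<d}. ctr E (\<beta> k m \<otimes> q) (b k)) = (\<Oplus>k\<in>{..<d}. ctr E q (b k \<triangleleft> \<beta> k m))"
    using assms by (intro MA.finsum_cong') (auto simp: ctr_ract E_left ctr_closed)
  also have "\<dots> = ctr E q (m \<bowtie> \<one>)"
    using assms by (intro quasibasis_hom[symmetric] MA.abelian_group_axioms ctr_hom E_left)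
  finally show ?thesis using assms by (simp add: ctr_pt E_left)
qed

text \<open>The dual family of the forward direction, with \<open>dual\<close> in place of a
  separability element, which is not yet at hand.\<close>

definition v :: "nat \<Rightarrow> (('m \<times> 'm) \<Rightarrow>\<^sub>0 int) set" where
  "v k = apr (\<beta> k) dual"

lemma v_invariants: "k < d \<Longrightarrow> v k \<in> invariants"
  unfolding v_def by (rule apr_casimir_invariants[OF \<beta>_bilinear casimir_dual])

abbreviation "\<gamma> k \<equiv> \<lambda>m. ctr E m (b k)"

lemma \<gamma>_bilinear: "k < d \<Longrightarrow> bilinear (\<gamma> k)"
  by (rule ctr_bilinear[OF E b_inv])

text \<open>For \<open>t = p \<bowtie> q\<close> the left side is \<open>p\<close> times
  \<open>x_i (x) \<gamma>_k(\<beta>_k(y_i) q)\<close> summed over \<open>i\<close> and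
  \<open>k\<close>. By \<open>ctr_b_sum\<close> this is \<open>p dual E(q)\<close>, and centrality
  of \<open>dual\<close> moves \<open>E(q)\<close> to the left.\<close>

lemma sum_apr_v:
  assumes t: "t \<in> carrier T"
  shows "(\<Oplus>\<^bsub>T\<^esub>k\<in>{..<d}. apr (\<gamma> k) (v k \<star> t)) = ctr E \<one> t \<triangleright> dual"
proof (rule T_eqI[OF T.abelian_group_axioms _ _ _ t])
  note \<gamma>l = bilinear_left[OF \<gamma>_bilinear]
  show "(\<lambda>t. \<Oplus>\<^bsub>T\<^esub>k\<in>{..<d}. apr (\<gamma> k) (v k \<star> t)) \<in> addhom T T"
    by (intro addhom_sum T.abelian_group_axioms addhom_comp[OF insert_hom apr_hom])
      (auto simp: v_invariants \<gamma>l)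
  show "(\<lambda>t. ctr E \<one> t \<triangleright> dual) \<in> addhom T T"
    by (intro addhomI) (simp_all add: ctr_closed ctr_add E_left lact_T_add_scalar)
  have sum: "(\<Oplus>\<^bsub>T\<^esub>k\<in>{..<d}. apr (\<gamma> k) (apr (\<beta> k) w \<triangleleft> q)) = w \<triangleleft> E q"
    if q: "q \<in> carrier M" and w: "w \<in> carrier T" for q w
  proof (rule T_eqI[OF T.abelian_group_axioms _ ract_T_hom[OF E_closed[OF q]] _ w])
    show "(\<lambda>w. \<Oplus>\<^bsub>T\<^esub>k\<in>{..<d}. apr (\<gamma> k) (apr (\<beta> k) w \<triangleleft> q)) \<in> addhom T T"
      using q by (intro addhom_sum T.abelian_group_axioms
          addhom_comp[OF addhom_comp[OF apr_hom ract_T_hom] apr_hom]) (auto simp: \<beta>_left \<gamma>l)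
    fix p m assume pm: "p \<in> carrier M" "m \<in> carrier M"
    have "(\<Oplus>\<^bsub>T\<^esub>k\<in>{..<d}. apr (\<gamma> k) (apr (\<beta> k) (p \<bowtie> m) \<triangleleft> q)) =
        (\<Oplus>\<^bsub>T\<^esub>k\<in>{..<d}. p \<bowtie> ctr E (\<beta> k m \<otimes> q) (b k))"
      using pm q by (intro T.finsum_cong') (auto simp: apr_pt \<beta>_left \<gamma>l ctr_closed E_left)
    also have "\<dots> = p \<bowtie> (m \<otimes> E q)"
      using pm q by (subst pt_sum_right[symmetric]) (auto simp: ctr_b_sum ctr_closed E_left)
    finally show "(\<Oplus>\<^bsub>T\<^esub>k\<in>{..<d}. apr (\<gamma> k) (apr (\<beta> k) (p \<bowtie> m) \<triangleleft> q)) = p \<bowtie> m \<triangleleft> E q"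
      using pm q by simp
  qed
  fix p q assume pq: "p \<in> carrier M" "q \<in> carrier M"
  have "(\<Oplus>\<^bsub>T\<^esub>k\<in>{..<d}. apr (\<gamma> k) (v k \<star> p \<bowtie> q)) =
      (\<Oplus>\<^bsub>T\<^esub>k\<in>{..<d}. p \<triangleright> apr (\<gamma> k) (apr (\<beta> k) dual \<triangleleft> q))"
    using pq by (intro T.finsum_cong')
      (auto simp: insert_pt v_invariants v_def[symmetric] lact_ract_T apr_lact \<gamma>l
        invariants_closed apr_closed)
  also have "\<dots> = p \<triangleright> (\<Oplus>\<^bsub>T\<^esub>k\<in>{..<d}. apr (\<gamma> k) (apr (\<beta> k) dual \<triangleleft> q))"
    using pq by (intro addhom_finsum[symmetric, OF T.abelian_group_axioms T.abelian_group_axioms lact_T_hom])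
      (auto simp: \<gamma>l \<beta>_left apr_closed)
  also have "\<dots> = p \<triangleright> E q \<triangleright> dual"
    using pq by (simp add: sum casimir_comm[OF casimir_dual])
  finally show "(\<Oplus>\<^bsub>T\<^esub>k\<in>{..<d}. apr (\<gamma> k) (v k \<star> p \<bowtie> q)) = ctr E \<one> (p \<bowtie> q) \<triangleright> dual"
    using pq by (simp add: ctr_pt E_left lact_T_mult)
qed

lemma r_v:
  assumes k: "k < d"
  shows "r (v k) = (\<Oplus>j\<in>{..<c}. \<beta> k (x j) \<otimes> y j)"
proof -
  \<comment> \<open>Values of \<open>E\<close> lie in \<open>N\<close>, so they may be moved inside
    \<open>\<beta> k\<close> by left linearity. With \<open>w = dual\<close> the argument of
    \<open>\<beta> k\<close> then collapses to \<open>m\<close>.\<close>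
  have E\<beta>: "appl E (m \<triangleright> apr (\<beta> k) w) = \<beta> k (appl (\<lambda>p. E (m \<otimes> p)) w)"
    if m: "m \<in> carrier M" and w: "w \<in> carrier T" for m w
  proof (rule T_eqI[OF MA.abelian_group_axioms _ _ _ w])
    show "(\<lambda>w. appl E (m \<triangleright> apr (\<beta> k) w)) \<in> addhom T M"
      by (rule addhom_comp[OF addhom_comp[OF apr_hom[OF \<beta>_left[OF k]] lact_T_hom[OF m]] appl_hom[OF E_right]])
    show "(\<lambda>w. \<beta> k (appl (\<lambda>p. E (m \<otimes> p)) w)) \<in> addhom T M"
      by (rule addhom_comp[OF appl_hom[OF right_linear_E_mult[OF m]] left_linear_hom[OF \<beta>_left[OF k]]])
    fix p q assume pq: "p \<in> carrier M" "q \<in> carrier M"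
    then obtain n where "n \<in> carrier N" "E (m \<otimes> p) = \<iota> n" using E_image[of "m \<otimes> p"] m by auto
    then show "appl E (m \<triangleright> apr (\<beta> k) (p \<bowtie> q)) = \<beta> k (appl (\<lambda>p. E (m \<otimes> p)) (p \<bowtie> q))"
      using pq m k
      by (simp add: apr_pt \<beta>_left appl_pt E_right right_linear_E_mult bilinear_lmult[OF \<beta>_bilinear])
  qed
  note vk = v_invariants[OF k]
  have "r (v k) = (\<Oplus>j\<in>{..<c}. appl E (v k \<star> x j \<bowtie> y j))"
    unfolding r_def
    by (rule hom_dual[OF MA.abelian_group_axioms addhom_comp[OF insert_hom[OF vk] appl_hom[OF E_right]]])
  also have "\<dots> = (\<Oplus>j\<in>{..<c}. \<beta> k (x j) \<otimes> y j)"
    using k by (intro MA.finsum_cong')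
      (auto simp: v_def insert_pt vk[unfolded v_def] appl_ract E_right E\<beta> appl_dual apr_closed \<beta>_left)
  finally show ?thesis .
qed

text \<open>By \<open>r_v\<close> and \<open>ctr_b_sum\<close>,
  \<open>sum_k \<gamma>_k(r(v_k) q)\<close> becomes \<open>sum_j x_j E(y_j q)\<close>, which is
  \<open>q\<close>.\<close>

lemma sum_apr_r:
  assumes t: "t \<in> carrier T"
  shows "(\<Oplus>\<^bsub>T\<^esub>k\<in>{..<d}. apr (\<gamma> k) (\<one> \<bowtie> r (v k) \<star> t)) = t"
proof (rule T_eqI[OF T.abelian_group_axioms _ addhom_id _ t])
  note \<gamma>l = bilinear_left[OF \<gamma>_bilinear]
  note rv = r_centralizer[OF v_invariants]
  show "(\<lambda>t. \<Oplus>\<^bsub>T\<^esub>k\<in>{..<d}. apr (\<gamma> k) (\<one> \<bowtie> r (v k) \<star> t)) \<in> addhom T T"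
    by (intro addhom_sum T.abelian_group_axioms addhom_comp[OF insert_hom apr_hom])
      (auto simp: centralizer_right_invariants rv \<gamma>l)
  fix p q assume pq: "p \<in> carrier M" "q \<in> carrier M"
  have \<gamma>r: "ctr E (r (v k) \<otimes> q) (b k) = (\<Oplus>j\<in>{..<c}. ctr E (\<beta> k (x j) \<otimes> (y j \<otimes> q)) (b k))"
    if k: "k < d" for k
  proof -
    have "r (v k) \<otimes> q = (\<Oplus>j\<in>{..<c}. (\<beta> k (x j) \<otimes> y j) \<otimes> q)"
      unfolding r_v[OF k] using k pq by (intro MA.finsum_ldistr) auto
    also have "\<dots> = (\<Oplus>j\<in>{..<c}. \<beta> k (x j) \<otimes> (y j \<otimes> q))"
      using k pq by (intro MA.finsum_cong') (auto simp: MA.m_assoc)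
    finally show ?thesis
      using addhom_finsum[OF MA.abelian_group_axioms MA.abelian_group_axioms
          left_linear_hom[OF \<gamma>l[OF k]], of "{..<c}" "\<lambda>j. \<beta> k (x j) \<otimes> (y j \<otimes> q)"] k pq
      by (simp add: Pi_def)
  qed
  have "(\<Oplus>k\<in>{..<d}. ctr E (r (v k) \<otimes> q) (b k)) =
      (\<Oplus>k\<in>{..<d}. \<Oplus>j\<in>{..<c}. ctr E (\<beta> k (x j) \<otimes> (y j \<otimes> q)) (b k))"
    using pq by (intro MA.finsum_cong') (auto simp: \<gamma>r ctr_closed E_left intro!: MA.finsum_closed)
  also have "\<dots> = (\<Oplus>j\<in>{..<c}. \<Oplus>k\<in>{..<d}. ctr E (\<beta> k (x j) \<otimes> (y j \<otimes> q)) (b k))"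
    using pq by (intro MA.finsum_swap) (auto simp: ctr_closed E_left)
  also have "\<dots> = (\<Oplus>j\<in>{..<c}. x j \<otimes> E (y j \<otimes> q))"
    using pq by (intro MA.finsum_cong') (auto simp: ctr_b_sum)
  finally have q: "(\<Oplus>k\<in>{..<d}. ctr E (r (v k) \<otimes> q) (b k)) = q"
    using pq by (simp add: dual_left)
  have "(\<Oplus>\<^bsub>T\<^esub>k\<in>{..<d}. apr (\<gamma> k) (\<one> \<bowtie> r (v k) \<star> p \<bowtie> q)) =
      (\<Oplus>\<^bsub>T\<^esub>k\<in>{..<d}. p \<bowtie> ctr E (r (v k) \<otimes> q) (b k))"
    using pq by (intro T.finsum_cong')
      (auto simp: insert_right_pt rv apr_pt \<gamma>l v_invariants ctr_closed E_left)
  also have "\<dots> = p \<bowtie> q"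
    using pq by (subst pt_sum_right[symmetric]) (auto simp: q v_invariants ctr_closed E_left)
  finally show "(\<Oplus>\<^bsub>T\<^esub>k\<in>{..<d}. apr (\<gamma> k) (\<one> \<bowtie> r (v k) \<star> p \<bowtie> q)) = p \<bowtie> q" .
qed

text \<open>Take \<open>w = v k\<close> in the hypothesis and apply \<open>\<gamma> k\<close> to the
  second factor. Summed over \<open>k\<close>, one side returns \<open>t\<close> by
  \<open>sum_apr_r\<close> and the other is a left multiple of \<open>dual\<close> by
  \<open>sum_apr_v\<close>.\<close>

lemma invariant_eq_lact_dual:
  assumes t: "t \<in> carrier T" and eq: "\<And>w. w \<in> invariants \<Longrightarrow> w \<star> t = \<one> \<bowtie> r w \<star> t"
  shows "t = ctr E \<one> t \<triangleright> dual"
proof -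
  have "t = (\<Oplus>\<^bsub>T\<^esub>k\<in>{..<d}. apr (\<gamma> k) (\<one> \<bowtie> r (v k) \<star> t))"
    using sum_apr_r[OF t] by simp
  also have "\<dots> = (\<Oplus>\<^bsub>T\<^esub>k\<in>{..<d}. apr (\<gamma> k) (v k \<star> t))"
    using t by (intro T.finsum_cong')
      (auto simp: eq[OF v_invariants] apr_closed bilinear_left[OF \<gamma>_bilinear] insert_closed
        centralizer_right_invariants r_centralizer v_invariants)
  finally show ?thesis using sum_apr_v[OF t] by simp
qed

text \<open>A separability element \<open>\<Sum> g\<^sub>1 \<otimes> g\<^sub>2\<close> of the invariant algebra gives \<open>t = \<Sum> g\<^sub>1 r(g\<^sub>2)\<close>, which
  equals \<open>\<tau> \<Sum> x\<^sub>i \<otimes> y\<^sub>i\<close>; then \<open>\<Sum> x\<^sub>i \<tau> \<otimes> y\<^sub>i\<close> is a separability element of the extension.\<close>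

lemma separable_extension_of_separable_invariants:
  assumes sep: "separable_algebra K B"
  shows "separable_extension N M \<iota>"
proof -
  interpret AB: assoc_algebra K B by (rule assoc_algebra_B)
  interpret BE: ring_ext K B "\<lambda>k. k \<odot>\<^bsub>B\<^esub> \<one>\<^bsub>B\<^esub>" by (rule AB.ring_ext_scalars)
  obtain g where g: "BE.casimir g" and \<mu>g: "BE.\<mu> g = \<one>\<^bsub>B\<^esub>"
    using sep separable_algebra_iff[OF assoc_algebra_B] by auto
  note gT = BE.casimir_closed[OF g]
  note Bcl = insert_invariants invariants_closed invariants_ract_centralizer r_centralizer
    scalar_invariants unit_invariants insert_closed
  have r_add: "r (w \<oplus>\<^bsub>T\<^esub> w') = r w \<oplus> r w'" if "w \<in> invariants" "w' \<in> invariants" for w w'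
    using that by (simp add: r_def insert_add_left appl_add E_right insert_closed)
  have r_smult: "r ((k \<odot>\<^bsub>M\<^esub> \<one>) \<triangleright> w) = (k \<odot>\<^bsub>M\<^esub> \<one>) \<otimes> r w" if k: "k \<in> carrier K" and w: "w \<in> invariants" for k w
  proof -
    have "((k \<odot>\<^bsub>M\<^esub> \<one>) \<triangleright> w) \<star> dual = (k \<odot>\<^bsub>M\<^esub> \<one>) \<triangleright> (w \<star> dual)"
      using AB.smult_mult_left[of k w dual] k w casimir_invariants[OF casimir_dual]
      by (simp add: B_simps)
    then show ?thesis
      using appl_lact[OF E, of "k \<odot>\<^bsub>N\<^esub> \<one>\<^bsub>N\<^esub>" "w \<star> dual"] k w
      by (simp add: r_def \<iota>_scalar insert_closed)
  qed
  define L where "L = tensor_lift B (\<lambda>w w'. w \<triangleleft> r w')"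
  have bL: "BE.bal B (\<lambda>w w'. w \<triangleleft> r w')"
  proof (rule BE.balI[OF abelian_group_B])
    fix w k w' assume *: "w \<in> carrier B" "k \<in> carrier K" "w' \<in> carrier B"
    then have w: "w \<in> invariants" "w' \<in> invariants" by (simp_all add: carrier_B)
    have "w \<otimes>\<^bsub>B\<^esub> (k \<odot>\<^bsub>B\<^esub> \<one>\<^bsub>B\<^esub>) = (k \<odot>\<^bsub>M\<^esub> \<one>) \<triangleright> w"
      using AB.smult_mult_right[of k w "\<one>\<^bsub>B\<^esub>"] * AB.r_one[of w] by (simp add: smult_B)
    moreover have "(k \<odot>\<^bsub>B\<^esub> \<one>\<^bsub>B\<^esub>) \<otimes>\<^bsub>B\<^esub> w' = (k \<odot>\<^bsub>M\<^esub> \<one>) \<triangleright> w'"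
      using AB.smult_mult_left[of k "\<one>\<^bsub>B\<^esub>" w'] * AB.l_one[of w'] by (simp add: smult_B)
    moreover have "(k \<odot>\<^bsub>M\<^esub> \<one>) \<triangleright> w = w \<triangleleft> (k \<odot>\<^bsub>M\<^esub> \<one>)"
      using invariants_comm[OF w(1), of "k \<odot>\<^bsub>N\<^esub> \<one>\<^bsub>N\<^esub>"] * by (simp add: \<iota>_scalar)
    ultimately show "(w \<otimes>\<^bsub>B\<^esub> (k \<odot>\<^bsub>B\<^esub> \<one>\<^bsub>B\<^esub>)) \<triangleleft> r w' = w \<triangleleft> r ((k \<odot>\<^bsub>B\<^esub> \<one>\<^bsub>B\<^esub>) \<otimes>\<^bsub>B\<^esub> w')"
      using *(2) w by (simp add: r_smult ract_T_mult invariants_closed)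
  qed (simp_all add: carrier_B add_B Bcl r_add ract_T_add ract_T_add_scalar)
  note L_hom = BE.lift_hom[OF bL, folded L_def]
  have L_pt: "L (BE.pt w w') = w \<triangleleft> r w'" if "w \<in> invariants" "w' \<in> invariants" for w w'
    unfolding L_def using BE.lift_pt[OF bL] that by (simp add: carrier_B)
  have L_inv: "L u \<in> invariants" if "u \<in> carrier BE.T" for u
    using addhom_closed[OF L_hom that] by (simp add: carrier_B)
  have hom_B: "h \<in> addhom B B" if "\<And>w. w \<in> invariants \<Longrightarrow> h w \<in> invariants"
    "\<And>w w'. w \<in> invariants \<Longrightarrow> w' \<in> invariants \<Longrightarrow> h (w \<oplus>\<^bsub>T\<^esub> w') = h w \<oplus>\<^bsub>T\<^esub> h w'" for h
    using that by (intro addhomI) (simp_all add: carrier_B add_B)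
  define t where "t = L g"
  have t: "t \<in> invariants" unfolding t_def by (rule L_inv[OF gT])
  have L_lact: "L (lact BE.T w u) = w \<star> L u" if w: "w \<in> invariants" and u: "u \<in> carrier BE.T" for w u
  proof (rule BE.T_eqI[OF abelian_group_B _ _ _ u])
    have wB: "w \<in> carrier B" using w by (simp add: carrier_B)
    show "(\<lambda>u. L (lact BE.T w u)) \<in> addhom BE.T B"
      by (rule addhom_comp[OF BE.lact_T_hom[OF wB] L_hom])
    show "(\<lambda>u. w \<star> L u) \<in> addhom BE.T B"
      by (rule addhom_comp[OF L_hom hom_B]) (simp_all add: w Bcl insert_add)
    fix p q assume pq: "p \<in> carrier B" "q \<in> carrier B"
    then show "L (lact BE.T w (BE.pt p q)) = w \<star> L (BE.pt p q)"
      using w wB BE.lact_T_pt[OF wB pq]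
      by (simp add: carrier_B mult_B L_pt Bcl insert_ract del: BE.lact_T_pt)
  qed
  \<comment> \<open>By \<open>r_insert\<close>, \<open>r (q \<star> w)\<close> depends on
    \<open>w\<close> only through \<open>r w\<close>. This is the counterpart of evaluating at
    \<open>\<one>\<close> in the endomorphism algebra.\<close>
  have L_ract: "L (ract BE.T u w) = L (ract BE.T u (\<one> \<bowtie> r w))"
    if w: "w \<in> invariants" and u: "u \<in> carrier BE.T" for w u
  proof (rule BE.T_eqI[OF abelian_group_B _ _ _ u])
    have wB: "w \<in> carrier B" and jB: "\<one> \<bowtie> r w \<in> carrier B"
      using w by (simp_all add: carrier_B centralizer_right_invariants r_centralizer)
    show "(\<lambda>u. L (ract BE.T u w)) \<in> addhom BE.T B"
      by (rule addhom_comp[OF BE.ract_T_hom[OF wB] L_hom])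
    show "(\<lambda>u. L (ract BE.T u (\<one> \<bowtie> r w))) \<in> addhom BE.T B"
      by (rule addhom_comp[OF BE.ract_T_hom[OF jB] L_hom])
    fix p q assume pq: "p \<in> carrier B" "q \<in> carrier B"
    then show "L (ract BE.T (BE.pt p q) w) = L (ract BE.T (BE.pt p q) (\<one> \<bowtie> r w))"
      using w wB jB BE.ract_T_pt[OF wB pq] BE.ract_T_pt[OF jB pq]
      by (simp add: carrier_B mult_B L_pt insert_invariants r_insert[of q w] del: BE.ract_T_pt)
  qed
  have "w \<star> t = \<one> \<bowtie> r w \<star> t" if w: "w \<in> invariants" for w
  proof -
    have j: "\<one> \<bowtie> r w \<in> invariants" using w by (simp add: centralizer_right_invariants r_centralizer)
    have "w \<star> t = L (ract BE.T g w)"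
      using L_lact[OF w gT] BE.casimir_comm[OF g, of w] w by (simp add: t_def carrier_B)
    also have "\<dots> = \<one> \<bowtie> r w \<star> t"
      using L_ract[OF w gT] L_lact[OF j gT] BE.casimir_comm[OF g, of "\<one> \<bowtie> r w"] j
      by (simp add: t_def carrier_B)
    finally show ?thesis .
  qed
  then have t_eq: "t = ctr E \<one> t \<triangleright> dual"
    by (intro invariant_eq_lact_dual invariants_closed[OF t])
  define \<tau> where "\<tau> = ctr E \<one> t"
  have \<tau>: "\<tau> \<in> centralizer"
    unfolding \<tau>_def by (rule bilinear_one_centralizer[OF ctr_bilinear[OF E t]])
  note \<tau>M = centralizer_closed[OF \<tau>] and \<tau>i = centralizer_left_invariants[OF \<tau>]
  \<comment> \<open>On \<open>dual\<close>, \<open>r q\<close> acts like \<open>q\<close>, so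
    \<open>L\<close> and the multiplication of \<open>B\<close> cannot be told apart there. The
    normalization of \<open>g\<close> then gives \<open>t \<star> dual = dual\<close>.\<close>
  have "L u \<star> dual = BE.\<mu> u \<star> dual" if u: "u \<in> carrier BE.T" for u
  proof (rule BE.T_eqI[OF T.abelian_group_axioms _ _ _ u])
    have hom: "(\<lambda>w. w \<star> dual) \<in> addhom B T"
      by (intro addhomI) (simp_all add: carrier_B add_B insert_closed insert_add_left)
    show "(\<lambda>u. L u \<star> dual) \<in> addhom BE.T T" by (rule addhom_comp[OF L_hom hom])
    show "(\<lambda>u. BE.\<mu> u \<star> dual) \<in> addhom BE.T T" by (rule addhom_comp[OF BE.\<mu>_hom hom])
    fix p q assume pqB: "p \<in> carrier B" "q \<in> carrier B"
    then have pq: "p \<in> invariants" "q \<in> invariants" by (simp_all add: carrier_B)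
    have "(p \<triangleleft> r q) \<star> dual = (p \<star> \<one> \<bowtie> r q) \<star> dual"
      using pq by (simp add: insert_pt invariants_closed)
    also have "\<dots> = p \<star> q \<star> dual"
      using pq by (simp add: insert_assoc centralizer_right_invariants r_centralizer insert_dual[symmetric])
    finally show "L (BE.pt p q) \<star> dual = BE.\<mu> (BE.pt p q) \<star> dual"
      using pq BE.\<mu>_pt[OF pqB] by (simp add: L_pt mult_B insert_assoc)
  qed
  from this[OF gT] have t_dual: "t \<star> dual = dual"
    using \<mu>g by (simp add: t_def one_B insert_unit_left)
  \<comment> \<open>Inserting \<open>t = \<tau> \<triangleright> dual\<close> into
    \<open>p \<bowtie> q\<close> gives \<open>p \<tau> dual q\<close>, and centrality of
    \<open>dual\<close> collects all factors on the left as \<open>p \<tau> q\<close>.\<close>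
  have "t \<star> w = \<mu> (\<tau> \<bowtie> \<one> \<star> w) \<triangleright> dual" if w: "w \<in> carrier T" for w
  proof (rule T_eqI[OF T.abelian_group_axioms insert_hom[OF t] _ _ w])
    show "(\<lambda>w. \<mu> (\<tau> \<bowtie> \<one> \<star> w) \<triangleright> dual) \<in> addhom T T"
      by (intro addhomI)
        (simp_all add: insert_closed insert_add \<tau>i lift_add[OF bal_mult] lact_T_add_scalar)
    fix p q assume pq: "p \<in> carrier M" "q \<in> carrier M"
    have "t \<star> p \<bowtie> q = p \<triangleright> \<tau> \<triangleright> (dual \<triangleleft> q)"
      using pq \<tau>M unfolding insert_pt[OF t pq]
      by (subst t_eq) (simp add: \<tau>_def[symmetric] lact_ract_T)
    then show "t \<star> p \<bowtie> q = \<mu> (\<tau> \<bowtie> \<one> \<star> p \<bowtie> q) \<triangleright> dual"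
      using pq \<tau>M
      by (simp add: insert_pt \<tau>i \<mu>_pt casimir_comm[OF casimir_dual, symmetric] lact_T_mult)
  qed
  from this[OF dual_closed] have "dual = \<mu> (\<tau> \<bowtie> \<one> \<star> dual) \<triangleright> dual"
    using t_dual by simp
  \<comment> \<open>The factor \<open>dual\<close> is cancelled by contracting with
    \<open>ctr E \<one>\<close>, which is left \<open>M\<close>-linear and sends \<open>dual\<close>
    to \<open>\<one>\<close>.\<close>
  then have "ctr E \<one> dual = ctr E \<one> (\<mu> (\<tau> \<bowtie> \<one> \<star> dual) \<triangleright> dual)" by simp
  then have "\<mu> (\<tau> \<bowtie> \<one> \<star> dual) = \<one>"
    by (simp add: ctr_lact E_left ctr_dual insert_closed \<tau>i)
  then show ?thesis
    using separable_extension_iff insert_casimir[OF \<tau>i casimir_dual] by blast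
qed

end

theorem corollary9p6:
  fixes K :: "('k, 'x) ring_scheme"
    and N :: "('k, 'n) module"
    and M :: "('k, 'm) module"
    and \<iota> :: "'n \<Rightarrow> 'm"
  assumes "field K"
    and "assoc_algebra K N"
    and "assoc_algebra K M"
    and "\<iota> \<in> algebra_hom K N M"
    and "inj_on \<iota> (carrier N)"
    and "frobenius_extension N M \<iota>"
    and "D2_extension N M \<iota>"
    and "separable_algebra K (centralizer_algebra N M \<iota>)"
    and "balanced_extension N M \<iota>"
  shows "(split_extension N M \<iota> \<longleftrightarrow> separable_algebra K (bimodule_End_algebra N M \<iota>)) \<and>
         (separable_extension N M \<iota> \<longleftrightarrow> separable_algebra K (tensor_invariant_algebra N M \<iota>))"
proof -
  interpret algebra_ext K N M \<iota>
    using assms(2-4) by (simp add: algebra_ext_def algebra_ext_axioms_def)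
  obtain d :: nat and b \<beta> where "\<forall>k<d. b k \<in> invariants" "\<forall>k<d. bilinear (\<beta> k)"
    "\<forall>m\<in>carrier M. pt m \<one>\<^bsub>M\<^esub> = (\<Oplus>\<^bsub>T\<^esub>k\<in>{..<d}. ract T (b k) (\<beta> k m))"
    using D2_quasibases[OF assms(7)] by blast
  then interpret depth_two_ext K N M \<iota> d b \<beta>
    by unfold_locales simp_all
  obtain E c x y where
    E: "E \<in> bimodule_hom (carrier N) (carrier N) (ring_bimodule M \<iota> \<iota>) (ring_bimodule N id id)"
    and xy: "x \<in> {..<c::nat} \<rightarrow> carrier M" "y \<in> {..<c} \<rightarrow> carrier M"
    and dual: "\<And>m. m \<in> carrier M \<Longrightarrow> (\<Oplus>\<^bsub>M\<^esub>i\<in>{..<c}. x i \<otimes>\<^bsub>M\<^esub> \<iota> (E (y i \<otimes>\<^bsub>M\<^esub> m))) = m"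
      "\<And>m. m \<in> carrier M \<Longrightarrow> (\<Oplus>\<^bsub>M\<^esub>i\<in>{..<c}. \<iota> (E (m \<otimes>\<^bsub>M\<^esub> x i)) \<otimes>\<^bsub>M\<^esub> y i) = m"
    using assms(6) unfolding frobenius_extension_def by blast
  have Ecl: "E m \<in> carrier N" if "m \<in> carrier M" for m
    using addhom_closed[OF bimodule_hom_add[OF E]] that by (simp add: ring_bimodule_def)
  \<comment> \<open>The Frobenius homomorphism has values in \<open>N\<close>; followed by
    \<open>\<iota>\<close> it becomes a bilinear endomorphism of \<open>M\<close>, the form in which
    the contractions use it.\<close>
  have bil: "bilinear (\<lambda>m. \<iota> (E m))"
    using Ecl addhom_add[OF bimodule_hom_add[OF E]] bimodule_hom_lact[OF E] bimodule_hom_ract[OF E]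
    by (intro bilinearI)
      (simp_all add: ring_bimodule_def id_apply ring_hom_add[OF \<iota>_hom] ring_hom_mult[OF \<iota>_hom])
  have x: "x i \<in> carrier M" and y: "y i \<in> carrier M" if "i < c" for i
    using xy that by auto
  have image: "\<iota> (E m) \<in> \<iota> ` carrier N" if "m \<in> carrier M" for m
    using Ecl[OF that] by (rule imageI)
  interpret frobenius_depth_two_ext K N M \<iota> d b \<beta> "\<lambda>m. \<iota> (E m)" c x y
    by (rule frobenius_depth_two_ext.intro[OF depth_two_ext_axioms
          frobenius_depth_two_ext_axioms.intro[OF bil image x y dual]])
  show ?thesis
    by (rule conjI[OF iffI[OF separable_End_of_split[OF assms(8)] split_of_separable_End[OF assms(9)]]
          iffI[OF separable_invariants_of_separable_extension[OF assms(8)]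
            separable_extension_of_separable_invariants]])
qed

end
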